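(* Let $(S,\mathbb C)$ be a relative Sierpiński carpet (i.e. with $\Omega=\mathbb C$), and $u:S\to\mathbb R$ a (normalized) carpet-harmonic function that is bounded above or below. Then $u$ is constant.
   Context: Relative Sierpiński carpets. Let $\Omega\subset\mathbb C$ be a connected open set and $\{Q_i\}_{i\in\mathbb N}$ open Jordan regions compactly contained in $\Omega$, with pairwise disjoint closures, such that $S:=\Omega\setminus\bigcup_iQ_i$ has empty interior and is locally connected. Then $(S,\Omega)$ is a relative Sierpiński carpet with peripheral disks $Q_i$. Standing assumptions on every relative Sierpiński carpet: (i) $\mathcal H^2(S)=0$; (ii) there is $K_0\ge1$ such that for each $i$ there are concentric balls $B(x,r)\subset Q_i\subset B(x,R)$ with $R/r\le K_0$; (iii) there is $K_1>0$ such that $\mathcal H^2(B(x,r)\cap Q_i)\ge K_1r^2$ for all $i$, $x\in Q_i$, $0<r<\operatorname{diam}(Q_i)$. $\mathcal H^m$ is Hausdorff measure normalized to agree with Lebesgue measure. Notation. $\widehat{\mathbb R}=\mathbb R\cup\{\pm\infty\}$. $V\subset\subset\Omega$: $\overline V$ is compact and contained in $\Omega$. $I_V=\{i:Q_i\cap V\ne\emptyset\}$. $S^\circ$: points of $S$ on no $\partial Q_i$. A path is a continuous map from a bounded interval to $\mathbb C$ with a continuous extension to the closed interval (also its image); it is open if the interval is open; subpaths are restrictions to subintervals. For $g:S\to\widehat{\mathbb R}$: $M_{Q_i}(g)=\sup_{\partial Q_i}g$, $m_{Q_i}(g)=\inf_{\partial Q_i}g$, $\operatorname{osc}_{Q_i}(g)=M_{Q_i}(g)-m_{Q_i}(g)$.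 Moduli of a path family $\Gamma$ in $\Omega$. $\mathrm{mod}_2(\Gamma)=\inf\int\lambda^2d\mathcal H^2$ over Borel $\lambda\ge0$ with $\int_\gamma\lambda\,ds\ge1$ for all $\gamma\in\Gamma$ (with $\int_\gamma\lambda\,ds:=\infty$ if $\gamma$ is not locally rectifiable). Weak modulus $\mathrm{mod}_w(\Gamma)=\inf\sum_i\rho(Q_i)^2$ over non-negative sequences for which there is $\Gamma_0\subset\Gamma$ with $\mathrm{mod}_2(\Gamma_0)=0$ and $\sum_{i:Q_i\cap\gamma\ne\emptyset}\rho(Q_i)\ge1$ for $\gamma\in\Gamma\setminus\Gamma_0$. Strong modulus $\mathrm{mod}_s(\Gamma)$: the same infimum over sequences satisfying this inequality for all $\gamma\in\Gamma$ with $\mathcal H^1(\gamma\cap S)=0$. Sobolev spaces. $\{\rho(Q_i)\}$ is a weak (strong) upper gradient of $g:S\to\widehat{\mathbb R}$ if there is $\Gamma_0$ with $\mathrm{mod}_w(\Gamma_0)=0$ ($\mathrm{mod}_s(\Gamma_0)=0$) such that for all paths $\gamma\subset\Omega$, $\gamma\notin\Gamma_0$, and $x,y\in\gamma\cap S$: $g(x),g(y)\neq\pm\infty$ and $|g(x)-g(y)|\le\sum_{i:Q_i\cap\gamma\ne\emptyset}\rho(Q_i)$. $g\in\mathcal W^{1,2}_{\mathrm{loc}}(S)$ if $M_{Q_i}(g),m_{Q_i}(g)$ are finite for all $i$, $\sum_{i\in I_B}M_{Q_i}(g)^2\operatorname{diam}(Q_i)^2<\infty$ and $\sum_{i\in I_B}\operatorname{osc}_{Q_i}(g)^2<\infty$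 for every ball $B\subset\subset\Omega$, and $\{\operatorname{osc}_{Q_i}(g)\}$ is an upper gradient of $g$; $g\in\mathcal W^{1,2}(S)$ if moreover the sums over all $i\in\mathbb N$ are finite. There is a weak and a strong version; the statement holds for each, with one version fixed throughout. Dirichlet energy: $D_V(g)=\sum_{i\in I_V}\operatorname{osc}_{Q_i}(g)^2$. $u\in\mathcal W^{1,2}_{\mathrm{loc}}(S)$ is carpet-harmonic if $D_V(u)\le D_V(u+\zeta)$ for every open $V\subset\subset\Omega$ and $\zeta\in\mathcal W^{1,2}(S)$ with $\zeta|_{S\setminus V}\equiv0$. Normalized functions. For $g\in\mathcal W^{1,2}_{\mathrm{loc}}(S)$ let $\hat g(Q_i)=M_{Q_i}(g)$. Let $\mathcal G_{\hat g}$ be the family of non-constant paths $\gamma\subset\Omega$ with: $\mathcal H^1(\gamma\cap S)=0$; for every subpath $\gamma'$ of $\gamma$ and $Q_{i_1},Q_{i_2}$ meeting $\gamma'$, $|\hat g(Q_{i_1})-\hat g(Q_{i_2})|\le\sum_{i:Q_i\cap\gamma'\neq\emptyset}\operatorname{osc}_{Q_i}(g)$; $\sum_{i:Q_i\cap\gamma'\ne\emptyset}\operatorname{osc}_{Q_i}(g)<\infty$ for subpaths $\gamma'\subset\subset\Omega$; and, if $\sum_{i\in\mathbb N}\operatorname{osc}_{Q_i}(g)^2<\infty$, also $\sum_{i:Q_i\cap\gamma\ne\emptyset}\operatorname{osc}_{Q_i}(g)<\infty$. A point $x\in S$ is accessible by $\gamma_0$ if $x\in\gamma_0\cap S^\circ$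 (put $\gamma=\gamma_0$), or there is an open subpath $\gamma$ of $\gamma_0$ with $x\in\overline\gamma\setminus\gamma$ and $\gamma\cap Q_{i_0}=\emptyset$ whenever $x\in\partial Q_{i_0}$. The normalized version $\tilde g$ of $g$ is: $\tilde g(x)=\liminf_{Q_i\to x,\,Q_i\cap\gamma\ne\emptyset}\hat g(Q_i)$ if $x$ is accessible by a path $\gamma_0\in\mathcal G_{\hat g}$, where $\gamma=\gamma_0$ if $x\in\gamma_0\cap S^\circ$, and otherwise $\gamma$ is an open subpath of $\gamma_0$ with $x\in\overline\gamma\setminus\gamma$ and $\gamma\cap Q_{i_0}=\emptyset$ whenever $x\in\partial Q_{i_0}$ (the value is independent of $\gamma$); for non-accessible $x\in\partial Q_{i_0}$, $\tilde g(x)=\liminf\tilde g(y)$ as $y\to x$ through accessible $y\in\partial Q_{i_0}$; for all other $x$, $\tilde g(x)=\liminf\tilde g(y)$ as $y\to x$ through accessible $y$. A function is normalized if it equals the normalized version of some function in the Sobolev space. Standing convention: carpet-harmonic functions are normalized. *)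

theory Defs
  imports "HOL-Analysis.Analysis"
begin

section \<open>Hausdorff 1-measure\<close>

text \<open>
  The measure \<open>\<H>\<^sup>2\<close>, being normalized to agree with Lebesgue measure, is rendered throughout by
  \<^const>\<open>lebesgue\<close> (or \<^const>\<open>lborel\<close>, for Borel integrands). For the outer measure
  \<open>\<H>\<^sup>1\<close> that normalization makes the constant in front of the diameters equal to 1.
  Covering sets have to be bounded, since \<^const>\<open>diameter\<close> is 0 on unbounded sets.
\<close>

definition hausdorff_1 :: "complex set \<Rightarrow> ennreal" where
  "hausdorff_1 A =
     (SUP \<delta>\<in>{0<..}. INF E\<in>{E :: nat \<Rightarrow> complex set.
         A \<subseteq> (\<Union>n. E n) \<and> (\<forall>n. bounded (E n) \<and> diameter (E n) \<le> \<delta>)}.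
       \<Sum>n. ennreal (diameter (E n)))"

section \<open>Paths and line integrals\<close>

text \<open>
  A path is a parameter interval together with a map, of which only the values on that interval
  matter. (None of the notions below can tell apart two maps that agree on the interval.)
\<close>

type_synonym curve = "real set \<times> (real \<Rightarrow> complex)"

definition is_curve :: "curve \<Rightarrow> bool" where
  "is_curve \<gamma> \<longleftrightarrow>
     fst \<gamma> \<noteq> {} \<and> is_interval (fst \<gamma>) \<and> bounded (fst \<gamma>) \<and>
     (\<exists>h. continuous_on (closure (fst \<gamma>)) h \<and> (\<forall>t\<in>fst \<gamma>. h t = snd \<gamma> t))"

definition trace :: "curve \<Rightarrow> complex set" where
  "trace \<gamma> = snd \<gamma> ` fst \<gamma>"

definition curves_in :: "complex set \<Rightarrow> curve set" where
  "curves_in \<Omega> = {\<gamma>. is_curve \<gamma> \<and> trace \<gamma> \<subseteq> \<Omega>}"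

definition open_curve :: "curve \<Rightarrow> bool" where
  "open_curve \<gamma> \<longleftrightarrow> open (fst \<gamma>)"

definition subcurve :: "curve \<Rightarrow> curve \<Rightarrow> bool" where
  "subcurve \<gamma>' \<gamma> \<longleftrightarrow>
     fst \<gamma>' \<noteq> {} \<and> is_interval (fst \<gamma>') \<and> fst \<gamma>' \<subseteq> fst \<gamma> \<and> snd \<gamma>' = snd \<gamma>"

definition curve_length :: "(real \<Rightarrow> complex) \<Rightarrow> real \<Rightarrow> real \<Rightarrow> ennreal" where
  "curve_length f a b =
     (SUP ts\<in>{ts. sorted ts \<and> set ts \<subseteq> {a..b}}.
       \<Sum>k<length ts - 1. ennreal (dist (f (ts ! k)) (f (ts ! Suc k))))"

definition locally_rectifiable :: "curve \<Rightarrow> bool" where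
  "locally_rectifiable \<gamma> \<longleftrightarrow>
     (\<forall>a b. a \<le> b \<longrightarrow> {a..b} \<subseteq> fst \<gamma> \<longrightarrow> curve_length (snd \<gamma>) a b < \<infinity>)"

text \<open>
  The arc length parametrization of a rectifiable path on \<open>[a, b]\<close>, meaningful for \<open>s\<close>
  between 0 and the length. The value does not depend on the chosen \<open>t\<close>, as the path is constant
  on any interval on which its length function is.
\<close>

definition arc_length_param :: "(real \<Rightarrow> complex) \<Rightarrow> real \<Rightarrow> real \<Rightarrow> real \<Rightarrow> complex" where
  "arc_length_param f a b s = f (SOME t. t \<in> {a..b} \<and> curve_length f a t = ennreal s)"

definition line_integral :: "(complex \<Rightarrow> ennreal) \<Rightarrow> curve \<Rightarrow> ennreal" where
  "line_integral w \<gamma> =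
     (if locally_rectifiable \<gamma>
      then SUP (a, b)\<in>{(a, b). a \<le> b \<and> {a..b} \<subseteq> fst \<gamma>}.
             \<integral>\<^sup>+ s \<in> {0..enn2real (curve_length (snd \<gamma>) a b)}.
               w (arc_length_param (snd \<gamma>) a b s) \<partial>lborel
      else \<infinity>)"

section \<open>Relative Sierpinski carpets\<close>

definition jordan_region :: "complex set \<Rightarrow> bool" where
  "jordan_region U \<longleftrightarrow>
     (\<exists>c. simple_path c \<and> pathfinish c = pathstart c \<and> U = inside (path_image c))"

definition compactly_contained :: "complex set \<Rightarrow> complex set \<Rightarrow> bool" where
  "compactly_contained V \<Omega> \<longleftrightarrow> compact (closure V) \<and> closure V \<subseteq> \<Omega>"

definition carpet :: "complex set \<Rightarrow> (nat \<Rightarrow> complex set) \<Rightarrow> complex set" where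
  "carpet \<Omega> Q = \<Omega> - (\<Union>i. Q i)"

definition carpet_inner :: "complex set \<Rightarrow> (nat \<Rightarrow> complex set) \<Rightarrow> complex set" where
  "carpet_inner \<Omega> Q = carpet \<Omega> Q - (\<Union>i. frontier (Q i))"

text \<open>The last three conjuncts are the standing assumptions imposed on every carpet.\<close>

definition relative_sierpinski_carpet :: "complex set \<Rightarrow> (nat \<Rightarrow> complex set) \<Rightarrow> bool" where
  "relative_sierpinski_carpet \<Omega> Q \<longleftrightarrow>
     open \<Omega> \<and> connected \<Omega> \<and>
     (\<forall>i. jordan_region (Q i) \<and> compactly_contained (Q i) \<Omega>) \<and>
     (\<forall>i j. i \<noteq> j \<longrightarrow> closure (Q i) \<inter> closure (Q j) = {}) \<and>
     interior (carpet \<Omega> Q) = {} \<and>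
     locally connected (carpet \<Omega> Q) \<and>
     emeasure lebesgue (carpet \<Omega> Q) = 0 \<and>
     (\<exists>K\<^sub>0\<ge>1. \<forall>i. \<exists>x r R. 0 < r \<and> 0 < R \<and> ball x r \<subseteq> Q i \<and> Q i \<subseteq> ball x R \<and> R / r \<le> K\<^sub>0) \<and>
     (\<exists>K\<^sub>1>0. \<forall>i. \<forall>x\<in>Q i. \<forall>r. 0 < r \<longrightarrow> r < diameter (Q i) \<longrightarrow>
        ennreal (K\<^sub>1 * r\<^sup>2) \<le> emeasure lebesgue (ball x r \<inter> Q i))"

text \<open>The index set \<open>I\<^sub>V\<close>; also used with \<open>V\<close> the trace of a path.\<close>

definition hit :: "(nat \<Rightarrow> complex set) \<Rightarrow> complex set \<Rightarrow> nat set" where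
  "hit Q V = {i. Q i \<inter> V \<noteq> {}}"

section \<open>Moduli of path families\<close>

definition mod_2 :: "curve set \<Rightarrow> ennreal" where
  "mod_2 \<Gamma> =
     (INF w\<in>{w :: complex \<Rightarrow> ennreal.
         w \<in> borel_measurable borel \<and> (\<forall>\<gamma>\<in>\<Gamma>. 1 \<le> line_integral w \<gamma>)}.
       \<integral>\<^sup>+ z. (w z)\<^sup>2 \<partial>lborel)"

definition mod_weak :: "(nat \<Rightarrow> complex set) \<Rightarrow> curve set \<Rightarrow> ennreal" where
  "mod_weak Q \<Gamma> =
     (INF \<rho>\<in>{\<rho> :: nat \<Rightarrow> ennreal. \<exists>\<Gamma>\<^sub>0\<subseteq>\<Gamma>. mod_2 \<Gamma>\<^sub>0 = 0 \<and>
         (\<forall>\<gamma>\<in>\<Gamma> - \<Gamma>\<^sub>0. 1 \<le> (\<Sum>\<^sub>\<infinity>i\<in>hit Q (trace \<gamma>). \<rho> i))}.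
       \<Sum>\<^sub>\<infinity>i\<in>UNIV. (\<rho> i)\<^sup>2)"

definition mod_strong :: "complex set \<Rightarrow> (nat \<Rightarrow> complex set) \<Rightarrow> curve set \<Rightarrow> ennreal" where
  "mod_strong \<Omega> Q \<Gamma> =
     (INF \<rho>\<in>{\<rho> :: nat \<Rightarrow> ennreal.
         \<forall>\<gamma>\<in>\<Gamma>. hausdorff_1 (trace \<gamma> \<inter> carpet \<Omega> Q) = 0 \<longrightarrow>
           1 \<le> (\<Sum>\<^sub>\<infinity>i\<in>hit Q (trace \<gamma>). \<rho> i)}.
       \<Sum>\<^sub>\<infinity>i\<in>UNIV. (\<rho> i)\<^sup>2)"

text \<open>All subsequent notions come in a weak and a strong version.\<close>

datatype carpet_version = Weak | Strong

definition carpet_mod ::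
    "carpet_version \<Rightarrow> complex set \<Rightarrow> (nat \<Rightarrow> complex set) \<Rightarrow> curve set \<Rightarrow> ennreal" where
  "carpet_mod v \<Omega> Q \<Gamma> =
     (case v of Weak \<Rightarrow> mod_weak Q \<Gamma> | Strong \<Rightarrow> mod_strong \<Omega> Q \<Gamma>)"

section \<open>Sobolev spaces\<close>

text \<open>
  A function from the carpet to \<open>[-\<infinity>, \<infinity>]\<close> is a total function of which only the values on the
  carpet matter. In the following three definitions \<open>U\<close> is a peripheral disk.
\<close>

definition max_disk :: "complex set \<Rightarrow> (complex \<Rightarrow> ereal) \<Rightarrow> ereal" where
  "max_disk U g = (SUP x\<in>frontier U. g x)"

definition min_disk :: "complex set \<Rightarrow> (complex \<Rightarrow> ereal) \<Rightarrow> ereal" where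
  "min_disk U g = (INF x\<in>frontier U. g x)"

definition osc :: "complex set \<Rightarrow> (complex \<Rightarrow> ereal) \<Rightarrow> ennreal" where
  "osc U g = e2ennreal (max_disk U g - min_disk U g)"

definition upper_gradient ::
    "carpet_version \<Rightarrow> complex set \<Rightarrow> (nat \<Rightarrow> complex set) \<Rightarrow>
     (complex \<Rightarrow> ereal) \<Rightarrow> (nat \<Rightarrow> ennreal) \<Rightarrow> bool" where
  "upper_gradient v \<Omega> Q g \<rho> \<longleftrightarrow>
     (\<exists>\<Gamma>\<^sub>0\<subseteq>curves_in \<Omega>. carpet_mod v \<Omega> Q \<Gamma>\<^sub>0 = 0 \<and>
       (\<forall>\<gamma>\<in>curves_in \<Omega> - \<Gamma>\<^sub>0.
         \<forall>x\<in>trace \<gamma> \<inter> carpet \<Omega> Q. \<forall>y\<in>trace \<gamma> \<inter> carpet \<Omega> Q.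
           \<bar>g x\<bar> \<noteq> \<infinity> \<and> \<bar>g y\<bar> \<noteq> \<infinity> \<and>
           \<bar>g x - g y\<bar> \<le> enn2ereal (\<Sum>\<^sub>\<infinity>i\<in>hit Q (trace \<gamma>). \<rho> i)))"

definition sobolev_sums_finite ::
    "(nat \<Rightarrow> complex set) \<Rightarrow> (complex \<Rightarrow> ereal) \<Rightarrow> nat set \<Rightarrow> bool" where
  "sobolev_sums_finite Q g I \<longleftrightarrow>
     (\<Sum>\<^sub>\<infinity>i\<in>I. e2ennreal ((max_disk (Q i) g)\<^sup>2) * ennreal ((diameter (Q i))\<^sup>2)) < \<infinity> \<and>
     (\<Sum>\<^sub>\<infinity>i\<in>I. (osc (Q i) g)\<^sup>2) < \<infinity>"

definition sobolev_loc ::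
    "carpet_version \<Rightarrow> complex set \<Rightarrow> (nat \<Rightarrow> complex set) \<Rightarrow> (complex \<Rightarrow> ereal) set" where
  "sobolev_loc v \<Omega> Q =
     {g. (\<forall>i. \<bar>max_disk (Q i) g\<bar> \<noteq> \<infinity> \<and> \<bar>min_disk (Q i) g\<bar> \<noteq> \<infinity>) \<and>
         (\<forall>x r. 0 < r \<longrightarrow> compactly_contained (ball x r) \<Omega> \<longrightarrow>
           sobolev_sums_finite Q g (hit Q (ball x r))) \<and>
         upper_gradient v \<Omega> Q g (\<lambda>i. osc (Q i) g)}"

definition sobolev ::
    "carpet_version \<Rightarrow> complex set \<Rightarrow> (nat \<Rightarrow> complex set) \<Rightarrow> (complex \<Rightarrow> ereal) set" where
  "sobolev v \<Omega> Q = {g \<in> sobolev_loc v \<Omega> Q. sobolev_sums_finite Q g UNIV}"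

section \<open>Carpet-harmonic functions\<close>

definition dirichlet_energy ::
    "(nat \<Rightarrow> complex set) \<Rightarrow> complex set \<Rightarrow> (complex \<Rightarrow> ereal) \<Rightarrow> ennreal" where
  "dirichlet_energy Q V g = (\<Sum>\<^sub>\<infinity>i\<in>hit Q V. (osc (Q i) g)\<^sup>2)"

text \<open>
  The energy of \<open>u + \<zeta>\<close> only involves values on the boundaries of the peripheral disks, where both
  functions are finite, so the convention for \<open>\<infinity> + (-\<infinity>)\<close> plays no role.
\<close>

definition carpet_harmonic ::
    "carpet_version \<Rightarrow> complex set \<Rightarrow> (nat \<Rightarrow> complex set) \<Rightarrow> (complex \<Rightarrow> ereal) \<Rightarrow> bool" where
  "carpet_harmonic v \<Omega> Q u \<longleftrightarrow>
     u \<in> sobolev_loc v \<Omega> Q \<and>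
     (\<forall>V. open V \<longrightarrow> compactly_contained V \<Omega> \<longrightarrow>
       (\<forall>\<zeta>\<in>sobolev v \<Omega> Q. (\<forall>x\<in>carpet \<Omega> Q - V. \<zeta> x = 0) \<longrightarrow>
         dirichlet_energy Q V u \<le> dirichlet_energy Q V (\<lambda>x. u x + \<zeta> x)))"

section \<open>Normalized functions\<close>

definition good_curves ::
    "complex set \<Rightarrow> (nat \<Rightarrow> complex set) \<Rightarrow> (complex \<Rightarrow> ereal) \<Rightarrow> curve set" where
  "good_curves \<Omega> Q g =
     {\<gamma> \<in> curves_in \<Omega>.
        \<not> snd \<gamma> constant_on fst \<gamma> \<and>
        hausdorff_1 (trace \<gamma> \<inter> carpet \<Omega> Q) = 0 \<and>
        (\<forall>\<gamma>'. subcurve \<gamma>' \<gamma> \<longrightarrow>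
          (\<forall>i\<in>hit Q (trace \<gamma>'). \<forall>j\<in>hit Q (trace \<gamma>').
            \<bar>max_disk (Q i) g - max_disk (Q j) g\<bar>
              \<le> enn2ereal (\<Sum>\<^sub>\<infinity>k\<in>hit Q (trace \<gamma>'). osc (Q k) g))) \<and>
        (\<forall>\<gamma>'. subcurve \<gamma>' \<gamma> \<longrightarrow> compactly_contained (trace \<gamma>') \<Omega> \<longrightarrow>
          (\<Sum>\<^sub>\<infinity>k\<in>hit Q (trace \<gamma>'). osc (Q k) g) < \<infinity>) \<and>
        ((\<Sum>\<^sub>\<infinity>k\<in>UNIV. (osc (Q k) g)\<^sup>2) < \<infinity> \<longrightarrow>
          (\<Sum>\<^sub>\<infinity>k\<in>hit Q (trace \<gamma>). osc (Q k) g) < \<infinity>)}"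

text \<open>
  \<open>access_curve \<Omega> Q g x \<gamma>\<close>: the point \<open>x\<close> is accessible by some path \<open>\<gamma>\<^sub>0\<close> of the good family,
  and \<open>\<gamma>\<close> is the path along which the limit defining the normalized version at \<open>x\<close> is taken.
\<close>

definition access_curve ::
    "complex set \<Rightarrow> (nat \<Rightarrow> complex set) \<Rightarrow> (complex \<Rightarrow> ereal) \<Rightarrow> complex \<Rightarrow> curve \<Rightarrow> bool" where
  "access_curve \<Omega> Q g x \<gamma> \<longleftrightarrow>
     x \<in> carpet \<Omega> Q \<and>
     (\<exists>\<gamma>\<^sub>0\<in>good_curves \<Omega> Q g.
       if x \<in> trace \<gamma>\<^sub>0 \<inter> carpet_inner \<Omega> Q then \<gamma> = \<gamma>\<^sub>0
       else subcurve \<gamma> \<gamma>\<^sub>0 \<and> open_curve \<gamma> \<and> x \<in> closure (trace \<gamma>) - trace \<gamma> \<and>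
            (\<forall>i. x \<in> frontier (Q i) \<longrightarrow> trace \<gamma> \<inter> Q i = {}))"

definition accessible ::
    "complex set \<Rightarrow> (nat \<Rightarrow> complex set) \<Rightarrow> (complex \<Rightarrow> ereal) \<Rightarrow> complex set" where
  "accessible \<Omega> Q g = {x. \<exists>\<gamma>. access_curve \<Omega> Q g x \<gamma>}"

text \<open>
  The filter of the limit \<open>Q\<^sub>i \<longrightarrow> x\<close>, \<open>Q\<^sub>i \<inter> \<gamma> \<noteq> \<emptyset>\<close>: the disks concerned eventually lie in any
  given ball around \<open>x\<close>.
\<close>

definition disks_to :: "(nat \<Rightarrow> complex set) \<Rightarrow> complex \<Rightarrow> curve \<Rightarrow> nat filter" where
  "disks_to Q x \<gamma> = (INF \<epsilon>\<in>{0<..}. principal {i \<in> hit Q (trace \<gamma>). Q i \<subseteq> ball x \<epsilon>})"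

text \<open>For \<open>g\<close> in the local Sobolev space the value does not depend on the choice of \<open>\<gamma>\<close>.\<close>

definition access_value ::
    "complex set \<Rightarrow> (nat \<Rightarrow> complex set) \<Rightarrow> (complex \<Rightarrow> ereal) \<Rightarrow> complex \<Rightarrow> ereal" where
  "access_value \<Omega> Q g x =
     Liminf (disks_to Q x (SOME \<gamma>. access_curve \<Omega> Q g x \<gamma>)) (\<lambda>i. max_disk (Q i) g)"

definition normalized_version ::
    "complex set \<Rightarrow> (nat \<Rightarrow> complex set) \<Rightarrow> (complex \<Rightarrow> ereal) \<Rightarrow> complex \<Rightarrow> ereal" where
  "normalized_version \<Omega> Q g x =
     (if x \<in> accessible \<Omega> Q g then access_value \<Omega> Q g x
      else if \<exists>i. x \<in> frontier (Q i)
      then Liminf (at x within (accessible \<Omega> Q g \<inter> frontier (Q (THE i. x \<in> frontier (Q i)))))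
             (access_value \<Omega> Q g)
      else Liminf (at x within accessible \<Omega> Q g) (access_value \<Omega> Q g))"

definition normalized ::
    "carpet_version \<Rightarrow> complex set \<Rightarrow> (nat \<Rightarrow> complex set) \<Rightarrow> (complex \<Rightarrow> ereal) \<Rightarrow> bool" where
  "normalized v \<Omega> Q u \<longleftrightarrow>
     (\<exists>g\<in>sobolev_loc v \<Omega> Q. \<forall>x\<in>carpet \<Omega> Q. u x = normalized_version \<Omega> Q g x)"

end

(*
  Caccioppoli argument. Suppose u is bounded below, so that U = u + c >= 1, and compare u with
  u + t eta^2 / U, where eta is a cutoff function. Monotonicity of x + t k / x in x and k bounds the
  oscillation of the competitor on each disk, and the first variation gives
     sum_i (M_i - m_i)^2 min(eta)^2 / (M_i m_i) <= 6 sum_i osc_i(eta)^2,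
  where M_i and m_i are the maximum and the minimum of U on the boundary of the i-th disk. Since the
  disks are fat, averages of cutoffs on widely separated scales make the right-hand side arbitrarily
  small (the plane is parabolic for the carpet energy). Hence u has no oscillation on any disk. Along
  generic horizontal and vertical lines its boundary values then agree on all disks. Finally, u is
  the normalized version of some g: a square around a boundary point of a disk, of a size chosen by a
  length-area argument, ties the value of u there to the value of g on that disk, up to a multiple
  of the oscillation of g, and the oscillations tend to 0 along any limit defining u.
*)
theory Submission
  imports Defs
begin

text \<open>The delicate point of the comparison is that eta^2 / U must lie in the Sobolev space,
  whose definition demands that the boundary oscillations of the test function themselves form an
  upper gradient. Only a cruder bound, by oscillations of u plus diameters, is immediate. It is
  sharpened combinatorially: a curve is replaced by a shortest chain that jumps across the
  boundaries of disks, and the crude bound is spent only on a small tail of the disks. The choice of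
  eta^2 / U reflects one-sided boundedness: it is the test function for log U and asks for no bound
  on U from the other side away from the disk under study. No continuity of u is available, and g is
  tied to u only by the normalization formula, so its values on disks must be compared with the
  common boundary value of u from scratch. Squares rather than circles occur because Fubini gives
  control on axis-parallel lines. The weak and the strong version differ only in the curves exempt
  from the admissibility inequality; once this notion is isolated, nearly all arguments are common
  to both.\<close>

section \<open>Sums in the extended non-negative reals\<close>

text \<open>The definitions use \<open>infsum\<close>; the counting-measure integral brings in
  monotonicity, interchange of sums and Cauchy-Schwarz without summability conditions.\<close>

lemma infsum_ennreal_eq_nn_integral:
  fixes f :: "'i \<Rightarrow> ennreal"
  shows "infsum f A = (\<integral>\<^sup>+i. f i \<partial>count_space A)"
proof -
  have "infsum f A = (SUP F\<in>{F. finite F \<and> F \<subseteq> A}. sum f F)"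
    by (rule nonneg_infsum_complete) simp
  also have "\<dots> = (\<integral>\<^sup>+i. f i \<partial>count_space A)"
  proof (rule antisym)
    show "(SUP F\<in>{F. finite F \<and> F \<subseteq> A}. sum f F) \<le> (\<integral>\<^sup>+i. f i \<partial>count_space A)"
    proof (rule SUP_least, clarify)
      fix F assume F: "finite F" "F \<subseteq> A"
      have "sum f F = (\<integral>\<^sup>+i. f i \<partial>count_space F)"
        using F by (simp add: nn_integral_count_space_finite)
      also have "\<dots> = (\<integral>\<^sup>+i. f i * indicator F i \<partial>count_space A)"
        using F by (subst nn_integral_count_space_indicator[of F], simp)
          (subst nn_integral_count_space_indicator[of A], simp,
            auto intro!: nn_integral_cong simp: indicator_def)
      also have "\<dots> \<le> (\<integral>\<^sup>+i. f i \<partial>count_space A)"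
        by (intro nn_integral_mono) (auto simp: indicator_def)
      finally show "sum f F \<le> (\<integral>\<^sup>+i. f i \<partial>count_space A)" .
    qed
    show "(\<integral>\<^sup>+i. f i \<partial>count_space A) \<le> (SUP F\<in>{F. finite F \<and> F \<subseteq> A}. sum f F)"
      unfolding nn_integral_def
    proof (rule SUP_least, clarify)
      fix g assume g: "simple_function (count_space A) g" "g \<le> f"
      have fin: "finite (g ` A)" using g(1) by (simp add: simple_function_def)
      show "integral\<^sup>S (count_space A) g \<le> (SUP F\<in>{F. finite F \<and> F \<subseteq> A}. sum f F)"
      proof (cases "finite {i\<in>A. g i \<noteq> 0}")
        case True
        have "integral\<^sup>S (count_space A) g = (\<integral>\<^sup>+i. g i \<partial>count_space A)"
          using g(1) by (simp add: nn_integral_eq_simple_integral)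
        also have "\<dots> = (\<Sum>i\<in>{i\<in>A. g i \<noteq> 0}. g i)"
          using nn_integral_count_space[OF , of A g] True by (simp add: zero_less_iff_neq_zero)
        also have "\<dots> \<le> (\<Sum>i\<in>{i\<in>A. g i \<noteq> 0}. f i)"
          using g(2) by (intro sum_mono) (auto simp: le_fun_def)
        also have "\<dots> \<le> (SUP F\<in>{F. finite F \<and> F \<subseteq> A}. sum f F)"
          using True by (intro SUP_upper) auto
        finally show ?thesis .
      next
        case False
        \<comment> \<open>A simple function with infinite support takes one of its finitely many
          nonzero values infinitely often, so the finite partial sums of \<open>f\<close> are
          unbounded.\<close>
        have "\<exists>c\<in>g ` A - {0}. infinite {i\<in>A. g i = c}"
        proof (rule ccontr)
          assume "\<not> ?thesis"
          then have "finite (\<Union>c\<in>g ` A - {0}. {i\<in>A. g i = c})" using fin by auto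
          moreover have "{i\<in>A. g i \<noteq> 0} \<subseteq> (\<Union>c\<in>g ` A - {0}. {i\<in>A. g i = c})" by auto
          ultimately show False using False finite_subset by blast
        qed
        then obtain c where c: "c \<noteq> 0" "infinite {i\<in>A. g i = c}" by auto
        have "(\<Sum>\<^sub>\<infinity>i\<in>{i\<in>A. g i = c}. f i) = \<infinity>"
          by (rule infsum_superconst_infinite_ennreal[where b=c])
            (use c g(2) in \<open>auto simp: le_fun_def zero_less_iff_neq_zero\<close>)
        then have "(SUP F\<in>{F. finite F \<and> F \<subseteq> {i\<in>A. g i = c}}. sum f F) = \<infinity>"
          by (subst nonneg_infsum_complete[symmetric]) auto
        moreover have "(SUP F\<in>{F. finite F \<and> F \<subseteq> {i\<in>A. g i = c}}. sum f F)
            \<le> (SUP F\<in>{F. finite F \<and> F \<subseteq> A}. sum f F)"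
          by (intro SUP_subset_mono) auto
        ultimately have "(SUP F\<in>{F. finite F \<and> F \<subseteq> A}. sum f F) = \<infinity>"
          by (metis infinity_ennreal_def top_unique)
        then show ?thesis by (metis infinity_ennreal_def top_greatest)
      qed
    qed
  qed
  finally show ?thesis .
qed

lemma infsum_ennreal_indicator:
  fixes f :: "'i \<Rightarrow> ennreal"
  shows "infsum f A = (\<integral>\<^sup>+i. f i * indicator A i \<partial>count_space UNIV)"
  by (simp add: infsum_ennreal_eq_nn_integral nn_integral_count_space_indicator)

lemma infsum_mono_ennreal:
  fixes f :: "'i \<Rightarrow> ennreal"
  assumes "A \<subseteq> B" "\<And>i. i \<in> A \<Longrightarrow> f i \<le> g i"
  shows "infsum f A \<le> infsum g B"
  unfolding infsum_ennreal_indicator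
  by (intro nn_integral_mono) (use assms in \<open>auto simp: indicator_def\<close>)

lemma infsum_add_ennreal:
  fixes f :: "'i \<Rightarrow> ennreal"
  shows "(\<Sum>\<^sub>\<infinity>i\<in>A. f i + g i) = infsum f A + infsum g A"
  unfolding infsum_ennreal_eq_nn_integral by (intro nn_integral_add) auto

lemma infsum_cmult_ennreal:
  fixes f :: "'i \<Rightarrow> ennreal"
  shows "(\<Sum>\<^sub>\<infinity>i\<in>A. c * f i) = c * infsum f A"
  unfolding infsum_ennreal_eq_nn_integral by (intro nn_integral_cmult) auto

lemma infsum_Un_le_ennreal:
  fixes f :: "'i \<Rightarrow> ennreal"
  shows "infsum f (A \<union> B) \<le> infsum f A + infsum f B"
  unfolding infsum_ennreal_indicator
  by (subst nn_integral_add[symmetric]) (auto intro!: nn_integral_mono simp: indicator_def)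

lemma infsum_zero_outside_ennreal:
  fixes f :: "'i \<Rightarrow> ennreal"
  assumes "A \<subseteq> B" "\<And>i. i \<in> B - A \<Longrightarrow> f i = 0"
  shows "infsum f B = infsum f A"
  unfolding infsum_ennreal_indicator
  by (intro nn_integral_cong) (use assms in \<open>auto simp: indicator_def\<close>)

lemma infsum_ge_member_ennreal:
  fixes f :: "'i \<Rightarrow> ennreal"
  assumes "i \<in> A"
  shows "f i \<le> infsum f A"
  using infsum_mono_ennreal[of "{i}" A f f] assms by simp

lemma infsum_le_iff_ennreal:
  fixes f :: "'i \<Rightarrow> ennreal"
  shows "infsum f A \<le> c \<longleftrightarrow> (\<forall>F. finite F \<and> F \<subseteq> A \<longrightarrow> sum f F \<le> c)"
  by (subst nonneg_infsum_complete) (auto simp: SUP_le_iff)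

lemma infsum_tail_ennreal:
  fixes f :: "'i \<Rightarrow> ennreal"
  assumes "infsum f A < \<infinity>" "0 < e"
  obtains F where "finite F" "F \<subseteq> A" "infsum f (A - F) < e"
proof -
  \<comment> \<open>\<open>e'\<close> leaves room for the strict inequality in the conclusion, as
    splitting off \<open>F\<close> only gives a non-strict one.\<close>
  obtain e' where e': "0 < e'" "e' < e" using dense[OF assms(2)] by blast
  have "\<exists>F. finite F \<and> F \<subseteq> A \<and> infsum f A \<le> sum f F + e'"
  proof (cases "infsum f A = 0")
    case True
    then show ?thesis by (intro exI[of _ "{}"]) auto
  next
    case False
    then have "infsum f A - e' < infsum f A"
      using assms e' by (simp add: ennreal_between zero_less_iff_neq_zero)
    then obtain F where "finite F" "F \<subseteq> A" "infsum f A - e' < sum f F"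
      by (subst (asm) (2) nonneg_infsum_complete) (auto simp: less_SUP_iff)
    then show ?thesis
      by (auto intro!: exI[of _ F] dest!: order.strict_implies_order simp: ennreal_minus_le_iff add.commute)
  qed
  then obtain F where F: "finite F" "F \<subseteq> A" "infsum f A \<le> sum f F + e'" by blast
  have "sum f F + infsum f (A - F) = infsum f F + infsum f (A - F)" using F by simp
  also have "\<dots> = infsum f A"
    using F unfolding infsum_ennreal_indicator
    by (subst nn_integral_add[symmetric]) (auto intro!: nn_integral_cong simp: indicator_def)
  finally have "sum f F + infsum f (A - F) \<le> sum f F + e'" using F by simp
  moreover have "sum f F < \<infinity>"
    using infsum_mono_ennreal[of F A f f] F assms(1) by (simp add: order_le_less_trans)
  ultimately have "infsum f (A - F) \<le> e'"
    by (auto simp: ennreal_add_left_cancel_le)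
  then show ?thesis using that F e' by (meson order_le_less_trans)
qed

lemma infsum_Cauchy_Schwarz_ennreal:
  fixes f g :: "'i \<Rightarrow> ennreal"
  shows "(\<Sum>\<^sub>\<infinity>i\<in>A. f i * g i)\<^sup>2 \<le> (\<Sum>\<^sub>\<infinity>i\<in>A. (f i)\<^sup>2) * (\<Sum>\<^sub>\<infinity>i\<in>A. (g i)\<^sup>2)"
  unfolding infsum_ennreal_eq_nn_integral by (intro Cauchy_Schwarz_nn_integral) auto

lemma nn_integral_infsum:
  fixes f :: "nat \<Rightarrow> 'a \<Rightarrow> ennreal"
  assumes "\<And>i. f i \<in> borel_measurable M"
  shows "(\<integral>\<^sup>+x. (\<Sum>\<^sub>\<infinity>i\<in>A. f i x) \<partial>M) = (\<Sum>\<^sub>\<infinity>i\<in>A. \<integral>\<^sup>+x. f i x \<partial>M)"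
proof -
  have eq: "(\<Sum>\<^sub>\<infinity>i\<in>A. g i) = (\<Sum>i. g i * indicator A i)" for g :: "nat \<Rightarrow> ennreal"
    by (simp add: infsum_ennreal_indicator nn_integral_count_space_nat)
  have "(\<integral>\<^sup>+x. (\<Sum>\<^sub>\<infinity>i\<in>A. f i x) \<partial>M) = (\<integral>\<^sup>+x. (\<Sum>i. f i x * indicator A i) \<partial>M)"
    by (simp add: eq)
  also have "\<dots> = (\<Sum>i. \<integral>\<^sup>+x. f i x * indicator A i \<partial>M)"
    using assms by (intro nn_integral_suminf) auto
  also have "\<dots> = (\<Sum>i. (\<integral>\<^sup>+x. f i x \<partial>M) * indicator A i)"
    using assms by (simp add: nn_integral_multc)
  finally show ?thesis using eq by simp
qed

lemma borel_measurable_infsum_ennreal [measurable (raw)]: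
  fixes f :: "nat \<Rightarrow> 'a \<Rightarrow> ennreal"
  assumes [measurable]: "\<And>i. f i \<in> borel_measurable M"
  shows "(\<lambda>x. \<Sum>\<^sub>\<infinity>i\<in>A. f i x) \<in> borel_measurable M"
  unfolding infsum_ennreal_indicator nn_integral_count_space_nat by measurable

text \<open>Each product \<open>a m * a n\<close> is at most the larger of the two squares. Taking
  suprema instead of sums of countably many weights is what makes energies add, so that countable
  unions of null families are null.\<close>

lemma Sup_square_le_suminf:
  fixes a :: "nat \<Rightarrow> ennreal"
  shows "(SUP n. a n)\<^sup>2 \<le> (\<Sum>n. (a n)\<^sup>2)"
proof -
  have le: "(a n)\<^sup>2 \<le> (\<Sum>n. (a n)\<^sup>2)" for n
    using sum_le_suminf[of "\<lambda>n. (a n)\<^sup>2" "{n}"] by simp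
  have "a m * a n \<le> (\<Sum>n. (a n)\<^sup>2)" for m n
  proof (cases "a m \<le> a n")
    case True
    then have "a m * a n \<le> (a n)\<^sup>2"
      by (simp add: power2_eq_square mult_right_mono)
    then show ?thesis using le[of n] by (rule order_trans)
  next
    case False
    then have "a m * a n \<le> (a m)\<^sup>2"
      by (simp add: power2_eq_square mult_left_mono)
    then show ?thesis using le[of m] by (rule order_trans)
  qed
  then show ?thesis
    by (simp add: power2_eq_square SUP_mult_right_ennreal SUP_mult_left_ennreal SUP_le_iff)
qed

lemma infsum_Sup_square_le:
  fixes r :: "nat \<Rightarrow> 'i \<Rightarrow> ennreal"
  shows "(\<Sum>\<^sub>\<infinity>i\<in>A. (SUP n. r n i)\<^sup>2) \<le> (\<Sum>n. \<Sum>\<^sub>\<infinity>i\<in>A. (r n i)\<^sup>2)"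
proof -
  have "(\<Sum>\<^sub>\<infinity>i\<in>A. (SUP n. r n i)\<^sup>2) \<le> (\<Sum>\<^sub>\<infinity>i\<in>A. \<Sum>n. (r n i)\<^sup>2)"
    by (intro infsum_mono_ennreal Sup_square_le_suminf) auto
  also have "\<dots> = (\<Sum>n. \<Sum>\<^sub>\<infinity>i\<in>A. (r n i)\<^sup>2)"
    unfolding infsum_ennreal_eq_nn_integral by (intro nn_integral_suminf) auto
  finally show ?thesis .
qed

section \<open>Null families of curves\<close>

lemma hit_mono: "X \<subseteq> Y \<Longrightarrow> hit Q X \<subseteq> hit Q Y"
  by (auto simp: hit_def)

lemma trace_mono: "subcurve \<gamma>' \<gamma> \<Longrightarrow> trace \<gamma>' \<subseteq> trace \<gamma>"
  by (auto simp: subcurve_def trace_def)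

lemma line_integral_mono:
  assumes "\<And>z. w z \<le> w' z"
  shows "line_integral w \<gamma> \<le> line_integral w' \<gamma>"
  unfolding line_integral_def
  by (auto intro!: SUP_mono' nn_integral_mono mult_right_mono assms)

lemma line_integral_subcurve_le:
  assumes "subcurve \<gamma>' \<gamma>"
  shows "line_integral w \<gamma>' \<le> line_integral w \<gamma>"
proof (cases "locally_rectifiable \<gamma>")
  case True
  have "locally_rectifiable \<gamma>'"
    using True assms unfolding locally_rectifiable_def subcurve_def by (metis order_trans)
  then show ?thesis
    using True assms unfolding line_integral_def subcurve_def
    by (auto intro!: SUP_subset_mono)
qed (simp add: line_integral_def)

lemma INF_ennreal_eq_0_iff:
  fixes f :: "'a \<Rightarrow> ennreal"
  shows "(INF x\<in>A. f x) = 0 \<longleftrightarrow> (\<forall>e>0. \<exists>x\<in>A. f x \<le> ennreal e)"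
proof
  assume L: "(INF x\<in>A. f x) = 0"
  show "\<forall>e>0. \<exists>x\<in>A. f x \<le> ennreal e"
  proof (intro allI impI)
    fix e :: real assume "0 < e"
    then have "(INF x\<in>A. f x) < ennreal e" using L by simp
    then obtain x where "x \<in> A" "f x < ennreal e" unfolding INF_less_iff by (elim bexE)
    then show "\<exists>x\<in>A. f x \<le> ennreal e" by (intro bexI[of _ x] less_imp_le)
  qed
next
  assume R: "\<forall>e>0. \<exists>x\<in>A. f x \<le> ennreal e"
  have "(INF x\<in>A. f x) \<le> 0 + ennreal e" if e: "e > 0" for e
  proof -
    obtain x where "x \<in> A" "f x \<le> ennreal e" using R[THEN spec, THEN mp, OF e] by (elim bexE)
    then show ?thesis unfolding add_0 by (rule INF_lower2)
  qed
  then have "(INF x\<in>A. f x) \<le> 0" by (rule ennreal_le_epsilon)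
  then show "(INF x\<in>A. f x) = 0" by simp
qed

lemma mod_2_eq_0_iff:
  "mod_2 \<Gamma> = 0 \<longleftrightarrow> (\<forall>e>0. \<exists>w. w \<in> borel_measurable borel \<and>
     (\<forall>\<gamma>\<in>\<Gamma>. 1 \<le> line_integral w \<gamma>) \<and> (\<integral>\<^sup>+ z. (w z)\<^sup>2 \<partial>lborel) \<le> ennreal e)"
  unfolding mod_2_def INF_ennreal_eq_0_iff by blast

text \<open>A weight admissible for a subcurve is admissible for the whole curve. This later
  upgrades statements about generic curves to statements about all their subcurves.\<close>

lemma mod_2_eq_0_mono:
  assumes "mod_2 \<Gamma>' = 0" "\<And>\<gamma>. \<gamma> \<in> \<Gamma> \<Longrightarrow> \<exists>\<gamma>'\<in>\<Gamma>'. subcurve \<gamma>' \<gamma> \<or> \<gamma>' = \<gamma>"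
  shows "mod_2 \<Gamma> = 0"
  unfolding mod_2_eq_0_iff
proof (intro allI impI)
  fix e :: real assume "0 < e"
  then obtain w where w: "w \<in> borel_measurable borel" "\<forall>\<gamma>\<in>\<Gamma>'. 1 \<le> line_integral w \<gamma>"
      "(\<integral>\<^sup>+ z. (w z)\<^sup>2 \<partial>lborel) \<le> ennreal e"
    using assms(1)[unfolded mod_2_eq_0_iff, THEN spec, THEN mp, OF \<open>0 < e\<close>] by (elim exE conjE)
  have "1 \<le> line_integral w \<gamma>" if "\<gamma> \<in> \<Gamma>" for \<gamma>
    using assms(2)[OF that] w(2) line_integral_subcurve_le[of _ \<gamma> w] order_trans by blast
  then show "\<exists>w. w \<in> borel_measurable borel \<and>
     (\<forall>\<gamma>\<in>\<Gamma>. 1 \<le> line_integral w \<gamma>) \<and> (\<integral>\<^sup>+ z. (w z)\<^sup>2 \<partial>lborel) \<le> ennreal e"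
    using w by blast
qed

lemma suminf_ennreal_geometric_half:
  "e \<ge> 0 \<Longrightarrow> (\<Sum>n. ennreal (e * (1 / 2) ^ Suc n)) = ennreal e"
  using sums_mult[OF power_half_series, of e] by (intro suminf_ennreal_eq) auto

text \<open>The families get weights of geometrically decreasing energy, and the pointwise supremum
  of the weights serves all of them.\<close>

lemma mod_2_UN_eq_0:
  assumes "\<And>n::nat. mod_2 (\<Gamma> n) = 0"
  shows "mod_2 (\<Union>n. \<Gamma> n) = 0"
  unfolding mod_2_eq_0_iff
proof (intro allI impI)
  fix e :: real assume e: "0 < e"
  have "\<forall>n. \<exists>w. w \<in> borel_measurable borel \<and> (\<forall>\<gamma>\<in>\<Gamma> n. 1 \<le> line_integral w \<gamma>) \<and>
      (\<integral>\<^sup>+ z. (w z)\<^sup>2 \<partial>lborel) \<le> ennreal (e * (1 / 2) ^ Suc n)"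
    by (intro allI, rule assms[unfolded mod_2_eq_0_iff, rule_format]) (use e in simp)
  then obtain w where w: "\<forall>n. w n \<in> borel_measurable borel \<and> (\<forall>\<gamma>\<in>\<Gamma> n. 1 \<le> line_integral (w n) \<gamma>) \<and>
      (\<integral>\<^sup>+ z. (w n z)\<^sup>2 \<partial>lborel) \<le> ennreal (e * (1 / 2) ^ Suc n)"
    by (rule choice[THEN exE])
  then have [measurable]: "\<And>n. w n \<in> borel_measurable borel"
    and adm: "\<And>n \<gamma>. \<gamma> \<in> \<Gamma> n \<Longrightarrow> 1 \<le> line_integral (w n) \<gamma>"
    and int: "\<And>n. (\<integral>\<^sup>+ z. (w n z)\<^sup>2 \<partial>lborel) \<le> ennreal (e * (1 / 2) ^ Suc n)"
    by blast+
  show "\<exists>w. w \<in> borel_measurable borel \<and> (\<forall>\<gamma>\<in>(\<Union>n. \<Gamma> n). 1 \<le> line_integral w \<gamma>) \<and>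
      (\<integral>\<^sup>+ z. (w z)\<^sup>2 \<partial>lborel) \<le> ennreal e"
  proof (intro exI conjI ballI)
    show "(\<lambda>z. SUP n. w n z) \<in> borel_measurable borel" by measurable
    show "1 \<le> line_integral (\<lambda>z. SUP n. w n z) \<gamma>" if asm: "\<gamma> \<in> (\<Union>n. \<Gamma> n)" for \<gamma>
    proof -
      obtain n where "\<gamma> \<in> \<Gamma> n" using asm by blast
      then have "1 \<le> line_integral (w n) \<gamma>" by (rule adm)
      also have "\<dots> \<le> line_integral (\<lambda>z. SUP n. w n z) \<gamma>"
        by (intro line_integral_mono SUP_upper UNIV_I)
      finally show ?thesis .
    qed
    have "(\<integral>\<^sup>+ z. (SUP n. w n z)\<^sup>2 \<partial>lborel) \<le> (\<integral>\<^sup>+ z. (\<Sum>n. (w n z)\<^sup>2) \<partial>lborel)"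
      by (intro nn_integral_mono Sup_square_le_suminf)
    also have "\<dots> = (\<Sum>n. \<integral>\<^sup>+ z. (w n z)\<^sup>2 \<partial>lborel)"
      by (intro nn_integral_suminf) measurable
    also have "\<dots> \<le> (\<Sum>n. ennreal (e * (1 / 2) ^ Suc n))"
      by (intro suminf_le int) auto
    finally show "(\<integral>\<^sup>+ z. (SUP n. w n z)\<^sup>2 \<partial>lborel) \<le> ennreal e"
      unfolding suminf_ennreal_geometric_half[OF less_imp_le[OF e]] .
  qed
qed

section \<open>Exempt families: one treatment of weak and strong null families\<close>

lemma hausdorff_1_mono:
  assumes "A \<subseteq> B"
  shows "hausdorff_1 A \<le> hausdorff_1 B"
  unfolding hausdorff_1_def
  by (intro SUP_mono' INF_superset_mono order_refl) (use assms in blast)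

text \<open>The curves that need not satisfy the inequality defining the admissible weights.\<close>

definition exempt :: "carpet_version \<Rightarrow> complex set \<Rightarrow> (nat \<Rightarrow> complex set) \<Rightarrow> curve set \<Rightarrow> bool" where
  "exempt v \<Omega> Q \<Gamma> \<longleftrightarrow>
     (case v of Weak \<Rightarrow> mod_2 \<Gamma> = 0
      | Strong \<Rightarrow> (\<forall>\<gamma>\<in>\<Gamma>. hausdorff_1 (trace \<gamma> \<inter> carpet \<Omega> Q) \<noteq> 0))"

lemma exempt_mono:
  assumes "exempt v \<Omega> Q \<Gamma>'" "\<And>\<gamma>. \<gamma> \<in> \<Gamma> \<Longrightarrow> \<exists>\<gamma>'\<in>\<Gamma>'. subcurve \<gamma>' \<gamma> \<or> \<gamma>' = \<gamma>"
  shows "exempt v \<Omega> Q \<Gamma>"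
proof (cases v)
  case Strong
  have "hausdorff_1 (trace \<gamma> \<inter> carpet \<Omega> Q) \<noteq> 0" if that': "\<gamma> \<in> \<Gamma>" for \<gamma>
  proof -
    obtain \<gamma>' where "\<gamma>' \<in> \<Gamma>'" "subcurve \<gamma>' \<gamma> \<or> \<gamma>' = \<gamma>" using assms(2)[OF that'] by blast
    then have "hausdorff_1 (trace \<gamma>' \<inter> carpet \<Omega> Q) \<noteq> 0" "trace \<gamma>' \<subseteq> trace \<gamma>"
      using assms(1) Strong by (auto simp: exempt_def subcurve_def trace_def)
    then show ?thesis
      using hausdorff_1_mono[OF Int_mono[OF _ order_refl], of "trace \<gamma>'" "trace \<gamma>" "carpet \<Omega> Q"] by auto
  qed
  then show ?thesis using Strong by (simp add: exempt_def)
qed (use assms mod_2_eq_0_mono[of \<Gamma>' \<Gamma>] in \<open>simp add: exempt_def\<close>)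

lemma exempt_UN:
  assumes "\<And>n::nat. exempt v \<Omega> Q (\<Gamma> n)"
  shows "exempt v \<Omega> Q (\<Union>n. \<Gamma> n)"
  using assms by (cases v) (auto simp: exempt_def mod_2_UN_eq_0)

text \<open>One description for both versions. In the weak case \<open>\<Gamma>\<^sub>0\<close> may
  leave \<open>\<Gamma>\<close>, as its intersection with \<open>\<Gamma>\<close> is still null; in
  the strong case the witness is the family of all curves whose part in the carpet has nonzero
  Hausdorff measure.\<close>

lemma carpet_mod_eq_0_iff:
  "carpet_mod v \<Omega> Q \<Gamma> = 0 \<longleftrightarrow> (\<forall>e>0. \<exists>\<rho> \<Gamma>\<^sub>0. exempt v \<Omega> Q \<Gamma>\<^sub>0 \<and>
     (\<forall>\<gamma>\<in>\<Gamma> - \<Gamma>\<^sub>0. 1 \<le> (\<Sum>\<^sub>\<infinity>i\<in>hit Q (trace \<gamma>). \<rho> i)) \<and>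
     (\<Sum>\<^sub>\<infinity>i\<in>UNIV. (\<rho> i)\<^sup>2) \<le> ennreal e)"
proof -
  define Adm where "Adm = {\<rho> :: nat \<Rightarrow> ennreal. \<exists>\<Gamma>\<^sub>0. exempt v \<Omega> Q \<Gamma>\<^sub>0 \<and>
     (\<forall>\<gamma>\<in>\<Gamma> - \<Gamma>\<^sub>0. 1 \<le> (\<Sum>\<^sub>\<infinity>i\<in>hit Q (trace \<gamma>). \<rho> i))}"
  have eq: "carpet_mod v \<Omega> Q \<Gamma> = (INF \<rho>\<in>Adm. \<Sum>\<^sub>\<infinity>i\<in>UNIV. (\<rho> i)\<^sup>2)"
  proof (cases v)
    case Weak
    have *: "mod_2 (\<Gamma> \<inter> \<Gamma>\<^sub>0) = 0" if "mod_2 \<Gamma>\<^sub>0 = 0" for \<Gamma>\<^sub>0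
      using that mod_2_eq_0_mono[of \<Gamma>\<^sub>0 "\<Gamma> \<inter> \<Gamma>\<^sub>0"] by blast
    have "\<rho> \<in> Adm \<longleftrightarrow> (\<exists>\<Gamma>\<^sub>0\<subseteq>\<Gamma>. mod_2 \<Gamma>\<^sub>0 = 0 \<and>
         (\<forall>\<gamma>\<in>\<Gamma> - \<Gamma>\<^sub>0. 1 \<le> (\<Sum>\<^sub>\<infinity>i\<in>hit Q (trace \<gamma>). \<rho> i)))" (is "_ \<longleftrightarrow> ?R") for \<rho>
    proof -
      have "?R" if asm: "\<rho> \<in> Adm"
      proof -
        obtain \<Gamma>\<^sub>0 where "mod_2 \<Gamma>\<^sub>0 = 0" "\<forall>\<gamma>\<in>\<Gamma> - \<Gamma>\<^sub>0. 1 \<le> (\<Sum>\<^sub>\<infinity>i\<in>hit Q (trace \<gamma>). \<rho> i)"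
          using asm Weak by (auto simp: Adm_def exempt_def)
        then show ?thesis
          using * by (intro exI[of _ "\<Gamma> \<inter> \<Gamma>\<^sub>0"]) auto
      qed
      then show ?thesis
        using Weak by (auto simp: Adm_def exempt_def)
    qed
    then have "Adm = {\<rho>. \<exists>\<Gamma>\<^sub>0\<subseteq>\<Gamma>. mod_2 \<Gamma>\<^sub>0 = 0 \<and>
         (\<forall>\<gamma>\<in>\<Gamma> - \<Gamma>\<^sub>0. 1 \<le> (\<Sum>\<^sub>\<infinity>i\<in>hit Q (trace \<gamma>). \<rho> i))}" by blast
    then show ?thesis using Weak by (simp add: carpet_mod_def mod_weak_def)
  next
    case Strong
    then have "Adm = {\<rho>. \<forall>\<gamma>\<in>\<Gamma>. hausdorff_1 (trace \<gamma> \<inter> carpet \<Omega> Q) = 0 \<longrightarrow>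
           1 \<le> (\<Sum>\<^sub>\<infinity>i\<in>hit Q (trace \<gamma>). \<rho> i)}"
      unfolding Adm_def exempt_def
      by (auto intro!: exI[of _ "{\<gamma>. hausdorff_1 (trace \<gamma> \<inter> carpet \<Omega> Q) \<noteq> 0}"])
    then show ?thesis using Strong by (simp add: carpet_mod_def mod_strong_def)
  qed
  show ?thesis
    unfolding eq INF_ennreal_eq_0_iff unfolding Adm_def by blast
qed

lemma carpet_mod_eq_0_mono:
  assumes "carpet_mod v \<Omega> Q \<Gamma>' = 0" "\<And>\<gamma>. \<gamma> \<in> \<Gamma> \<Longrightarrow> \<exists>\<gamma>'\<in>\<Gamma>'. subcurve \<gamma>' \<gamma> \<or> \<gamma>' = \<gamma>"
  shows "carpet_mod v \<Omega> Q \<Gamma> = 0"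
  unfolding carpet_mod_eq_0_iff
proof (intro allI impI)
  fix e :: real assume "0 < e"
  from assms(1)[unfolded carpet_mod_eq_0_iff, THEN spec, THEN mp, OF this]
  obtain \<rho> \<Gamma>\<^sub>0 where *: "exempt v \<Omega> Q \<Gamma>\<^sub>0"
      "\<forall>\<gamma>\<in>\<Gamma>' - \<Gamma>\<^sub>0. 1 \<le> (\<Sum>\<^sub>\<infinity>i\<in>hit Q (trace \<gamma>). \<rho> i)"
      "(\<Sum>\<^sub>\<infinity>i\<in>UNIV. (\<rho> i)\<^sup>2) \<le> ennreal e"
    by (elim exE conjE)
  \<comment> \<open>Curves containing an exempt curve are exempt in both versions: line integrals
    and Hausdorff measure grow with the curve.\<close>
  define \<Gamma>\<^sub>1 where "\<Gamma>\<^sub>1 = {\<gamma>. \<exists>\<gamma>'\<in>\<Gamma>\<^sub>0. subcurve \<gamma>' \<gamma> \<or> \<gamma>' = \<gamma>}"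
  have "exempt v \<Omega> Q \<Gamma>\<^sub>1"
    using *(1) by (rule exempt_mono) (auto simp: \<Gamma>\<^sub>1_def)
  moreover have "1 \<le> (\<Sum>\<^sub>\<infinity>i\<in>hit Q (trace \<gamma>). \<rho> i)" if asm: "\<gamma> \<in> \<Gamma> - \<Gamma>\<^sub>1" for \<gamma>
  proof -
    obtain \<gamma>' where \<gamma>': "\<gamma>' \<in> \<Gamma>'" "subcurve \<gamma>' \<gamma> \<or> \<gamma>' = \<gamma>" using assms(2)[of \<gamma>] asm by blast
    then have "\<gamma>' \<notin> \<Gamma>\<^sub>0" using asm unfolding \<Gamma>\<^sub>1_def by blast
    then have "1 \<le> (\<Sum>\<^sub>\<infinity>i\<in>hit Q (trace \<gamma>'). \<rho> i)" using bspec[OF *(2)] \<gamma>'(1) by (meson DiffI)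
    also have "\<dots> \<le> (\<Sum>\<^sub>\<infinity>i\<in>hit Q (trace \<gamma>). \<rho> i)"
      using \<gamma>'(2) trace_mono[of \<gamma>' \<gamma>] by (intro infsum_mono_ennreal hit_mono) auto
    finally show ?thesis .
  qed
  ultimately show "\<exists>\<rho> \<Gamma>\<^sub>0. exempt v \<Omega> Q \<Gamma>\<^sub>0 \<and>
     (\<forall>\<gamma>\<in>\<Gamma> - \<Gamma>\<^sub>0. 1 \<le> (\<Sum>\<^sub>\<infinity>i\<in>hit Q (trace \<gamma>). \<rho> i)) \<and>
     (\<Sum>\<^sub>\<infinity>i\<in>UNIV. (\<rho> i)\<^sup>2) \<le> ennreal e"
    using *(3) by blast
qed

lemma carpet_mod_UN_eq_0:
  assumes "\<And>n::nat. carpet_mod v \<Omega> Q (\<Gamma> n) = 0"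
  shows "carpet_mod v \<Omega> Q (\<Union>n. \<Gamma> n) = 0"
  unfolding carpet_mod_eq_0_iff
proof (intro allI impI)
  fix e :: real assume e: "0 < e"
  let ?P = "\<lambda>n \<rho> \<Gamma>\<^sub>0. exempt v \<Omega> Q \<Gamma>\<^sub>0 \<and>
     (\<forall>\<gamma>\<in>\<Gamma> n - \<Gamma>\<^sub>0. 1 \<le> (\<Sum>\<^sub>\<infinity>i\<in>hit Q (trace \<gamma>). \<rho> i)) \<and>
     (\<Sum>\<^sub>\<infinity>i\<in>UNIV. (\<rho> i)\<^sup>2) \<le> ennreal (e * (1 / 2) ^ Suc n)"
  have P: "\<forall>n. \<exists>\<rho> \<Gamma>\<^sub>0. ?P n \<rho> \<Gamma>\<^sub>0"
    by (intro allI, rule assms[unfolded carpet_mod_eq_0_iff, rule_format]) (use e in simp)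
  obtain \<rho> where "\<forall>n. \<exists>\<Gamma>\<^sub>0. ?P n (\<rho> n) \<Gamma>\<^sub>0" using choice[OF P] by (rule exE)
  then obtain \<Gamma>\<^sub>0 where "\<forall>n. ?P n (\<rho> n) (\<Gamma>\<^sub>0 n)" by (rule choice[THEN exE])
  then have ex: "\<And>n. exempt v \<Omega> Q (\<Gamma>\<^sub>0 n)"
    and adm: "\<And>n \<gamma>. \<gamma> \<in> \<Gamma> n - \<Gamma>\<^sub>0 n \<Longrightarrow> 1 \<le> (\<Sum>\<^sub>\<infinity>i\<in>hit Q (trace \<gamma>). \<rho> n i)"
    and en: "\<And>n. (\<Sum>\<^sub>\<infinity>i\<in>UNIV. (\<rho> n i)\<^sup>2) \<le> ennreal (e * (1 / 2) ^ Suc n)"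
    by blast+
  show "\<exists>\<rho> \<Gamma>\<^sub>0. exempt v \<Omega> Q \<Gamma>\<^sub>0 \<and>
     (\<forall>\<gamma>\<in>(\<Union>n. \<Gamma> n) - \<Gamma>\<^sub>0. 1 \<le> (\<Sum>\<^sub>\<infinity>i\<in>hit Q (trace \<gamma>). \<rho> i)) \<and>
     (\<Sum>\<^sub>\<infinity>i\<in>UNIV. (\<rho> i)\<^sup>2) \<le> ennreal e"
  proof (intro exI conjI ballI)
    show "exempt v \<Omega> Q (\<Union>n. \<Gamma>\<^sub>0 n)" using ex by (rule exempt_UN)
    show "1 \<le> (\<Sum>\<^sub>\<infinity>i\<in>hit Q (trace \<gamma>). SUP n. \<rho> n i)" if asm: "\<gamma> \<in> (\<Union>n. \<Gamma> n) - (\<Union>n. \<Gamma>\<^sub>0 n)" for \<gamma>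
    proof -
      obtain n where "\<gamma> \<in> \<Gamma> n - \<Gamma>\<^sub>0 n" using asm by blast
      then have "1 \<le> (\<Sum>\<^sub>\<infinity>i\<in>hit Q (trace \<gamma>). \<rho> n i)" by (rule adm)
      also have "\<dots> \<le> (\<Sum>\<^sub>\<infinity>i\<in>hit Q (trace \<gamma>). SUP n. \<rho> n i)"
        by (intro infsum_mono_ennreal SUP_upper) auto
      finally show ?thesis .
    qed
    have "(\<Sum>\<^sub>\<infinity>i\<in>UNIV. (SUP n. \<rho> n i)\<^sup>2) \<le> (\<Sum>n. \<Sum>\<^sub>\<infinity>i\<in>UNIV. (\<rho> n i)\<^sup>2)"
      by (rule infsum_Sup_square_le)
    also have "\<dots> \<le> (\<Sum>n. ennreal (e * (1 / 2) ^ Suc n))"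
      by (intro suminf_le en) auto
    finally show "(\<Sum>\<^sub>\<infinity>i\<in>UNIV. (SUP n. \<rho> n i)\<^sup>2) \<le> ennreal e"
      unfolding suminf_ennreal_geometric_half[OF less_imp_le[OF e]] .
  qed
qed

lemma carpet_mod_Un_eq_0:
  assumes "carpet_mod v \<Omega> Q \<Gamma> = 0" "carpet_mod v \<Omega> Q \<Gamma>' = 0"
  shows "carpet_mod v \<Omega> Q (\<Gamma> \<union> \<Gamma>') = 0"
proof -
  have "carpet_mod v \<Omega> Q (\<Union>n. case_nat \<Gamma> (\<lambda>_. \<Gamma>') n) = 0"
    by (intro carpet_mod_UN_eq_0) (use assms in \<open>simp split: nat.split\<close>)
  moreover have "\<Gamma> \<union> \<Gamma>' \<subseteq> (\<Union>n. case_nat \<Gamma> (\<lambda>_. \<Gamma>') n)"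
    using UN_upper[of 0 UNIV "case_nat \<Gamma> (\<lambda>_. \<Gamma>')"] UN_upper[of 1 UNIV "case_nat \<Gamma> (\<lambda>_. \<Gamma>')"] by simp
  ultimately show ?thesis using carpet_mod_eq_0_mono[of v \<Omega> Q _ "\<Gamma> \<union> \<Gamma>'"] by blast
qed

lemma carpet_mod_exempt_eq_0:
  assumes "exempt v \<Omega> Q \<Gamma>"
  shows "carpet_mod v \<Omega> Q \<Gamma> = 0"
  unfolding carpet_mod_eq_0_iff using assms by (auto intro!: exI[of _ "\<lambda>_. 0"] exI[of _ \<Gamma>])

lemma exempt_empty [simp]: "exempt v \<Omega> Q {}"
  by (cases v) (auto simp: exempt_def mod_2_eq_0_iff intro!: exI[of _ "\<lambda>_. 0"])

text \<open>Every positive multiple of \<open>\<rho>\<close>, however small, is admissible for this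
  family, because a positive multiple of infinity is infinite.\<close>

lemma carpet_mod_infinite_sum_eq_0:
  assumes "(\<Sum>\<^sub>\<infinity>i\<in>UNIV. (\<rho> i)\<^sup>2) < (\<infinity> :: ennreal)"
  shows "carpet_mod v \<Omega> Q {\<gamma>. (\<Sum>\<^sub>\<infinity>i\<in>hit Q (trace \<gamma>). \<rho> i) = \<infinity>} = 0"
  unfolding carpet_mod_eq_0_iff
proof (intro allI impI)
  fix e :: real assume e: "0 < e"
  obtain E where E: "(\<Sum>\<^sub>\<infinity>i\<in>UNIV. (\<rho> i)\<^sup>2) = ennreal E" "0 \<le> E"
    using assms by (cases "\<Sum>\<^sub>\<infinity>i\<in>UNIV. (\<rho> i)\<^sup>2") auto
  \<comment> \<open>\<open>E + 1\<close> avoids a division by zero when the energy vanishes.\<close>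
  define c where "c = sqrt (e / (E + 1))"
  have c: "0 < c" "c\<^sup>2 * E \<le> e"
    using e E by (auto simp: c_def field_simps)
  show "\<exists>\<rho>' \<Gamma>\<^sub>0. exempt v \<Omega> Q \<Gamma>\<^sub>0 \<and>
     (\<forall>\<gamma>\<in>{\<gamma>. (\<Sum>\<^sub>\<infinity>i\<in>hit Q (trace \<gamma>). \<rho> i) = \<infinity>} - \<Gamma>\<^sub>0.
        1 \<le> (\<Sum>\<^sub>\<infinity>i\<in>hit Q (trace \<gamma>). \<rho>' i)) \<and>
     (\<Sum>\<^sub>\<infinity>i\<in>UNIV. (\<rho>' i)\<^sup>2) \<le> ennreal e"
  proof (intro exI conjI ballI)
    show "exempt v \<Omega> Q {}" by simp
    show "1 \<le> (\<Sum>\<^sub>\<infinity>i\<in>hit Q (trace \<gamma>). ennreal c * \<rho> i)"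
      if "\<gamma> \<in> {\<gamma>. (\<Sum>\<^sub>\<infinity>i\<in>hit Q (trace \<gamma>). \<rho> i) = \<infinity>} - {}" for \<gamma>
      using that c by (simp add: infsum_cmult_ennreal ennreal_mult_top)
    have "(\<Sum>\<^sub>\<infinity>i\<in>UNIV. (ennreal c * \<rho> i)\<^sup>2) = ennreal (c\<^sup>2) * ennreal E"
      using c by (simp add: power_mult_distrib infsum_cmult_ennreal E ennreal_power)
    then show "(\<Sum>\<^sub>\<infinity>i\<in>UNIV. (ennreal c * \<rho> i)\<^sup>2) \<le> ennreal e"
      using c E by (simp flip: ennreal_mult add: ennreal_leI)
  qed
qed

lemma bounded_trace:
  assumes "is_curve \<gamma>"
  shows "bounded (trace \<gamma>)"
proof -
  obtain h where h: "continuous_on (closure (fst \<gamma>)) h" "\<forall>t\<in>fst \<gamma>. h t = snd \<gamma> t" "bounded (fst \<gamma>)"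
    using assms unfolding is_curve_def by blast
  have "compact (closure (fst \<gamma>))" using h(3) by (simp add: compact_closure)
  then have "compact (h ` closure (fst \<gamma>))" by (rule compact_continuous_image[OF h(1)])
  moreover have "snd \<gamma> ` fst \<gamma> = h ` fst \<gamma>" using h(2) by simp
  then have "trace \<gamma> \<subseteq> h ` closure (fst \<gamma>)"
    unfolding trace_def using image_mono[OF closure_subset, of h "fst \<gamma>"] by simp
  ultimately show ?thesis using bounded_subset compact_imp_bounded by blast
qed

text \<open>Square sums are finite only locally, but a curve is bounded: \<open>\<rho>\<close> cut
  off to the disks meeting a large ball agrees with \<open>\<rho>\<close> on all disks met by the
  curve.\<close>

lemma carpet_mod_locally_infinite_sum_eq_0:
  fixes \<rho> :: "nat \<Rightarrow> ennreal"
  assumes "\<And>r. 0 < r \<Longrightarrow> (\<Sum>\<^sub>\<infinity>i\<in>hit Q (ball 0 r). (\<rho> i)\<^sup>2) < \<infinity>"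
  shows "carpet_mod v \<Omega> Q {\<gamma>. is_curve \<gamma> \<and> (\<Sum>\<^sub>\<infinity>i\<in>hit Q (trace \<gamma>). \<rho> i) = \<infinity>} = 0"
proof -
  define \<rho>' where "\<rho>' n i = \<rho> i * indicator (hit Q (ball 0 (real (Suc n)))) i" for n i
  have "carpet_mod v \<Omega> Q (\<Union>n. {\<gamma>. (\<Sum>\<^sub>\<infinity>i\<in>hit Q (trace \<gamma>). \<rho>' n i) = \<infinity>}) = 0"
  proof (intro carpet_mod_UN_eq_0 carpet_mod_infinite_sum_eq_0)
    fix n
    have "(\<Sum>\<^sub>\<infinity>i\<in>UNIV. (\<rho>' n i)\<^sup>2) = (\<Sum>\<^sub>\<infinity>i\<in>hit Q (ball 0 (real (Suc n))). (\<rho> i)\<^sup>2)"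
      unfolding infsum_ennreal_indicator
      by (intro nn_integral_cong) (auto simp: \<rho>'_def indicator_def)
    then show "(\<Sum>\<^sub>\<infinity>i\<in>UNIV. (\<rho>' n i)\<^sup>2) < \<infinity>" using assms[of "real (Suc n)"] by simp
  qed
  then show ?thesis
  proof (rule carpet_mod_eq_0_mono)
    fix \<gamma> assume \<gamma>: "\<gamma> \<in> {\<gamma>. is_curve \<gamma> \<and> (\<Sum>\<^sub>\<infinity>i\<in>hit Q (trace \<gamma>). \<rho> i) = \<infinity>}"
    then obtain r where r: "\<And>z. z \<in> trace \<gamma> \<Longrightarrow> norm z \<le> r"
      using bounded_trace unfolding bounded_iff by blast
    obtain n where "r < real n" using reals_Archimedean2[of r] by blast
    then have "r < real (Suc n)" by simp
    then have "trace \<gamma> \<subseteq> ball 0 (real (Suc n))" using r by fastforce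
    then have "(\<Sum>\<^sub>\<infinity>i\<in>hit Q (trace \<gamma>). \<rho>' n i) = (\<Sum>\<^sub>\<infinity>i\<in>hit Q (trace \<gamma>). \<rho> i)"
      by (intro infsum_cong) (auto simp: \<rho>'_def hit_def indicator_def)
    then have "\<gamma> \<in> (\<Union>n. {\<gamma>. (\<Sum>\<^sub>\<infinity>i\<in>hit Q (trace \<gamma>). \<rho>' n i) = \<infinity>})"
      using \<gamma> by (intro UN_I[of n]) simp_all
    then show "\<exists>\<gamma>'\<in>(\<Union>n. {\<gamma>. (\<Sum>\<^sub>\<infinity>i\<in>hit Q (trace \<gamma>). \<rho>' n i) = \<infinity>}). subcurve \<gamma>' \<gamma> \<or> \<gamma>' = \<gamma>"
      by blast
  qed
qed

section \<open>Packing and length-area estimates\<close>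

text \<open>Chebyshev: the set where \<open>F\<close> is at least 1 has measure at most the
  integral. The null set \<open>N\<close>, which may depend on \<open>e\<close>, makes room for the
  exempt family that accompanies a weight.\<close>

lemma negligible_if_small_integrals:
  fixes E :: "real set"
  assumes "\<And>e. 0 < e \<Longrightarrow> \<exists>F N. F \<in> borel_measurable borel \<and> (\<integral>\<^sup>+h. F h \<partial>lborel) \<le> ennreal e \<and>
    negligible N \<and> (\<forall>h\<in>E - N. 1 \<le> F h)"
  shows "negligible E"
  unfolding negligible_outer_le
proof (intro allI impI)
  fix e :: real assume e: "0 < e"
  obtain F N where [measurable]: "F \<in> borel_measurable borel" and F: "(\<integral>\<^sup>+h. F h \<partial>lborel) \<le> ennreal e"
    and N: "negligible N" and EN: "\<forall>h\<in>E - N. 1 \<le> F h"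
    using assms[OF e] by (elim exE conjE)
  define A where "A = {h. 1 \<le> F h}"
  have [measurable]: "A \<in> sets borel" unfolding A_def by measurable
  have "emeasure lborel A = (\<integral>\<^sup>+h. indicator A h \<partial>lborel)" by simp
  also have "\<dots> \<le> (\<integral>\<^sup>+h. F h \<partial>lborel)"
    by (intro nn_integral_mono) (auto simp: A_def indicator_def)
  finally have A: "emeasure lebesgue A \<le> ennreal e" using F by simp
  then have Am: "A \<in> lmeasurable"
    by (intro fmeasurableI) (auto intro: order_le_less_trans)
  then have mA: "measure lebesgue A \<le> e"
    using A e by (simp add: measure_def enn2real_leI)
  have "N \<in> lmeasurable" "measure lebesgue N = 0"
    using N by (auto simp: negligible_iff_measure)
  then have "A \<union> N \<in> lmeasurable" "measure lebesgue (A \<union> N) \<le> e"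
    using Am mA measure_Un_le[of A lebesgue N] by (auto simp: fmeasurable.Un fmeasurableD)
  moreover have "E \<subseteq> A \<union> N" using EN by (auto simp: A_def)
  ultimately show "\<exists>T. E \<subseteq> T \<and> T \<in> lmeasurable \<and> measure lebesgue T \<le> e" by blast
qed

lemma jordan_region_properties:
  assumes "jordan_region U"
  shows "open U" "connected U" "U \<noteq> {}" "bounded U"
proof -
  obtain c where "simple_path c" "pathfinish c = pathstart c" "U = inside (path_image c)"
    using assms unfolding jordan_region_def by blast
  then show "open U" "connected U" "U \<noteq> {}" "bounded U"
    using Jordan_inside_outside[of c] bounded_inside[of "path_image c"]
    by (auto simp: bounded_simple_path_image)
qed

lemma frontier_subset_closure: "frontier T \<subseteq> closure T"
  by (auto simp: frontier_def)

locale plane_carpet =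
  fixes Q :: "nat \<Rightarrow> complex set"
  assumes carpet: "relative_sierpinski_carpet UNIV Q"
begin

abbreviation "S \<equiv> carpet UNIV Q"

lemma open_Q [simp, intro]: "open (Q i)"
  and connected_Q [simp, intro]: "connected (Q i)"
  and Q_nonempty [simp]: "Q i \<noteq> {}"
  and bounded_Q [simp, intro]: "bounded (Q i)"
  using carpet jordan_region_properties[of "Q i"] by (auto simp: relative_sierpinski_carpet_def)

lemma closure_Q_disjoint: "i \<noteq> j \<Longrightarrow> closure (Q i) \<inter> closure (Q j) = {}"
  using carpet by (auto simp: relative_sierpinski_carpet_def)

lemma Q_disjoint: "z \<in> Q i \<Longrightarrow> z \<in> Q j \<Longrightarrow> i = j"
  using closure_Q_disjoint[of i j] closure_subset[of "Q i"] closure_subset[of "Q j"] by blast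

lemma frontier_Q_disjoint: "z \<in> frontier (Q i) \<Longrightarrow> z \<in> frontier (Q j) \<Longrightarrow> i = j"
  using closure_Q_disjoint[of i j] by (auto simp: frontier_def)

lemma frontier_subset_S: "frontier (Q i) \<subseteq> S"
proof
  fix z assume z: "z \<in> frontier (Q i)"
  have "z \<notin> Q j" for j
  proof (cases "i = j")
    case True
    then show ?thesis using z by (simp add: frontier_def interior_open)
  next
    case False
    then show ?thesis
      using z closure_Q_disjoint[of i j] closure_subset[of "Q j"] by (auto simp: frontier_def)
  qed
  then show "z \<in> S" by (simp add: carpet_def)
qed

lemma frontier_Q_nonempty: "frontier (Q i) \<noteq> {}"
proof
  assume "frontier (Q i) = {}"
  then have "Q i = UNIV" using frontier_eq_empty[of "Q i"] by simp
  then show False using bounded_Q[of i] by (metis not_bounded_UNIV)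
qed

lemma compact_frontier_Q: "compact (frontier (Q i))"
  by (simp add: compact_frontier_bounded)

lemma not_in_S: "z \<notin> S \<Longrightarrow> \<exists>i. z \<in> Q i"
  by (auto simp: carpet_def)

lemma in_S_notin_Q: "z \<in> S \<Longrightarrow> z \<notin> Q i"
  by (auto simp: carpet_def)

lemma closed_S: "closed S"
  unfolding carpet_def by (intro closed_Diff) auto

lemma negligible_S: "negligible S"
  using carpet closed_S by (auto simp: relative_sierpinski_carpet_def negligible_iff_null_sets null_sets_def)

lemma diameter_Q_pos: "0 < diameter (Q i)"
proof -
  obtain z where z: "z \<in> Q i" using Q_nonempty by blast
  then obtain e where e: "e > 0" "ball z e \<subseteq> Q i" using open_Q[of i] open_contains_ball by blast
  have "dist z (z + of_real (e / 2)) = e / 2" using e by (simp add: dist_norm)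
  then have "z + of_real (e / 2) \<in> Q i" using e by (intro subsetD[OF e(2)]) (simp add: dist_norm)
  then have "dist z (z + of_real (e / 2)) \<le> diameter (Q i)"
    using z by (intro diameter_bounded_bound) auto
  then show ?thesis using e by (simp add: dist_norm)
qed

lemma dist_le_diameter_closure:
  assumes "z \<in> closure (Q i)" "w \<in> closure (Q i)"
  shows "dist z w \<le> diameter (Q i)"
  using diameter_bounded_bound[of "closure (Q i)"] assms by (simp add: diameter_closure bounded_closure)

text \<open>Fatness and disjointness: a disk meeting \<open>ball x s\<close> fills, inside
  \<open>ball x (2 * s)\<close>, an area at least comparable to the square of
  \<open>min (diameter (Q i)) s\<close>. Capping the diameter by \<open>s\<close> lets disks much
  larger than the ball be counted too.\<close>

lemma packing:
  obtains C where "0 < C" "\<And>x s. 0 < s \<Longrightarrow>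
    (\<Sum>\<^sub>\<infinity>i\<in>hit Q (ball x s). (ennreal (min (diameter (Q i)) s))\<^sup>2) \<le> ennreal (C * s\<^sup>2)"
proof -
  obtain K where K: "0 < K" "\<And>i x r. x \<in> Q i \<Longrightarrow> 0 < r \<Longrightarrow> r < diameter (Q i) \<Longrightarrow>
      ennreal (K * r\<^sup>2) \<le> emeasure lebesgue (ball x r \<inter> Q i)"
    using carpet unfolding relative_sierpinski_carpet_def by blast
  define V where "V = unit_ball_vol (real DIM(complex))"
  have V: "0 < V" unfolding V_def by simp
  \<comment> \<open>\<open>4 / K\<close> undoes the area bound at radius \<open>a / 2\<close>, and
    \<open>V * 4\<close> is the area of a ball of radius 2. The halved radius provides the strict
    inequality \<open>r < diameter (Q i)\<close> that the fatness condition asks for.\<close>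
  define C where "C = 4 / K * (V * 4)"
  have C: "0 < C" using K V by (simp add: C_def)
  show ?thesis
  proof (rule that[OF C])
    fix x :: complex and s :: real assume s: "0 < s"
    have *: "(ennreal (min (diameter (Q i)) s))\<^sup>2
        \<le> ennreal (4 / K) * emeasure lebesgue (Q i \<inter> ball x (2 * s))" if i: "i \<in> hit Q (ball x s)" for i
    proof -
      define a where "a = min (diameter (Q i)) s"
      have a: "0 < a" using diameter_Q_pos[of i] s by (simp add: a_def)
      obtain z where z: "z \<in> Q i" "z \<in> ball x s" using i by (auto simp: hit_def)
      have "a / 2 < diameter (Q i)" "a / 2 \<le> s" using a by (auto simp: a_def)
      then have le: "ennreal (K * (a / 2)\<^sup>2) \<le> emeasure lebesgue (ball z (a / 2) \<inter> Q i)"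
        using K(2)[OF z(1), of "a / 2"] a by simp
      have "ball z (a / 2) \<subseteq> ball x (2 * s)"
      proof
        fix w assume "w \<in> ball z (a / 2)"
        then show "w \<in> ball x (2 * s)"
          using z(2) \<open>a / 2 \<le> s\<close> dist_triangle[of x w z] by (simp add: dist_commute)
      qed
      then have "emeasure lebesgue (ball z (a / 2) \<inter> Q i) \<le> emeasure lebesgue (Q i \<inter> ball x (2 * s))"
        by (intro emeasure_mono) auto
      with le have "ennreal (4 / K) * ennreal (K * (a / 2)\<^sup>2)
          \<le> ennreal (4 / K) * emeasure lebesgue (Q i \<inter> ball x (2 * s))"
        by (intro mult_left_mono) auto
      moreover have "ennreal (4 / K) * ennreal (K * (a / 2)\<^sup>2) = (ennreal a)\<^sup>2"
        using K a by (simp flip: ennreal_mult add: ennreal_power power2_eq_square)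
      ultimately show ?thesis by (simp add: a_def)
    qed
    have "(\<Sum>\<^sub>\<infinity>i\<in>hit Q (ball x s). (ennreal (min (diameter (Q i)) s))\<^sup>2)
        \<le> (\<Sum>\<^sub>\<infinity>i\<in>UNIV. ennreal (4 / K) * emeasure lebesgue (Q i \<inter> ball x (2 * s)))"
      by (rule infsum_mono_ennreal) (use * in auto)
    also have "\<dots> = ennreal (4 / K) * (\<Sum>i. emeasure lebesgue (Q i \<inter> ball x (2 * s)))"
      by (simp add: infsum_cmult_ennreal infsum_ennreal_eq_nn_integral nn_integral_count_space_nat)
    also have "(\<Sum>i. emeasure lebesgue (Q i \<inter> ball x (2 * s)))
        = emeasure lebesgue (\<Union>i. Q i \<inter> ball x (2 * s))"
    proof (intro suminf_emeasure)
      show "disjoint_family (\<lambda>i. Q i \<inter> ball x (2 * s))"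
        unfolding disjoint_family_on_def using Q_disjoint by blast
    qed auto
    also have "\<dots> \<le> emeasure lebesgue (ball x (2 * s))"
      by (intro emeasure_mono) auto
    also have "\<dots> = ennreal (V * (4 * s\<^sup>2))"
      using s by (simp add: emeasure_ball V_def power_mult_distrib)
    also have "ennreal (4 / K) * \<dots> = ennreal (C * s\<^sup>2)"
      using K V by (simp flip: ennreal_mult add: C_def algebra_simps)
    finally show "(\<Sum>\<^sub>\<infinity>i\<in>hit Q (ball x s). (ennreal (min (diameter (Q i)) s))\<^sup>2) \<le> ennreal (C * s\<^sup>2)"
      by (simp add: mult_left_mono)
  qed
qed

text \<open>Each disk of diameter at least \<open>s\<close> that meets the ball contributes the
  square of \<open>s\<close> to a finite sum. So there are finitely many of them, and the sum of
  their diameters bounds each one.\<close>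

lemma diameter_bound_in_ball:
  assumes "0 < s"
  obtains D where "0 < D" "\<And>i. i \<in> hit Q (ball x s) \<Longrightarrow> diameter (Q i) \<le> D"
proof -
  obtain C where C: "0 < C" "(\<Sum>\<^sub>\<infinity>i\<in>hit Q (ball x s). (ennreal (min (diameter (Q i)) s))\<^sup>2) \<le> ennreal (C * s\<^sup>2)"
    using packing assms by metis
  define J where "J = {i\<in>hit Q (ball x s). s \<le> diameter (Q i)}"
  have "finite J"
  proof (rule ccontr)
    assume "infinite J"
    then have "(\<Sum>\<^sub>\<infinity>i\<in>J. (ennreal (min (diameter (Q i)) s))\<^sup>2) = \<infinity>"
    proof (rule infsum_superconst_infinite_ennreal[where b = "(ennreal s)\<^sup>2", rotated 2])
      show "(ennreal s)\<^sup>2 \<le> (ennreal (min (diameter (Q i)) s))\<^sup>2" if "i \<in> J" for i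
      proof -
        have "min (diameter (Q i)) s = s" using that by (simp add: J_def)
        then show ?thesis by simp
      qed
    qed (use assms in \<open>simp add: ennreal_power\<close>)
    moreover have "(\<Sum>\<^sub>\<infinity>i\<in>J. (ennreal (min (diameter (Q i)) s))\<^sup>2)
        \<le> (\<Sum>\<^sub>\<infinity>i\<in>hit Q (ball x s). (ennreal (min (diameter (Q i)) s))\<^sup>2)"
      by (rule infsum_mono_ennreal) (auto simp: J_def)
    then have "(\<Sum>\<^sub>\<infinity>i\<in>J. (ennreal (min (diameter (Q i)) s))\<^sup>2) \<le> ennreal (C * s\<^sup>2)"
      using C(2) by (rule order_trans)
    ultimately show False by (simp add: top_unique)
  qed
  define D where "D = s + (\<Sum>i\<in>J. diameter (Q i))"
  have nn: "0 \<le> (\<Sum>i\<in>J. diameter (Q i))" by (intro sum_nonneg) (simp add: diameter_ge_0)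
  show ?thesis
  proof (rule that)
    show "0 < D" using assms nn by (simp add: D_def)
    fix i assume i: "i \<in> hit Q (ball x s)"
    show "diameter (Q i) \<le> D"
    proof (cases "i \<in> J")
      case True
      then have "diameter (Q i) \<le> (\<Sum>i\<in>J. diameter (Q i))"
        using \<open>finite J\<close> by (intro member_le_sum) (auto simp: diameter_ge_0)
      then show ?thesis using assms by (simp add: D_def)
    next
      case False
      then show ?thesis using i nn by (simp add: J_def D_def)
    qed
  qed
qed

text \<open>At a radius \<open>t\<close> not below any of the diameters involved, the capped
  diameters of the packing bound are the true ones.\<close>

lemma diameter_square_sum_finite:
  assumes "0 < s"
  shows "(\<Sum>\<^sub>\<infinity>i\<in>hit Q (ball x s). (ennreal (diameter (Q i)))\<^sup>2) < \<infinity>"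
proof -
  obtain D where D: "0 < D" "\<And>i. i \<in> hit Q (ball x s) \<Longrightarrow> diameter (Q i) \<le> D"
    using diameter_bound_in_ball[OF assms] by metis
  obtain C where C: "0 < C" "\<And>x s. 0 < s \<Longrightarrow>
    (\<Sum>\<^sub>\<infinity>i\<in>hit Q (ball x s). (ennreal (min (diameter (Q i)) s))\<^sup>2) \<le> ennreal (C * s\<^sup>2)"
    using packing by metis
  define t where "t = max s D"
  have "(\<Sum>\<^sub>\<infinity>i\<in>hit Q (ball x s). (ennreal (diameter (Q i)))\<^sup>2)
      \<le> (\<Sum>\<^sub>\<infinity>i\<in>hit Q (ball x t). (ennreal (min (diameter (Q i)) t))\<^sup>2)"
  proof (rule infsum_mono_ennreal)
    show "hit Q (ball x s) \<subseteq> hit Q (ball x t)" by (intro hit_mono) (auto simp: t_def)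
    show "(ennreal (diameter (Q i)))\<^sup>2 \<le> (ennreal (min (diameter (Q i)) t))\<^sup>2" if "i \<in> hit Q (ball x s)" for i
    proof -
      have "min (diameter (Q i)) t = diameter (Q i)" using D(2)[OF that] by (simp add: t_def)
      then show ?thesis by simp
    qed
  qed
  also have "\<dots> \<le> ennreal (C * t\<^sup>2)" using C assms by (simp add: t_def)
  finally show ?thesis by (simp add: order_le_less_trans)
qed

text \<open>Length-area method for the fibres of a 1-Lipschitz \<open>\<pi>\<close>. Inside the ball
  a disk is met only by fibres over an interval comparable to its capped diameter, so integration
  over \<open>h\<close> leaves the sum of \<open>\<rho> i\<close> times that length; Cauchy-Schwarz
  and packing finish. \<open>F\<close> is a measurable majorant, obtained by enlarging the
  projections of the disks to intervals.\<close>

lemma length_area: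
  obtains C where "0 < C" "\<And>(\<rho> :: nat \<Rightarrow> ennreal) x s (\<pi> :: complex \<Rightarrow> real). 0 < s \<Longrightarrow>
    (\<And>z w. \<bar>\<pi> z - \<pi> w\<bar> \<le> dist z w) \<Longrightarrow>
    \<exists>F. F \<in> borel_measurable borel \<and>
      (\<forall>h. (\<Sum>\<^sub>\<infinity>i\<in>{i. h \<in> \<pi> ` (Q i \<inter> ball x s)}. \<rho> i) \<le> F h) \<and>
      (\<integral>\<^sup>+h. F h \<partial>lborel)\<^sup>2 \<le> ennreal (C * s\<^sup>2) * (\<Sum>\<^sub>\<infinity>i\<in>hit Q (ball x s). (\<rho> i)\<^sup>2)"
proof -
  obtain C where C: "0 < C" "\<And>x s. 0 < s \<Longrightarrow>
    (\<Sum>\<^sub>\<infinity>i\<in>hit Q (ball x s). (ennreal (min (diameter (Q i)) s))\<^sup>2) \<le> ennreal (C * s\<^sup>2)"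
    using packing by metis
  show ?thesis
  proof (rule that[of "16 * C"])
    show "0 < 16 * C" using C by simp
    fix \<rho> :: "nat \<Rightarrow> ennreal" and x :: complex and s :: real and \<pi> :: "complex \<Rightarrow> real"
    assume s: "0 < s" and lip: "\<And>z w. \<bar>\<pi> z - \<pi> w\<bar> \<le> dist z w"
    define B where "B = ball x s"
    define I where "I = hit Q B"
    define a where "a i = min (diameter (Q i)) s" for i
    have a: "0 \<le> a i" for i using s by (simp add: a_def diameter_ge_0)
    define z where "z i = (SOME z. z \<in> Q i \<inter> B)" for i
    have z: "z i \<in> Q i \<inter> B" if "i \<in> I" for i
    proof -
      have "\<exists>w. w \<in> Q i \<inter> B" using that by (auto simp: I_def hit_def)
      then show ?thesis unfolding z_def by (rule someI_ex)
    qed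
    \<comment> \<open>Two points of \<open>Q i \<inter> B\<close> are at most
      \<open>diameter (Q i)\<close> and at most \<open>2 * s\<close> apart, hence at most
      \<open>2 * a i\<close>. The interval has length \<open>4 * a i\<close>, whose square produces
      the factor 16.\<close>
    define J where "J i = {\<pi> (z i) - 2 * a i .. \<pi> (z i) + 2 * a i}" for i
    have J: "\<pi> ` (Q i \<inter> B) \<subseteq> J i" if "i \<in> I" for i
    proof clarify
      fix w assume w: "w \<in> Q i" "w \<in> B"
      have "dist w (z i) \<le> diameter (Q i)"
        using z[OF that] w by (intro diameter_bounded_bound) auto
      moreover have "dist w (z i) \<le> 2 * s"
        using z[OF that] w dist_triangle2[of w "z i" x] by (simp add: B_def dist_commute)
      ultimately have "dist w (z i) \<le> 2 * a i" using diameter_Q_pos[of i] by (auto simp: a_def min_def)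
      then show "\<pi> w \<in> J i" using lip[of w "z i"] by (auto simp: J_def)
    qed
    define F where "F h = (\<Sum>\<^sub>\<infinity>i\<in>I. \<rho> i * indicator (J i) h)" for h
    show "\<exists>F. F \<in> borel_measurable borel \<and>
      (\<forall>h. (\<Sum>\<^sub>\<infinity>i\<in>{i. h \<in> \<pi> ` (Q i \<inter> ball x s)}. \<rho> i) \<le> F h) \<and>
      (\<integral>\<^sup>+h. F h \<partial>lborel)\<^sup>2 \<le> ennreal (16 * C * s\<^sup>2) * (\<Sum>\<^sub>\<infinity>i\<in>hit Q (ball x s). (\<rho> i)\<^sup>2)"
    proof (intro exI conjI allI)
      show "F \<in> borel_measurable borel" unfolding F_def J_def by measurable
      show "(\<Sum>\<^sub>\<infinity>i\<in>{i. h \<in> \<pi> ` (Q i \<inter> ball x s)}. \<rho> i) \<le> F h" for h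
        unfolding F_def
      proof (rule infsum_mono_ennreal)
        show sub: "{i. h \<in> \<pi> ` (Q i \<inter> ball x s)} \<subseteq> I" by (auto simp: I_def hit_def B_def)
        show "\<rho> i \<le> \<rho> i * indicator (J i) h" if "i \<in> {i. h \<in> \<pi> ` (Q i \<inter> ball x s)}" for i
        proof -
          have "h \<in> J i" using J[of i] that sub by (auto simp: B_def)
          then show ?thesis by simp
        qed
      qed
      have "(\<integral>\<^sup>+h. F h \<partial>lborel) = (\<Sum>\<^sub>\<infinity>i\<in>I. \<integral>\<^sup>+h. \<rho> i * indicator (J i) h \<partial>lborel)"
        unfolding F_def by (intro nn_integral_infsum) (simp add: J_def)
      also have "\<dots> = (\<Sum>\<^sub>\<infinity>i\<in>I. 4 * (\<rho> i * ennreal (a i)))"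
      proof (intro infsum_cong)
        fix i
        have "emeasure lborel (J i) = 4 * ennreal (a i)"
          using a[of i] by (simp add: J_def ennreal_mult'')
        then show "(\<integral>\<^sup>+h. \<rho> i * indicator (J i) h \<partial>lborel) = 4 * (\<rho> i * ennreal (a i))"
          by (simp add: nn_integral_cmult J_def mult_ac)
      qed
      also have "\<dots> = 4 * (\<Sum>\<^sub>\<infinity>i\<in>I. \<rho> i * ennreal (a i))"
        by (simp add: infsum_cmult_ennreal)
      finally have "(\<integral>\<^sup>+h. F h \<partial>lborel)\<^sup>2 = 16 * (\<Sum>\<^sub>\<infinity>i\<in>I. \<rho> i * ennreal (a i))\<^sup>2"
        by (simp add: power_mult_distrib)
      also have "\<dots> \<le> 16 * ((\<Sum>\<^sub>\<infinity>i\<in>I. (\<rho> i)\<^sup>2) * (\<Sum>\<^sub>\<infinity>i\<in>I. (ennreal (a i))\<^sup>2))"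
        by (intro mult_left_mono infsum_Cauchy_Schwarz_ennreal) auto
      also have "\<dots> \<le> 16 * ((\<Sum>\<^sub>\<infinity>i\<in>I. (\<rho> i)\<^sup>2) * ennreal (C * s\<^sup>2))"
        using C(2)[OF s, of x] by (intro mult_left_mono) (auto simp: I_def B_def a_def)
      also have "\<dots> = ennreal (16 * C * s\<^sup>2) * (\<Sum>\<^sub>\<infinity>i\<in>I. (\<rho> i)\<^sup>2)"
        using C by (simp add: ennreal_mult mult_ac)
      finally show "(\<integral>\<^sup>+h. F h \<partial>lborel)\<^sup>2 \<le> ennreal (16 * C * s\<^sup>2) * (\<Sum>\<^sub>\<infinity>i\<in>hit Q (ball x s). (\<rho> i)\<^sup>2)"
        by (simp add: I_def B_def)
    qed
  qed
qed

end

section \<open>Arc length\<close>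

definition chain_length :: "(real \<Rightarrow> complex) \<Rightarrow> real list \<Rightarrow> ennreal" where
  "chain_length f ts = (\<Sum>k<length ts - 1. ennreal (dist (f (ts ! k)) (f (ts ! Suc k))))"

lemma chain_length_simps [simp]:
  "chain_length f [] = 0"
  "chain_length f [x] = 0"
  "chain_length f (x # y # zs) = ennreal (dist (f x) (f y)) + chain_length f (y # zs)"
  by (auto simp: chain_length_def sum.lessThan_Suc_shift simp del: sum.lessThan_Suc)

lemma chain_length_Cons_ge: "chain_length f ts \<le> chain_length f (x # ts)"
  by (cases ts) auto

lemma chain_length_append_ge: "chain_length f us + chain_length f vs \<le> chain_length f (us @ vs)"
proof (induction us)
  case (Cons x us)
  show ?case
  proof (cases us)
    case Nil
    then show ?thesis by (simp add: chain_length_Cons_ge)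
  next
    case (Cons y us')
    then show ?thesis using Cons.IH by (simp add: add.assoc add_left_mono)
  qed
qed simp

lemma chain_length_insert_le:
  "chain_length f (us @ vs) \<le> chain_length f (us @ [b]) + chain_length f (b # vs)"
proof (induction us)
  case Nil
  then show ?case by (simp add: chain_length_Cons_ge)
next
  case (Cons x us)
  show ?case
  proof (cases us)
    case Nil
    show ?thesis
    proof (cases vs)
      case (Cons y vs')
      have "ennreal (dist (f x) (f y)) \<le> ennreal (dist (f x) (f b)) + ennreal (dist (f b) (f y))"
        by (simp flip: ennreal_plus add: dist_triangle ennreal_leI)
      then show ?thesis
        using Nil Cons by (simp flip: add.assoc add: add_right_mono)
    qed (use Nil in simp)
  next
    case (Cons y us')
    then show ?thesis using Cons.IH by (simp add: add.assoc add_left_mono)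
  qed
qed

lemma curve_length_alt:
  "curve_length f a b = (SUP ts\<in>{ts. sorted ts \<and> set ts \<subseteq> {a..b}}. chain_length f ts)"
  by (simp add: curve_length_def chain_length_def)

lemma chain_length_le_curve_length:
  "sorted ts \<Longrightarrow> set ts \<subseteq> {a..b} \<Longrightarrow> chain_length f ts \<le> curve_length f a b"
  unfolding curve_length_alt by (rule SUP_upper) simp

lemma dist_le_curve_length: "a \<le> b \<Longrightarrow> ennreal (dist (f a) (f b)) \<le> curve_length f a b"
  using chain_length_le_curve_length[of "[a, b]" a b f] by simp

lemma curve_length_superadditive:
  assumes "a \<le> b" "b \<le> c"
  shows "curve_length f a b + curve_length f b c \<le> curve_length f a c"
proof -
  have ne: "{ts :: real list. sorted ts \<and> set ts \<subseteq> {x..y}} \<noteq> {}" for x y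
    by (auto intro!: exI[of _ "[]"])
  have "chain_length f ts + chain_length f us \<le> curve_length f a c"
    if "sorted ts \<and> set ts \<subseteq> {a..b}" "sorted us \<and> set us \<subseteq> {b..c}" for ts us
  proof -
    have "sorted (ts @ us)" "set (ts @ us) \<subseteq> {a..c}"
      using that assms by (fastforce simp: sorted_append)+
    then show ?thesis
      using chain_length_append_ge chain_length_le_curve_length order_trans by blast
  qed
  then have "chain_length f ts + curve_length f b c \<le> curve_length f a c"
    if "sorted ts \<and> set ts \<subseteq> {a..b}" for ts
    unfolding curve_length_alt[of f b c] ennreal_SUP_add_right[OF ne]
    using that by (auto intro!: SUP_least)
  then show ?thesis
    unfolding curve_length_alt[of f a b] ennreal_SUP_add_left[OF ne, symmetric]
    by (auto intro!: SUP_least)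
qed

text \<open>For \<open>s = t\<close> a node equal to \<open>s\<close> would fall into both halves,
  so that case is returned separately.\<close>

lemma sorted_split:
  fixes ts :: "real list"
  assumes "sorted ts" "s \<le> t" "set ts \<inter> {s<..<t} = {}"
  obtains us vs where "ts = us @ vs" "sorted us" "sorted vs" "set us \<subseteq> {..s}" "set vs \<subseteq> {t..}"
    | "s = t"
proof (cases "s = t")
  case False
  have "ts = filter (\<lambda>x. x \<le> s) ts @ filter (\<lambda>x. t \<le> x) ts"
    using assms(1,3)
  proof (induction ts)
    case (Cons x ts)
    show ?case
    proof (cases "x \<le> s")
      case True
      then show ?thesis using Cons False assms(2) by auto
    next
      case x: False
      then have "t \<le> x" using Cons.prems by auto
      then have "\<forall>y\<in>set ts. t \<le> y" using Cons.prems by auto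
      then have "filter (\<lambda>y. t \<le> y) ts = ts" "filter (\<lambda>y. y \<le> s) ts = []"
        using False assms(2) by (auto simp: filter_empty_conv filter_id_conv)
      then show ?thesis using \<open>t \<le> x\<close> x by simp
    qed
  qed simp
  then show ?thesis using that(1)[of "filter (\<lambda>x. x \<le> s) ts" "filter (\<lambda>x. t \<le> x) ts"] assms(1)
    by (auto simp: sorted_wrt_filter)
qed (use that in blast)

text \<open>Inserting \<open>s\<close> and \<open>t\<close> as nodes only lengthens the polygon and
  isolates the single edge from \<open>s\<close> to \<open>t\<close>. With \<open>s = t\<close> this
  is subadditivity of length; with \<open>s < t\<close> it drives the continuity of arc
  length.\<close>

lemma chain_length_gap_le:
  assumes "a \<le> s" "s \<le> t" "t \<le> b" "sorted ts" "set ts \<subseteq> {a..b}" "set ts \<inter> {s<..<t} = {}"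
  shows "chain_length f ts \<le> curve_length f a s + ennreal (dist (f s) (f t)) + curve_length f t b"
proof -
  have main: "chain_length f ts \<le> curve_length f a s + ennreal (dist (f s) (f t)) + curve_length f t b"
    if uv: "ts = us @ vs" "sorted us" "sorted vs" "set us \<subseteq> {..s}" "set vs \<subseteq> {t..}" for us vs
  proof -
    have "chain_length f ts \<le> chain_length f (us @ [s]) + chain_length f ([s] @ vs)"
      using chain_length_insert_le[of f us vs s] uv by simp
    also have "\<dots> \<le> chain_length f (us @ [s]) + (chain_length f ([s] @ [t]) + chain_length f (t # vs))"
      by (intro add_left_mono chain_length_insert_le)
    also have "\<dots> \<le> curve_length f a s + (ennreal (dist (f s) (f t)) + curve_length f t b)"
    proof (intro add_mono)
      show "chain_length f (us @ [s]) \<le> curve_length f a s"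
        using uv assms(1,5) by (intro chain_length_le_curve_length) (force simp: sorted_append)+
      show "chain_length f (t # vs) \<le> curve_length f t b"
        using uv assms(3,5) by (intro chain_length_le_curve_length) force+
    qed simp
    finally show ?thesis by (simp add: add.assoc)
  qed
  show ?thesis
  proof (cases "s = t")
    case True
    show ?thesis
    proof (rule main)
      show "ts = filter (\<lambda>x. x \<le> s) ts @ filter (\<lambda>x. s < x) ts"
        using assms(4)
      proof (induction ts)
        case (Cons x ts)
        show ?case
        proof (cases "x \<le> s")
          case False
          then have "\<forall>y\<in>set ts. s < y" using Cons.prems by auto
          then have "filter (\<lambda>y. s < y) ts = ts" "filter (\<lambda>y. y \<le> s) ts = []"
            by (auto simp: filter_empty_conv filter_id_conv)
          then show ?thesis using False by simp
        qed (use Cons in auto)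
      qed simp
    qed (use assms(4) True in \<open>auto simp: sorted_wrt_filter\<close>)
  next
    case False
    then show ?thesis using sorted_split[OF assms(4,2,6)] main by metis
  qed
qed

lemma curve_length_additive:
  assumes "a \<le> b" "b \<le> c"
  shows "curve_length f a c = curve_length f a b + curve_length f b c"
proof (rule antisym)
  show "curve_length f a c \<le> curve_length f a b + curve_length f b c"
    unfolding curve_length_alt[of f a c]
  proof (rule SUP_least)
    fix ts assume "ts \<in> {ts. sorted ts \<and> set ts \<subseteq> {a..c}}"
    then show "chain_length f ts \<le> curve_length f a b + curve_length f b c"
      using chain_length_gap_le[of a b b c ts f] assms by auto
  qed
qed (rule curve_length_superadditive[OF assms])

lemma curve_length_finite_sub:
  assumes "a \<le> s" "s \<le> t" "t \<le> b" "curve_length f a b < \<infinity>"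
  shows "curve_length f s t < \<infinity>"
  using assms curve_length_additive[of a s b f] curve_length_additive[of s t b f]
  by (auto simp: ennreal_add_less_top)

definition arc_length :: "(real \<Rightarrow> complex) \<Rightarrow> real \<Rightarrow> real \<Rightarrow> real" where
  "arc_length f a t = enn2real (curve_length f a t)"

lemma arc_length_diff:
  assumes "a \<le> s" "s \<le> t" "t \<le> b" "curve_length f a b < \<infinity>"
  shows "ennreal (arc_length f a t - arc_length f a s) = curve_length f s t"
    "arc_length f a s \<le> arc_length f a t"
proof -
  have fin: "curve_length f a s < top" "curve_length f s t < top"
    using assms curve_length_finite_sub[of a a s b f] curve_length_finite_sub[of a s t b f] by auto
  then have "arc_length f a t = arc_length f a s + enn2real (curve_length f s t)"
    using curve_length_additive[of a s t f] assms by (simp add: arc_length_def enn2real_plus)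
  then show "ennreal (arc_length f a t - arc_length f a s) = curve_length f s t"
    "arc_length f a s \<le> arc_length f a t"
    using fin by (auto simp: less_top)
qed

lemma dist_le_arc_length_diff:
  assumes "s \<in> {a..b}" "t \<in> {a..b}" "curve_length f a b < \<infinity>"
  shows "dist (f s) (f t) \<le> \<bar>arc_length f a s - arc_length f a t\<bar>"
proof -
  have *: "dist (f s) (f t) \<le> \<bar>arc_length f a s - arc_length f a t\<bar>"
    if "s \<in> {a..b}" "t \<in> {a..b}" "s \<le> t" for s t
  proof -
    have "ennreal (dist (f s) (f t)) \<le> ennreal (arc_length f a t - arc_length f a s)"
      using that assms(3) arc_length_diff(1)[of a s t b f] dist_le_curve_length[of s t f] by auto
    then show ?thesis using arc_length_diff(2)[of a s t b f] that assms(3) by (auto simp: ennreal_le_iff)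
  qed
  show ?thesis
    using *[of s t] *[of t s] assms by (cases "s \<le> t") (auto simp: dist_commute abs_minus_commute)
qed

text \<open>Take a polygon within \<open>e / 2\<close> of the total length. If no node lies strictly
  between \<open>s\<close> and \<open>t\<close>, the polygon sees at most the chord there, so the
  arc between them exceeds the chord by less than \<open>e / 2\<close>.\<close>

lemma continuous_on_arc_length:
  assumes "continuous_on {a..b} f" "curve_length f a b < \<infinity>"
  shows "continuous_on {a..b} (arc_length f a)"
  unfolding continuous_on_iff
proof (intro ballI allI impI)
  fix t\<^sub>0 e :: real assume t\<^sub>0: "t\<^sub>0 \<in> {a..b}" and e: "0 < e"
  have "curve_length f a b < curve_length f a b + ennreal (e / 2)"
    using assms(2) e by (simp add: ennreal_add_left_cancel_less[of _ 0, simplified])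
  moreover have ne: "{ts :: real list. sorted ts \<and> set ts \<subseteq> {a..b}} \<noteq> {}"
    by (auto intro!: exI[of _ "[]"])
  ultimately have "curve_length f a b
      < (SUP ts\<in>{ts. sorted ts \<and> set ts \<subseteq> {a..b}}. chain_length f ts + ennreal (e / 2))"
    unfolding ennreal_SUP_add_left[OF ne] by (simp flip: curve_length_alt)
  then obtain ts where ts: "sorted ts" "set ts \<subseteq> {a..b}"
      "curve_length f a b < chain_length f ts + ennreal (e / 2)"
    unfolding less_SUP_iff by blast
  obtain d where d: "0 < d" "\<And>t. t \<in> {a..b} \<Longrightarrow> dist t t\<^sub>0 < d \<Longrightarrow> dist (f t) (f t\<^sub>0) < e / 2"
    using assms(1) t\<^sub>0 e unfolding continuous_on_iff by (meson half_gt_zero)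
  \<comment> \<open>Closer to \<open>t\<^sub>0\<close> than \<open>d'\<close>, the only possible
    node is \<open>t\<^sub>0\<close> itself, which is harmless as an end of the gap.\<close>
  obtain d' where d': "0 < d'" "\<And>x. x \<in> set ts \<Longrightarrow> x \<noteq> t\<^sub>0 \<Longrightarrow> d' \<le> dist t\<^sub>0 x"
    using finite_set_avoid[of "set ts" t\<^sub>0] by auto
  have key: "arc_length f a t - arc_length f a s < e"
    if st: "a \<le> s" "s \<le> t" "t \<le> b" "dist (f s) (f t) < e / 2" "set ts \<inter> {s<..<t} = {}" for s t
  proof -
    have fin: "curve_length f a s \<noteq> top" "curve_length f s t \<noteq> top" "curve_length f t b \<noteq> top"
      using st assms(2) curve_length_finite_sub[of a a s b f] curve_length_finite_sub[of a s t b f]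
        curve_length_finite_sub[of a t b b f] by auto
    have "curve_length f a s + (curve_length f s t + curve_length f t b)
        < curve_length f a s + ennreal (dist (f s) (f t)) + curve_length f t b + ennreal (e / 2)"
    proof -
      have "curve_length f a s + (curve_length f s t + curve_length f t b) = curve_length f a b"
        using st curve_length_additive[of a s b f] curve_length_additive[of s t b f] by simp
      also have "\<dots> < chain_length f ts + ennreal (e / 2)" by (rule ts(3))
      also have "\<dots> \<le> curve_length f a s + ennreal (dist (f s) (f t)) + curve_length f t b + ennreal (e / 2)"
        by (intro add_right_mono chain_length_gap_le st ts)
      finally show ?thesis .
    qed
    also have "\<dots> = curve_length f a s + ((ennreal (dist (f s) (f t)) + ennreal (e / 2)) + curve_length f t b)"
      by (simp add: add_ac)
    finally have "curve_length f s t + curve_length f t b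
        < (ennreal (dist (f s) (f t)) + ennreal (e / 2)) + curve_length f t b"
      using fin(1) by (simp add: ennreal_add_left_cancel_less)
    then have "curve_length f s t < ennreal (dist (f s) (f t)) + ennreal (e / 2)"
      using fin(3) by (simp add: add.commute[of _ "curve_length f t b"] ennreal_add_left_cancel_less)
    also have "\<dots> \<le> ennreal e"
      using st(4) e by (simp flip: ennreal_plus add: ennreal_leI)
    finally have "ennreal (arc_length f a t - arc_length f a s) < ennreal e"
      using arc_length_diff(1)[of a s t b f] st assms(2) by simp
    then show ?thesis using e by (meson ennreal_leI leD leI)
  qed
  show "\<exists>d>0. \<forall>t\<in>{a..b}. dist t t\<^sub>0 < d \<longrightarrow> dist (arc_length f a t) (arc_length f a t\<^sub>0) < e"
  proof (intro exI[of _ "min d d'"] conjI ballI impI)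
    show "0 < min d d'" using d d' by simp
    fix t assume t: "t \<in> {a..b}" "dist t t\<^sub>0 < min d d'"
    then have ft: "dist (f t) (f t\<^sub>0) < e / 2" using d by simp
    have gap: "set ts \<inter> {min t t\<^sub>0<..<max t t\<^sub>0} = {}"
      using d'(2) t(2) by (force simp: dist_real_def)
    show "dist (arc_length f a t) (arc_length f a t\<^sub>0) < e"
    proof (cases "t \<le> t\<^sub>0")
      case True
      then have "arc_length f a t\<^sub>0 - arc_length f a t < e"
        using key[of t t\<^sub>0] t t\<^sub>0 ft gap by auto
      then show ?thesis
        using arc_length_diff(2)[of a t t\<^sub>0 b f] True t t\<^sub>0 assms(2) by (auto simp: dist_real_def)
    next
      case False
      then have "arc_length f a t - arc_length f a t\<^sub>0 < e"
        using key[of t\<^sub>0 t] t t\<^sub>0 ft gap by (auto simp: dist_commute)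
      then show ?thesis
        using arc_length_diff(2)[of a t\<^sub>0 t b f] False t t\<^sub>0 assms(2) by (auto simp: dist_real_def)
    qed
  qed
qed

text \<open>The choice in \<open>arc_length_param\<close> is immaterial: distances are bounded by
  differences of arc length, so parameters of equal arc length have the same image.\<close>

lemma arc_length_param_arc_length:
  assumes "t \<in> {a..b}" "curve_length f a b < \<infinity>"
  shows "arc_length_param f a b (arc_length f a t) = f t"
proof -
  have eq: "ennreal (arc_length f a t) = curve_length f a t" if "t \<in> {a..b}" for t
    using curve_length_finite_sub[of a a t b f] that assms(2) by (auto simp: arc_length_def less_top)
  define t' where "t' = (SOME t'. t' \<in> {a..b} \<and> curve_length f a t' = ennreal (arc_length f a t))"
  have t': "t' \<in> {a..b} \<and> curve_length f a t' = ennreal (arc_length f a t)"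
    unfolding t'_def by (rule someI[of _ t]) (use assms eq in auto)
  then have "arc_length f a t' = arc_length f a t" by (simp add: arc_length_def)
  then have "f t' = f t"
    using dist_le_arc_length_diff[of t' a b t f] assms t' by simp
  then show ?thesis by (simp add: arc_length_param_def t'_def)
qed

text \<open>On \<open>T\<close> the function \<open>g\<close> factors through \<open>f\<close> as a
  1-Lipschitz function on the line, and such functions preserve null sets.\<close>

lemma negligible_Lipschitz_real_image:
  fixes f :: "'a::metric_space \<Rightarrow> real" and g :: "'a \<Rightarrow> real"
  assumes "negligible (f ` T)" "\<And>x y. x \<in> T \<Longrightarrow> y \<in> T \<Longrightarrow> \<bar>g x - g y\<bar> \<le> \<bar>f x - f y\<bar>"
  shows "negligible (g ` T)"
proof -
  define h where "h y = g (SOME x. x \<in> T \<and> f x = y)" for y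
  have sel: "(SOME x. x \<in> T \<and> f x = y) \<in> T \<and> f (SOME x. x \<in> T \<and> f x = y) = y" if "y \<in> f ` T" for y
    by (rule someI_ex) (use that in auto)
  have h: "h (f x) = g x" if "x \<in> T" for x
  proof -
    have "f x \<in> f ` T" using that by simp
    from sel[OF this] show ?thesis using assms(2)[of "SOME x'. x' \<in> T \<and> f x' = f x" x] that
      by (simp add: h_def)
  qed
  have "negligible (h ` f ` T)"
  proof (rule negligible_locally_Lipschitz_image[OF _ assms(1)])
    fix y assume "y \<in> f ` T"
    then show "\<exists>U B. open U \<and> y \<in> U \<and> (\<forall>z\<in>f ` T \<inter> U. norm (h z - h y) \<le> B * norm (z - y))"
      by (intro exI[of _ UNIV] exI[of _ 1]) (use assms(2) h in auto)
  qed simp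
  moreover have "h ` f ` T = g ` T" using h by (force simp: image_image)
  ultimately show ?thesis by simp
qed

text \<open>A finite integral of the weight that is infinite on \<open>A\<close> forces zero arc
  length on \<open>A\<close>, and \<open>\<pi>\<close> along the curve is 1-Lipschitz in arc length.
  Continuity of arc length makes the set of lengths spent in \<open>A\<close> compact, hence
  measurable.\<close>

lemma negligible_image_if_line_integral_finite:
  assumes "continuous_on {a..b} f" "closed A" "curve_length f a b < \<infinity>" "a \<le> b"
    and "(\<integral>\<^sup>+ s \<in> {0..enn2real (curve_length f a b)}. \<infinity> * indicator A (arc_length_param f a b s) \<partial>lborel) < \<infinity>"
    and "\<And>z w :: complex. \<bar>\<pi> z - \<pi> w\<bar> \<le> dist z w"
  shows "negligible (\<pi> ` (f ` {a..b} \<inter> A))"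
proof -
  define T where "T = {t\<in>{a..b}. f t \<in> A}"
  have "closed T"
    unfolding T_def using continuous_closed_preimage[OF assms(1) _ assms(2)] by (simp add: vimage_def Int_def)
  then have "compact T" unfolding T_def
    by (metis (no_types, lifting) T_def bounded_closed_interval bounded_subset compact_eq_bounded_closed mem_Collect_eq subsetI)
  moreover have "continuous_on T (arc_length f a)"
    using continuous_on_arc_length[OF assms(1,3)] by (rule continuous_on_subset) (auto simp: T_def)
  ultimately have "compact (arc_length f a ` T)" by (intro compact_continuous_image)
  then have [measurable]: "arc_length f a ` T \<in> sets borel" by (simp add: borel_compact)
  have T_range: "arc_length f a ` T \<subseteq> {0..enn2real (curve_length f a b)}"
    using arc_length_diff(2)[of a _ b b f] assms(3) by (force simp: T_def arc_length_def)
  have "\<infinity> * emeasure lborel (arc_length f a ` T)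
      = (\<integral>\<^sup>+ s. \<infinity> * indicator (arc_length f a ` T) s \<partial>lborel)"
    by (simp add: nn_integral_cmult)
  also have "\<dots> \<le> (\<integral>\<^sup>+ s \<in> {0..enn2real (curve_length f a b)}. \<infinity> * indicator A (arc_length_param f a b s) \<partial>lborel)"
  proof (rule nn_integral_mono)
    fix s
    show "(\<infinity>::ennreal) * indicator (arc_length f a ` T) s
        \<le> \<infinity> * indicator A (arc_length_param f a b s) * indicator {0..enn2real (curve_length f a b)} s"
    proof (cases "s \<in> arc_length f a ` T")
      case True
      then have "arc_length_param f a b s \<in> A" "s \<in> {0..enn2real (curve_length f a b)}"
        using arc_length_param_arc_length[of _ a b f] assms(3) T_range by (auto simp: T_def)
      then show ?thesis by simp
    qed simp
  qed
  finally have "\<infinity> * emeasure lborel (arc_length f a ` T) < \<infinity>" using assms(5) by (rule order_le_less_trans)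
  then have "emeasure lborel (arc_length f a ` T) = 0"
    by (auto simp: ennreal_mult_less_top)
  then have "negligible (arc_length f a ` T)"
    by (simp add: negligible_iff_null_sets null_sets_def)
  then have "negligible ((\<lambda>t. \<pi> (f t)) ` T)"
  proof (rule negligible_Lipschitz_real_image)
    show "\<bar>\<pi> (f s) - \<pi> (f t)\<bar> \<le> \<bar>arc_length f a s - arc_length f a t\<bar>" if "s \<in> T" "t \<in> T" for s t
      using dist_le_arc_length_diff[of s a b t f] that assms(3) assms(6)[of "f s" "f t"] by (simp add: T_def)
  qed
  moreover have "\<pi> ` (f ` {a..b} \<inter> A) = (\<lambda>t. \<pi> (f t)) ` T" by (auto simp: T_def)
  ultimately show ?thesis by simp
qed

lemma curve_length_isometric:
  assumes "\<And>s t. dist (f s) (f t) = \<bar>s - t\<bar>" "a \<le> b"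
  shows "curve_length f a b = ennreal (b - a)"
proof (rule antisym)
  have le: "chain_length f (x # ts) \<le> ennreal (b - x)" if "sorted (x # ts)" "set (x # ts) \<subseteq> {..b}" for x ts
    using that
  proof (induction ts arbitrary: x)
    case (Cons y ts)
    have "chain_length f (x # y # ts) \<le> ennreal (y - x) + ennreal (b - y)"
      using Cons assms(1) by (auto intro!: add_mono simp: abs_minus_commute)
    also have "\<dots> = ennreal (b - x)" using Cons.prems by (simp flip: ennreal_plus)
    finally show ?case .
  qed simp
  show "curve_length f a b \<le> ennreal (b - a)"
    unfolding curve_length_alt
  proof (rule SUP_least, clarify)
    fix ts assume ts: "sorted ts" "set ts \<subseteq> {a..b}"
    show "chain_length f ts \<le> ennreal (b - a)"
    proof (cases ts)
      case (Cons x us)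
      then have "chain_length f ts \<le> ennreal (b - x)" using le[of x us] ts by (auto simp: subset_iff)
      also have "\<dots> \<le> ennreal (b - a)" using ts Cons by (intro ennreal_leI) auto
      finally show ?thesis .
    qed simp
  qed
  show "ennreal (b - a) \<le> curve_length f a b"
    using dist_le_curve_length[OF assms(2), of f] assms by simp
qed

lemma line_integral_isometric_le:
  assumes "\<And>s t. dist (f s) (f t) = \<bar>s - t\<bar>" and [measurable]: "w \<in> borel_measurable borel"
    and "continuous_on UNIV f"
  shows "line_integral w ({a..b}, f) \<le> (\<integral>\<^sup>+t\<in>{a..b}. w (f t) \<partial>lborel)"
proof -
  have [measurable]: "f \<in> borel_measurable borel" using assms(3) by (rule borel_measurable_continuous_onI)
  have "(\<integral>\<^sup>+ s \<in> {0..enn2real (curve_length f c d)}. w (arc_length_param f c d s) \<partial>lborel)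
      \<le> (\<integral>\<^sup>+t\<in>{a..b}. w (f t) \<partial>lborel)" if cd: "c \<le> d" "{c..d} \<subseteq> {a..b}" for c d
  proof -
    have al: "arc_length_param f c d s = f (c + s)" if "s \<in> {0..d - c}" for s
    proof -
      have "arc_length f c (c + s) = s"
        using curve_length_isometric[of f c "c + s"] assms(1) that by (simp add: arc_length_def)
      then show ?thesis
        using arc_length_param_arc_length[of "c + s" c d f] curve_length_isometric[of f c d] assms(1) that cd by simp
    qed
    have "(\<integral>\<^sup>+ s \<in> {0..enn2real (curve_length f c d)}. w (arc_length_param f c d s) \<partial>lborel)
        = (\<integral>\<^sup>+ s. w (f (c + s)) * indicator {c..d} (c + s) \<partial>lborel)"
      using curve_length_isometric[of f c d] assms(1) cd al
      by (intro nn_integral_cong) (auto simp: indicator_def)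
    also have "\<dots> = (\<integral>\<^sup>+ s. w (f s) * indicator {c..d} s \<partial>lborel)"
      using nn_integral_real_affine[of "\<lambda>s. w (f s) * indicator {c..d} s" 1 c] by simp
    also have "\<dots> \<le> (\<integral>\<^sup>+t\<in>{a..b}. w (f t) \<partial>lborel)"
      using cd by (intro nn_integral_mono) (auto simp: indicator_def)
    finally show ?thesis .
  qed
  moreover have "locally_rectifiable ({a..b}, f)"
    using curve_length_isometric[of f] assms(1) by (auto simp: locally_rectifiable_def)
  ultimately show ?thesis by (auto simp: line_integral_def intro!: SUP_least)
qed

section \<open>Curves through the carpet and axis-parallel lines\<close>

lemma hausdorff_1_eq_0_cover:
  assumes "hausdorff_1 A = 0" "0 < e"
  obtains E where "A \<subseteq> (\<Union>n::nat. E n)" "\<And>n. bounded (E n)" "(\<Sum>n. ennreal (diameter (E n))) \<le> ennreal e"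
proof -
  let ?C = "{E :: nat \<Rightarrow> complex set. A \<subseteq> (\<Union>n. E n) \<and> (\<forall>n. bounded (E n) \<and> diameter (E n) \<le> 1)}"
  have "(INF E\<in>?C. \<Sum>n. ennreal (diameter (E n))) \<le> hausdorff_1 A"
    unfolding hausdorff_1_def by (rule SUP_upper2[of 1]) auto
  then have "(INF E\<in>?C. \<Sum>n. ennreal (diameter (E n))) = 0" using assms(1) by simp
  then obtain E where "E \<in> ?C" "(\<Sum>n. ennreal (diameter (E n))) \<le> ennreal e"
    unfolding INF_ennreal_eq_0_iff using assms(2) by blast
  then show ?thesis using that by blast
qed

text \<open>A nonempty covering set \<open>E n\<close> projects into the interval of radius
  \<open>diameter (E n)\<close> around the image of one of its points. Needed for coordinate
  projections and for the distance to the centre of a square.\<close>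

lemma negligible_image_if_hausdorff_1_eq_0:
  fixes \<pi> :: "complex \<Rightarrow> real"
  assumes "hausdorff_1 A = 0" "\<And>z w. \<bar>\<pi> z - \<pi> w\<bar> \<le> dist z w"
  shows "negligible (\<pi> ` A)"
proof (rule negligible_if_small_integrals)
  fix e :: real assume "0 < e"
  then obtain E where E: "A \<subseteq> (\<Union>n::nat. E n)" "\<And>n. bounded (E n)"
      "(\<Sum>n. ennreal (diameter (E n))) \<le> ennreal (e / 2)"
    using hausdorff_1_eq_0_cover[OF assms(1), of "e / 2"] by auto
  define z where "z n = (SOME z. z \<in> E n)" for n
  define J where "J n = {\<pi> (z n) - diameter (E n) .. \<pi> (z n) + diameter (E n)}" for n
  have "(\<integral>\<^sup>+h. (\<Sum>n. indicator (J n) h) \<partial>lborel) = (\<Sum>n. 2 * ennreal (diameter (E n)))"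
    by (subst nn_integral_suminf) (auto simp: J_def E(2) diameter_ge_0 ennreal_mult'' simp flip: ennreal_numeral)
  also have "\<dots> = 2 * (\<Sum>n. ennreal (diameter (E n)))" by (rule ennreal_suminf_cmult)
  also have "\<dots> \<le> 2 * ennreal (e / 2)" using E(3) by (intro mult_left_mono) auto
  also have "\<dots> = ennreal e" using \<open>0 < e\<close> by (simp flip: ennreal_numeral ennreal_mult)
  finally have int: "(\<integral>\<^sup>+h. (\<Sum>n. indicator (J n) h) \<partial>lborel) \<le> ennreal e" .
  have "1 \<le> (\<Sum>n. indicator (J n) h :: ennreal)" if h: "h \<in> \<pi> ` A" for h
  proof -
    obtain w n where w: "h = \<pi> w" "w \<in> E n" using h E(1) by blast
    have "z n \<in> E n" unfolding z_def using w(2) by (rule someI)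
    then have "dist w (z n) \<le> diameter (E n)" using w E(2) by (intro diameter_bounded_bound)
    then have "h \<in> J n" using assms(2)[of w "z n"] w by (auto simp: J_def)
    then show ?thesis using sum_le_suminf[of "\<lambda>n. indicator (J n) h :: ennreal" "{n}"] by simp
  qed
  then show "\<exists>F N. F \<in> borel_measurable borel \<and> (\<integral>\<^sup>+h. F h \<partial>lborel) \<le> ennreal e \<and>
    negligible N \<and> (\<forall>h\<in>\<pi> ` A - N. 1 \<le> F h)"
    using int by (intro exI[of _ "\<lambda>h. \<Sum>n. indicator (J n) h"] exI[of _ "{}"]) (auto simp: J_def)
qed

lemma diameter_isometric_image_le:
  fixes f :: "real \<Rightarrow> complex"
  assumes "\<And>s t. dist (f s) (f t) = \<bar>s - t\<bar>" "c \<le> d"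
  shows "bounded (f ` {c..d})" "diameter (f ` {c..d}) \<le> d - c"
proof -
  show "bounded (f ` {c..d})"
    unfolding bounded_def by (intro exI[of _ "f c"] exI[of _ "d - c"]) (auto simp: assms(1))
  show "diameter (f ` {c..d}) \<le> d - c"
    using assms(2) by (intro diameter_le) (auto simp: assms(1) simp flip: dist_norm)
qed

lemma hausdorff_1_isometric_image_eq_0:
  fixes f :: "real \<Rightarrow> complex"
  assumes "negligible T" "T \<subseteq> {a..b}" "a < b" "\<And>s t. dist (f s) (f t) = \<bar>s - t\<bar>"
  shows "hausdorff_1 (f ` T) = 0"
proof -
  have "(INF E\<in>{E :: nat \<Rightarrow> complex set.
         f ` T \<subseteq> (\<Union>n. E n) \<and> (\<forall>n. bounded (E n) \<and> diameter (E n) \<le> \<delta>)}.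
       \<Sum>n. ennreal (diameter (E n))) = 0" if \<delta>: "0 < \<delta>" for \<delta>
    unfolding INF_ennreal_eq_0_iff
  proof (intro allI impI)
    fix e :: real assume e: "0 < e"
    have T: "T \<in> lmeasurable" "measure lebesgue T = 0"
      using assms(1) by (auto simp: negligible_iff_measure)
    have ab: "T \<subseteq> cbox a b" "box a b \<noteq> {}" using assms by auto
    \<comment> \<open>A cover of total length at most \<open>min e \<delta>\<close> controls the sum
      and, term by term, the individual diameters.\<close>
    have pos: "0 < min e \<delta>" using e \<delta> by simp
    obtain \<D> where D: "countable \<D>"
        "\<And>K. K \<in> \<D> \<Longrightarrow> K \<subseteq> cbox a b \<and> K \<noteq> {} \<and> (\<exists>c d. K = cbox c d)"
        "pairwise (\<lambda>A B. interior A \<inter> interior B = {}) \<D>"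
        "T \<subseteq> \<Union>\<D>" "\<Union>\<D> \<in> lmeasurable" "measure lebesgue (\<Union>\<D>) \<le> min e \<delta>"
      using measurable_outer_intervals_bounded[OF T(1) ab(1) pos] unfolding T(2) add_0 by metis
    \<comment> \<open>The intervals are numbered through an injection into the naturals, possibly
      with gaps: \<open>E n\<close> is the interval with number \<open>n\<close>, or empty. Only the
      interiors are disjoint, so lengths are added through them.\<close>
    obtain g :: "real set \<Rightarrow> nat" where g: "inj_on g \<D>" using D(1) by (auto elim: countableE)
    define E where "E n = \<Union>{K\<in>\<D>. g K = n}" for n
    have E: "E n = {} \<or> E n \<in> \<D> \<and> g (E n) = n" for n
    proof (cases "\<exists>K\<in>\<D>. g K = n")
      case True
      then obtain K where "K \<in> \<D>" "g K = n" by blast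
      then have "{K\<in>\<D>. g K = n} = {K}" using g by (auto simp: inj_on_def)
      then show ?thesis using \<open>K \<in> \<D>\<close> \<open>g K = n\<close> by (simp add: E_def)
    qed (auto simp: E_def)
    have Eform: "E n = {} \<or> (\<exists>c d. c \<le> d \<and> E n = {c..d})" for n
      using E[of n] D(2)[of "E n"] by fastforce
    have meas: "emeasure lborel (interior (E n)) = ennreal (measure lebesgue (E n))
      \<and> ennreal (diameter (f ` E n)) \<le> ennreal (measure lebesgue (E n)) \<and> bounded (f ` E n)" for n
      using Eform[of n] diameter_isometric_image_le[OF assms(4)] by (auto intro!: ennreal_leI)
    have "(\<Sum>n. ennreal (diameter (f ` E n))) \<le> (\<Sum>n. emeasure lborel (interior (E n)))"
      using meas by (intro suminf_le) auto
    also have "\<dots> = emeasure lborel (\<Union>n. interior (E n))"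
    proof (intro suminf_emeasure)
      show "disjoint_family (\<lambda>n. interior (E n))"
        unfolding disjoint_family_on_def
      proof (intro ballI impI)
        fix m n :: nat assume "m \<noteq> n"
        show "interior (E m) \<inter> interior (E n) = {}"
        proof (cases "E m = {} \<or> E n = {}")
          case False
          then have "E m \<in> \<D>" "E n \<in> \<D>" "E m \<noteq> E n" using E[of m] E[of n] \<open>m \<noteq> n\<close> by auto
          then show ?thesis using D(3) by (auto simp: pairwise_def)
        qed auto
      qed
    qed auto
    also have "\<dots> \<le> emeasure lebesgue (\<Union>\<D>)"
    proof -
      have "(\<Union>n. interior (E n)) \<subseteq> \<Union>\<D>" using interior_subset by (fastforce simp: E_def)
      then have "emeasure lebesgue (\<Union>n. interior (E n)) \<le> emeasure lebesgue (\<Union>\<D>)"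
        using D(5) by (intro emeasure_mono) (auto simp: fmeasurable_def)
      moreover have "emeasure lebesgue (\<Union>n. interior (E n)) = emeasure lborel (\<Union>n. interior (E n))"
        by simp
      ultimately show ?thesis by simp
    qed
    also have "\<dots> \<le> ennreal (min e \<delta>)"
      using D(5,6) by (simp add: emeasure_eq_measure2 ennreal_leI)
    finally have le: "(\<Sum>n. ennreal (diameter (f ` E n))) \<le> ennreal (min e \<delta>)" .
    have "ennreal (diameter (f ` E n)) \<le> ennreal (min e \<delta>)" for n
      using sum_le_suminf[of "\<lambda>n. ennreal (diameter (f ` E n))" "{n}"] le by (auto intro: order_trans)
    then have "diameter (f ` E n) \<le> \<delta>" for n
      using pos by (metis ennreal_le_iff less_imp_le min.boundedE)
    moreover have "f ` T \<subseteq> (\<Union>n. f ` E n)"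
    proof clarify
      fix x assume "x \<in> T"
      then obtain K where "K \<in> \<D>" "x \<in> K" using D(4) by blast
      then have "x \<in> E (g K)" by (auto simp: E_def)
      then show "f x \<in> (\<Union>n. f ` E n)" by blast
    qed
    moreover have "(\<Sum>n. ennreal (diameter (f ` E n))) \<le> ennreal e"
      using le by (rule order_trans) (simp add: ennreal_leI)
    ultimately show "\<exists>E\<in>{E :: nat \<Rightarrow> complex set.
         f ` T \<subseteq> (\<Union>n. E n) \<and> (\<forall>n. bounded (E n) \<and> diameter (E n) \<le> \<delta>)}.
       (\<Sum>n. ennreal (diameter (E n))) \<le> ennreal e"
      using meas by (intro bexI[of _ "\<lambda>n. f ` E n"]) auto
  qed
  then show ?thesis unfolding hausdorff_1_def
    by (auto simp: SUP_eq_iff intro!: antisym SUP_least)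
qed

section \<open>Axis-parallel lines and Fubini\<close>

definition axis_line :: "bool \<Rightarrow> real \<Rightarrow> real \<Rightarrow> complex" where
  "axis_line d h t = (if d then Complex t h else Complex h t)"

text \<open>Constant along \<open>axis_line d h\<close>, while \<open>axis_coord (\<not> d)\<close>
  is the parameter on that line; the flag lets horizontal and vertical lines share all
  proofs.\<close>

definition axis_coord :: "bool \<Rightarrow> complex \<Rightarrow> real" where
  "axis_coord d z = (if d then Im z else Re z)"

lemma axis_coord_line [simp]: "axis_coord d (axis_line d h t) = h" "axis_coord (\<not> d) (axis_line d h t) = t"
  by (auto simp: axis_coord_def axis_line_def)

lemma axis_coord_Lipschitz: "\<bar>axis_coord d z - axis_coord d w\<bar> \<le> dist z w"
  using abs_Re_le_cmod[of "z - w"] abs_Im_le_cmod[of "z - w"] by (auto simp: axis_coord_def dist_norm)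

lemma axis_line_isometric [simp]: "dist (axis_line d h s) (axis_line d h t) = \<bar>s - t\<bar>"
  by (simp add: axis_line_def dist_norm cmod_def)

lemma norm_axis_line_le: "norm (axis_line d h t) \<le> \<bar>h\<bar> + \<bar>t\<bar>"
  using cmod_le[of "axis_line d h t"] by (auto simp: axis_line_def)

lemma continuous_on_axis_line [continuous_intros]: "continuous_on A (axis_line d h)"
  by (cases d) (auto simp: axis_line_def Complex_eq intro!: continuous_intros)

lemma borel_measurable_axis_line [measurable]:
  "(\<lambda>(h, t). axis_line d h t) \<in> borel_measurable (borel \<Otimes>\<^sub>M borel)"
proof -
  have "continuous_on UNIV (\<lambda>p. axis_line d (fst p) (snd p))"
    by (cases d) (auto simp: axis_line_def Complex_eq intro!: continuous_intros)
  then show ?thesis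
    by (simp add: borel_measurable_continuous_onI borel_prod case_prod_beta)
qed

lemma lborel_eq_distr_axis_line:
  "(lborel :: complex measure) = distr (lborel \<Otimes>\<^sub>M lborel) borel (\<lambda>(h, t). axis_line d h t)"
proof (rule lborel_eqI)
  fix l u :: complex assume lu: "\<And>b. b \<in> Basis \<Longrightarrow> l \<bullet> b \<le> u \<bullet> b"
  have le: "Re l \<le> Re u" "Im l \<le> Im u"
    using lu[of 1] lu[of \<i>] by (auto simp: Basis_complex_def)
  define A where "A = (if d then {Im l<..<Im u} else {Re l<..<Re u})"
  define B where "B = (if d then {Re l<..<Re u} else {Im l<..<Im u})"
  have "(\<lambda>(h, t). axis_line d h t) -` box l u = A \<times> B"
    by (auto simp: A_def B_def axis_line_def in_box_complex_iff split: if_splits)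
  then have "emeasure (distr (lborel \<Otimes>\<^sub>M lborel) borel (\<lambda>(h, t). axis_line d h t)) (box l u)
      = emeasure (lborel \<Otimes>\<^sub>M lborel) (A \<times> B)"
    by (subst emeasure_distr) (auto simp: space_pair_measure)
  also have "\<dots> = emeasure lborel A * emeasure lborel B"
    by (intro lborel.emeasure_pair_measure_Times) (auto simp: A_def B_def)
  also have "\<dots> = (\<Prod>b\<in>Basis. (u - l) \<bullet> b)"
    using le by (auto simp: A_def B_def Basis_complex_def ennreal_mult mult.commute)
  finally show "emeasure (distr (lborel \<Otimes>\<^sub>M lborel) borel (\<lambda>(h, t). axis_line d h t)) (box l u)
      = (\<Prod>b\<in>Basis. (u - l) \<bullet> b)" .
qed simp

lemma nn_integral_axis_line:
  assumes [measurable]: "w \<in> borel_measurable (borel :: complex measure)"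
  shows "(\<integral>\<^sup>+h. \<integral>\<^sup>+t. w (axis_line d h t) \<partial>lborel \<partial>lborel) = (\<integral>\<^sup>+z. w z \<partial>lborel)"
proof -
  have "(\<integral>\<^sup>+z. w z \<partial>lborel) = (\<integral>\<^sup>+p. w (case p of (h, t) \<Rightarrow> axis_line d h t) \<partial>(lborel \<Otimes>\<^sub>M lborel))"
    by (subst lborel_eq_distr_axis_line[of d], subst nn_integral_distr) auto
  also have "\<dots> = (\<integral>\<^sup>+h. \<integral>\<^sup>+t. w (axis_line d h t) \<partial>lborel \<partial>lborel)"
    by (subst lborel.nn_integral_fst[symmetric]) auto
  finally show ?thesis by simp
qed

lemma ennreal_le_of_square_le:
  fixes x :: ennreal
  assumes "x\<^sup>2 \<le> ennreal (e\<^sup>2)" "0 \<le> e"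
  shows "x \<le> ennreal e"
proof (cases x)
  case (real r)
  then have "r\<^sup>2 \<le> e\<^sup>2" using assms by (simp add: ennreal_power)
  then have "r \<le> e" using assms(2) by (rule power2_le_imp_le)
  then show ?thesis using real by (simp add: ennreal_leI)
next
  case top
  then show ?thesis using assms by (simp add: ennreal_power top_unique)
qed

text \<open>By Fubini over the square of side \<open>2 * n\<close>, the line integrals add up to the
  planar integral of the weight over that square, and Cauchy-Schwarz bounds this by the small
  energy.\<close>

lemma negligible_lines_mod_2:
  assumes "mod_2 \<Gamma> = 0" "0 < n"
  shows "negligible {h. \<bar>h\<bar> \<le> n \<and> ({-n..n}, axis_line d h) \<in> \<Gamma>}"
proof (rule negligible_if_small_integrals)
  fix e :: real assume e: "0 < e"
  \<comment> \<open>Chosen so that \<open>e'\<close> times the area \<open>4 * n\<^sup>2\<close> of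
    the square is \<open>e\<^sup>2\<close>.\<close>
  define e' where "e' = e\<^sup>2 / (4 * n\<^sup>2)"
  have e': "0 < e'" using e assms(2) by (simp add: e'_def)
  obtain w where [measurable]: "w \<in> borel_measurable borel" and adm: "\<forall>\<gamma>\<in>\<Gamma>. 1 \<le> line_integral w \<gamma>"
      and int: "(\<integral>\<^sup>+ z. (w z)\<^sup>2 \<partial>lborel) \<le> ennreal e'"
    using assms(1)[unfolded mod_2_eq_0_iff, THEN spec, THEN mp, OF e'] by (elim exE conjE)
  define B where "B = {z. \<bar>axis_coord d z\<bar> \<le> n \<and> \<bar>axis_coord (\<not> d) z\<bar> \<le> n}"
  have [measurable]: "axis_coord b \<in> borel_measurable borel" for b
    by (cases b) (auto simp: axis_coord_def[abs_def])
  have [measurable]: "B \<in> sets borel" unfolding B_def by measurable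
  define F where "F h = (\<integral>\<^sup>+t. w (axis_line d h t) * indicator B (axis_line d h t) \<partial>lborel)" for h
  have [measurable]: "(\<lambda>p. axis_line d (fst p) (snd p)) \<in> borel_measurable (borel \<Otimes>\<^sub>M borel)"
    using borel_measurable_axis_line[of d] by (simp add: case_prod_beta)
  have "F \<in> borel_measurable borel"
    unfolding F_def by measurable
  moreover have "(\<integral>\<^sup>+h. F h \<partial>lborel) \<le> ennreal e"
  proof (rule ennreal_le_of_square_le)
    have B: "(\<integral>\<^sup>+z. (indicator B z)\<^sup>2 \<partial>lborel) = ennreal (4 * n\<^sup>2)"
    proof -
      have "(\<integral>\<^sup>+z. (indicator B z)\<^sup>2 \<partial>lborel) = (\<integral>\<^sup>+z. indicator B z \<partial>lborel)"
        by (intro nn_integral_cong) (auto simp: indicator_def)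
      also have "\<dots> = (\<integral>\<^sup>+h. \<integral>\<^sup>+t. indicator B (axis_line d h t) \<partial>lborel \<partial>lborel)"
        by (subst nn_integral_axis_line) auto
      also have "\<dots> = (\<integral>\<^sup>+h. \<integral>\<^sup>+t. indicator {-n..n} h * indicator {-n..n} t \<partial>lborel \<partial>lborel)"
        by (intro nn_integral_cong) (auto simp: B_def indicator_def)
      also have "\<dots> = ennreal (2 * n) * ennreal (2 * n)"
        using assms(2) by (simp add: nn_integral_cmult nn_integral_multc)
      finally show ?thesis using assms(2) by (simp flip: ennreal_mult add: power2_eq_square)
    qed
    have "(\<integral>\<^sup>+h. F h \<partial>lborel) = (\<integral>\<^sup>+z. w z * indicator B z \<partial>lborel)"
      unfolding F_def by (rule nn_integral_axis_line) measurable
    then have "(\<integral>\<^sup>+h. F h \<partial>lborel)\<^sup>2 \<le> (\<integral>\<^sup>+z. (w z)\<^sup>2 \<partial>lborel) * (\<integral>\<^sup>+z. (indicator B z)\<^sup>2 \<partial>lborel)"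
      using Cauchy_Schwarz_nn_integral[of w lborel "indicator B"] by simp
    also have "\<dots> \<le> ennreal e' * ennreal (4 * n\<^sup>2)"
      unfolding B by (intro mult_right_mono int) simp
    also have "\<dots> = ennreal (e\<^sup>2)" using assms(2) e' by (simp flip: ennreal_mult add: e'_def)
    finally show "(\<integral>\<^sup>+h. F h \<partial>lborel)\<^sup>2 \<le> ennreal (e\<^sup>2)" .
  qed (use e in simp)
  moreover have "1 \<le> F h" if h: "\<bar>h\<bar> \<le> n" "({-n..n}, axis_line d h) \<in> \<Gamma>" for h
  proof -
    have "1 \<le> line_integral w ({-n..n}, axis_line d h)" using adm h(2) by blast
    also have "\<dots> \<le> (\<integral>\<^sup>+t\<in>{-n..n}. w (axis_line d h t) \<partial>lborel)"
      by (rule line_integral_isometric_le) (auto intro: continuous_intros)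
    also have "\<dots> = F h"
      unfolding F_def using h(1) by (intro nn_integral_cong) (auto simp: B_def indicator_def)
    finally show ?thesis .
  qed
  ultimately show "\<exists>F N. F \<in> borel_measurable borel \<and> (\<integral>\<^sup>+h. F h \<partial>lborel) \<le> ennreal e \<and>
    negligible N \<and> (\<forall>h\<in>{h. \<bar>h\<bar> \<le> n \<and> ({-n..n}, axis_line d h) \<in> \<Gamma>} - N. 1 \<le> F h)"
    by (intro exI[of _ F] exI[of _ "{}"]) auto
qed

lemma curve_continuous_on:
  assumes "is_curve \<gamma>"
  shows "continuous_on (fst \<gamma>) (snd \<gamma>)"
proof -
  obtain h where h: "continuous_on (closure (fst \<gamma>)) h" "\<forall>t\<in>fst \<gamma>. h t = snd \<gamma> t"
    using assms unfolding is_curve_def by blast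
  then have "continuous_on (fst \<gamma>) h" using continuous_on_subset closure_subset by blast
  then show ?thesis using h(2) by (simp cong: continuous_on_cong)
qed

section \<open>Null families contain almost no axis-parallel segments\<close>

context plane_carpet
begin

text \<open>In the strong version Fubini applies to the carpet itself: it has area zero, so almost
  every line meets it in a set of length zero, whose bounded parts have Hausdorff measure
  zero.\<close>

lemma negligible_lines_exempt:
  assumes "exempt v UNIV Q \<Gamma>" "0 < n"
  shows "negligible {h. \<bar>h\<bar> \<le> n \<and> ({-n..n}, axis_line d h) \<in> \<Gamma>}"
proof (cases v)
  case Weak
  then show ?thesis using negligible_lines_mod_2 assms by (simp add: exempt_def)
next
  case Strong
  have [measurable]: "S \<in> sets borel" using closed_S by simp
  have "(\<integral>\<^sup>+h. \<integral>\<^sup>+t. indicator S (axis_line d h t) \<partial>lborel \<partial>lborel) = (\<integral>\<^sup>+z. indicator S z \<partial>lborel)"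
    by (rule nn_integral_axis_line) measurable
  also have "\<dots> = emeasure lebesgue S" by simp
  also have "\<dots> = 0" using negligible_S by (simp add: negligible_iff_null_sets null_setsD1)
  finally have 0: "(\<integral>\<^sup>+h. \<integral>\<^sup>+t. indicator S (axis_line d h t) \<partial>lborel \<partial>lborel) = 0" .
  have [measurable]: "(\<lambda>p. axis_line d (fst p) (snd p)) \<in> borel_measurable (borel \<Otimes>\<^sub>M borel)"
    using borel_measurable_axis_line[of d] by (simp add: case_prod_beta)
  have "AE h in lborel. (\<integral>\<^sup>+t. indicator S (axis_line d h t) \<partial>lborel) = 0"
  proof -
    have "(\<lambda>h. \<integral>\<^sup>+t. indicator S (axis_line d h t) \<partial>lborel) \<in> borel_measurable borel"
      by measurable
    then show ?thesis using 0 by (simp add: nn_integral_0_iff_AE)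
  qed
  then obtain N where N: "N \<in> null_sets lborel"
      "{h. (\<integral>\<^sup>+t. indicator S (axis_line d h t) \<partial>lborel) \<noteq> 0} \<subseteq> N"
    by (auto elim!: AE_E3 simp: eventually_ae_filter)
  have "hausdorff_1 (trace ({-n..n}, axis_line d h) \<inter> S) = 0" if "h \<notin> N" for h
  proof -
    define T where "T = {t. axis_line d h t \<in> S}"
    have "axis_line d h \<in> borel_measurable borel"
      by (intro borel_measurable_continuous_onI continuous_intros)
    then have [measurable]: "T \<in> sets borel" unfolding T_def by measurable
    have "emeasure lborel T = (\<integral>\<^sup>+t. indicator S (axis_line d h t) \<partial>lborel)"
    proof -
      have "(\<integral>\<^sup>+t. indicator S (axis_line d h t) \<partial>lborel) = (\<integral>\<^sup>+t. indicator T t \<partial>lborel)"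
        by (intro nn_integral_cong) (simp add: T_def indicator_def)
      then show ?thesis by simp
    qed
    also have "\<dots> = 0" using N(2) that by blast
    finally have "negligible T" by (simp add: negligible_iff_null_sets null_sets_def)
    then have "negligible (T \<inter> {-n..n})" by (rule negligible_subset) auto
    then have "hausdorff_1 (axis_line d h ` (T \<inter> {-n..n})) = 0"
      by (rule hausdorff_1_isometric_image_eq_0[of _ "-n" n]) (use assms(2) in auto)
    moreover have "trace ({-n..n}, axis_line d h) \<inter> S = axis_line d h ` (T \<inter> {-n..n})"
      by (auto simp: trace_def T_def)
    ultimately show ?thesis by simp
  qed
  then have "{h. \<bar>h\<bar> \<le> n \<and> ({-n..n}, axis_line d h) \<in> \<Gamma>} \<subseteq> N"
    using assms(1) Strong by (auto simp: exempt_def)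
  moreover have "negligible N" using N(1)
    by (auto simp: negligible_iff_null_sets null_sets_def)
  ultimately show ?thesis using negligible_subset by blast
qed

text \<open>Length-area for the coordinate projection, applied to weights of small energy; segments
  in the exempt family are put into the null set \<open>N\<close>.\<close>

lemma negligible_lines_null_family:
  assumes "carpet_mod v UNIV Q \<Gamma> = 0" "0 < n"
  shows "negligible {h. \<bar>h\<bar> \<le> n \<and> ({-n..n}, axis_line d h) \<in> \<Gamma>}"
proof (rule negligible_if_small_integrals)
  fix e :: real assume e: "0 < e"
  obtain C where C: "0 < C" "\<And>(\<rho> :: nat \<Rightarrow> ennreal) x s (\<pi> :: complex \<Rightarrow> real). 0 < s \<Longrightarrow>
    (\<And>z w. \<bar>\<pi> z - \<pi> w\<bar> \<le> dist z w) \<Longrightarrow>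
    \<exists>F. F \<in> borel_measurable borel \<and>
      (\<forall>h. (\<Sum>\<^sub>\<infinity>i\<in>{i. h \<in> \<pi> ` (Q i \<inter> ball x s)}. \<rho> i) \<le> F h) \<and>
      (\<integral>\<^sup>+h. F h \<partial>lborel)\<^sup>2 \<le> ennreal (C * s\<^sup>2) * (\<Sum>\<^sub>\<infinity>i\<in>hit Q (ball x s). (\<rho> i)\<^sup>2)"
    by (rule length_area) blast
  \<comment> \<open>Points of the segments have norm at most \<open>2 * n\<close>, so the open ball
    of radius \<open>3 * n\<close> contains them.\<close>
  define s where "s = 3 * n"
  define e' where "e' = e\<^sup>2 / (C * s\<^sup>2)"
  have s: "0 < s" using assms(2) by (simp add: s_def)
  have e': "0 < e'" using e C(1) s by (simp add: e'_def)
  obtain \<rho> \<Gamma>\<^sub>0 where ex: "exempt v UNIV Q \<Gamma>\<^sub>0"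
    and adm: "\<forall>\<gamma>\<in>\<Gamma> - \<Gamma>\<^sub>0. 1 \<le> (\<Sum>\<^sub>\<infinity>i\<in>hit Q (trace \<gamma>). \<rho> i)"
    and en: "(\<Sum>\<^sub>\<infinity>i\<in>UNIV. (\<rho> i)\<^sup>2) \<le> ennreal e'"
    using assms(1)[unfolded carpet_mod_eq_0_iff, THEN spec, THEN mp, OF e'] by (elim exE conjE)
  obtain F where F: "F \<in> borel_measurable borel"
    "\<And>h. (\<Sum>\<^sub>\<infinity>i\<in>{i. h \<in> axis_coord d ` (Q i \<inter> ball 0 s)}. \<rho> i) \<le> F h"
    "(\<integral>\<^sup>+h. F h \<partial>lborel)\<^sup>2 \<le> ennreal (C * s\<^sup>2) * (\<Sum>\<^sub>\<infinity>i\<in>hit Q (ball 0 s). (\<rho> i)\<^sup>2)"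
    using C(2)[where \<rho> = \<rho> and x = 0 and s = s and \<pi> = "axis_coord d", OF s axis_coord_Lipschitz] by blast
  have "(\<integral>\<^sup>+h. F h \<partial>lborel)\<^sup>2 \<le> ennreal (C * s\<^sup>2) * ennreal e'"
    using infsum_mono_ennreal[of "hit Q (ball 0 s)" UNIV "\<lambda>i. (\<rho> i)\<^sup>2" "\<lambda>i. (\<rho> i)\<^sup>2"] en
    by (intro order_trans[OF F(3)] mult_left_mono) auto
  also have "\<dots> = ennreal (e\<^sup>2)" using C(1) s e' by (simp flip: ennreal_mult add: e'_def)
  finally have int: "(\<integral>\<^sup>+h. F h \<partial>lborel) \<le> ennreal e" by (rule ennreal_le_of_square_le) (use e in simp)
  define N where "N = {h. \<bar>h\<bar> \<le> n \<and> ({-n..n}, axis_line d h) \<in> \<Gamma>\<^sub>0}"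
  have N: "negligible N" unfolding N_def using ex assms(2) by (rule negligible_lines_exempt)
  have "1 \<le> F h" if h: "\<bar>h\<bar> \<le> n" "({-n..n}, axis_line d h) \<in> \<Gamma>" "h \<notin> N" for h
  proof -
    have "1 \<le> (\<Sum>\<^sub>\<infinity>i\<in>hit Q (trace ({-n..n}, axis_line d h)). \<rho> i)"
      using adm h by (auto simp: N_def)
    also have "\<dots> \<le> (\<Sum>\<^sub>\<infinity>i\<in>{i. h \<in> axis_coord d ` (Q i \<inter> ball 0 s)}. \<rho> i)"
    proof (rule infsum_mono_ennreal)
      show "hit Q (trace ({-n..n}, axis_line d h)) \<subseteq> {i. h \<in> axis_coord d ` (Q i \<inter> ball 0 s)}"
      proof
        fix i assume "i \<in> hit Q (trace ({-n..n}, axis_line d h))"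
        then have "\<exists>t\<in>{-n..n}. axis_line d h t \<in> Q i" by (auto simp: hit_def trace_def)
        then obtain t where t: "t \<in> {-n..n}" "axis_line d h t \<in> Q i" by (elim bexE)
        then have "norm (axis_line d h t) < s"
          using norm_axis_line_le[of d h t] h(1) assms(2) by (auto simp: s_def)
        then have "axis_line d h t \<in> Q i \<inter> ball 0 s" using t by simp
        then have "axis_coord d (axis_line d h t) \<in> axis_coord d ` (Q i \<inter> ball 0 s)" by (rule imageI)
        then show "i \<in> {i. h \<in> axis_coord d ` (Q i \<inter> ball 0 s)}" by simp
      qed
    qed simp
    also have "\<dots> \<le> F h" by (rule F(2))
    finally show ?thesis .
  qed
  then show "\<exists>F N. F \<in> borel_measurable borel \<and> (\<integral>\<^sup>+h. F h \<partial>lborel) \<le> ennreal e \<and>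
    negligible N \<and> (\<forall>h\<in>{h. \<bar>h\<bar> \<le> n \<and> ({-n..n}, axis_line d h) \<in> \<Gamma>} - N. 1 \<le> F h)"
    using F(1) int N by (intro exI[of _ F] exI[of _ N]) auto
qed

text \<open>Longer segments on the line of a bad segment belong to the family of supercurves, which
  is still null; countably many lengths therefore handle all segments at once.\<close>

lemma negligible_bad_lines:
  assumes "carpet_mod v UNIV Q \<Gamma> = 0"
  shows "negligible {h. \<exists>a b. a \<le> b \<and> ({a..b}, axis_line d h) \<in> \<Gamma>}"
proof -
  define \<Gamma>' where "\<Gamma>' = {\<gamma>. \<exists>\<gamma>'\<in>\<Gamma>. subcurve \<gamma>' \<gamma>}"
  have "carpet_mod v UNIV Q \<Gamma>' = 0"
    using assms by (rule carpet_mod_eq_0_mono) (auto simp: \<Gamma>'_def)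
  then have "negligible (\<Union>k. {h. \<bar>h\<bar> \<le> real (Suc k) \<and> ({-real (Suc k)..real (Suc k)}, axis_line d h) \<in> \<Gamma>'})"
    by (intro negligible_countable_Union) (auto intro!: negligible_lines_null_family simp del: of_nat_Suc)
  moreover have "{h. \<exists>a b. a \<le> b \<and> ({a..b}, axis_line d h) \<in> \<Gamma>}
      \<subseteq> (\<Union>k. {h. \<bar>h\<bar> \<le> real (Suc k) \<and> ({-real (Suc k)..real (Suc k)}, axis_line d h) \<in> \<Gamma>'})"
  proof clarify
    fix h a b assume ab: "a \<le> b" "({a..b}, axis_line d h) \<in> \<Gamma>"
    obtain k where "max \<bar>h\<bar> (max \<bar>a\<bar> \<bar>b\<bar>) \<le> real k" using real_arch_simple by blast
    then have k: "\<bar>h\<bar> \<le> real (Suc k)" "\<bar>a\<bar> \<le> real (Suc k)" "\<bar>b\<bar> \<le> real (Suc k)" by auto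
    then have "subcurve ({a..b}, axis_line d h) ({-real (Suc k)..real (Suc k)}, axis_line d h)"
      using ab(1) by (auto simp: subcurve_def is_interval_cc)
    then have "({-real (Suc k)..real (Suc k)}, axis_line d h) \<in> \<Gamma>'"
      using ab(2) by (auto simp: \<Gamma>'_def)
    then show "h \<in> (\<Union>k. {h. \<bar>h\<bar> \<le> real (Suc k) \<and> ({-real (Suc k)..real (Suc k)}, axis_line d h) \<in> \<Gamma>'})"
      using k(1) by blast
  qed
  ultimately show ?thesis by (rule negligible_subset)
qed

text \<open>The projected curve covers the interval between the projected ends. Apart from the null
  image of its part in the carpet, it stays in intervals of length twice the diameter, one for each
  disk it meets.\<close>

lemma projection_le_diameter_sum:
  fixes \<pi> :: "complex \<Rightarrow> real" and f :: "real \<Rightarrow> complex"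
  assumes "continuous_on {a..b} f" "a \<le> b" "\<And>z w. \<bar>\<pi> z - \<pi> w\<bar> \<le> dist z w"
    and "negligible (\<pi> ` (f ` {a..b} \<inter> S))"
  shows "ennreal \<bar>\<pi> (f a) - \<pi> (f b)\<bar> \<le> 2 * (\<Sum>\<^sub>\<infinity>i\<in>hit Q (f ` {a..b}). ennreal (diameter (Q i)))"
proof -
  define I where "I = hit Q (f ` {a..b})"
  define z where "z i = (SOME z. z \<in> Q i)" for i
  have z: "z i \<in> Q i" for i unfolding z_def using Q_nonempty by (meson ex_in_conv someI_ex)
  define J where "J i = (if i \<in> I then {\<pi> (z i) - diameter (Q i)..\<pi> (z i) + diameter (Q i)} else {})" for i
  define N where "N = \<pi> ` (f ` {a..b} \<inter> S)"
  have "continuous_on UNIV \<pi>"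
    unfolding continuous_on_iff using assms(3) by (auto simp: dist_real_def intro!: exI order_le_less_trans[OF assms(3)])
  then have cont: "continuous_on {a..b} (\<lambda>t. \<pi> (f t))"
    using continuous_on_compose2[OF _ assms(1)] by blast
  define p q where "p = min (\<pi> (f a)) (\<pi> (f b))" and "q = max (\<pi> (f a)) (\<pi> (f b))"
  have conn: "connected ((\<lambda>t. \<pi> (f t)) ` {a..b})"
    by (intro connected_continuous_image cont) simp
  have "{p..q} \<subseteq> (\<lambda>t. \<pi> (f t)) ` {a..b}"
  proof (rule connected_contains_Icc[OF conn])
    show "p \<in> (\<lambda>t. \<pi> (f t)) ` {a..b}" "q \<in> (\<lambda>t. \<pi> (f t)) ` {a..b}"
      using assms(2) by (auto simp: p_def q_def min_def max_def)
  qed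
  also have "\<dots> \<subseteq> N \<union> (\<Union>i. J i)"
  proof clarify
    fix t assume t: "t \<in> {a..b}" "\<pi> (f t) \<notin> (\<Union>i. J i)"
    show "\<pi> (f t) \<in> N"
    proof (cases "f t \<in> S")
      case False
      then obtain i where i: "f t \<in> Q i" using not_in_S by blast
      then have "i \<in> I" using t by (auto simp: I_def hit_def)
      moreover have "dist (f t) (z i) \<le> diameter (Q i)"
        using i z by (intro diameter_bounded_bound) auto
      ultimately have "\<pi> (f t) \<in> J i" using assms(3)[of "f t" "z i"] by (auto simp: J_def)
      then show ?thesis using t(2) by blast
    qed (use t in \<open>auto simp: N_def\<close>)
  qed
  finally have "emeasure lebesgue {p..q} \<le> emeasure lebesgue (N \<union> (\<Union>i. J i))"
    using assms(4) by (intro emeasure_mono) (auto simp: N_def J_def negligible_imp_sets)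
  also have "\<dots> \<le> emeasure lebesgue N + emeasure lebesgue (\<Union>i. J i)"
    using assms(4) by (intro emeasure_subadditive) (auto simp: N_def J_def negligible_imp_sets)
  also have "\<dots> = emeasure lebesgue (\<Union>i. J i)"
    using assms(4) by (simp add: N_def negligible_iff_null_sets null_setsD1)
  also have "\<dots> \<le> (\<Sum>i. emeasure lebesgue (J i))"
    by (intro emeasure_subadditive_countably) (auto simp: J_def)
  also have "\<dots> = (\<Sum>i. 2 * ennreal (diameter (Q i)) * indicator I i)"
    by (intro suminf_cong) (auto simp: J_def diameter_ge_0 ennreal_mult'' simp flip: ennreal_numeral)
  also have "\<dots> = 2 * (\<Sum>\<^sub>\<infinity>i\<in>I. ennreal (diameter (Q i)))"
    by (simp add: infsum_ennreal_indicator nn_integral_count_space_nat mult.assoc)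
  finally show ?thesis by (simp add: p_def q_def I_def abs_real_def min_def max_def split: if_splits)
qed

lemma dist_le_diameter_sum:
  fixes f :: "real \<Rightarrow> complex"
  assumes "continuous_on {a..b} f" "a \<le> b" "\<And>d. negligible (axis_coord d ` (f ` {a..b} \<inter> S))"
  shows "ennreal (dist (f a) (f b)) \<le> 4 * (\<Sum>\<^sub>\<infinity>i\<in>hit Q (f ` {a..b}). ennreal (diameter (Q i)))"
proof -
  have "dist (f a) (f b) \<le> \<bar>axis_coord True (f a) - axis_coord True (f b)\<bar> + \<bar>axis_coord False (f a) - axis_coord False (f b)\<bar>"
    using cmod_le[of "f a - f b"] by (simp add: dist_norm axis_coord_def)
  then have "ennreal (dist (f a) (f b)) \<le> ennreal \<bar>axis_coord True (f a) - axis_coord True (f b)\<bar>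
      + ennreal \<bar>axis_coord False (f a) - axis_coord False (f b)\<bar>"
    by (simp flip: ennreal_plus add: ennreal_leI)
  also have "\<dots> \<le> 2 * (\<Sum>\<^sub>\<infinity>i\<in>hit Q (f ` {a..b}). ennreal (diameter (Q i)))
      + 2 * (\<Sum>\<^sub>\<infinity>i\<in>hit Q (f ` {a..b}). ennreal (diameter (Q i)))"
    by (intro add_mono projection_le_diameter_sum assms axis_coord_Lipschitz)
  also have "\<dots> = 4 * (\<Sum>\<^sub>\<infinity>i\<in>hit Q (f ` {a..b}). ennreal (diameter (Q i)))"
    by (simp flip: distrib_right)
  finally show ?thesis .
qed

text \<open>In the weak version, the weight that is infinite on the carpet has zero energy, the
  carpet having area zero; a curve of finite integral projects its carpet part to null sets and so
  satisfies the estimate. In the strong version, only curves meeting the carpet in nonzero Hausdorff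
  measure can violate it.\<close>

lemma carpet_mod_dist_le_diameter_sum_eq_0:
  "carpet_mod v UNIV Q {\<gamma>. is_curve \<gamma> \<and> (\<exists>a b. a \<le> b \<and> {a..b} \<subseteq> fst \<gamma> \<and>
     \<not> ennreal (dist (snd \<gamma> a) (snd \<gamma> b))
       \<le> 4 * (\<Sum>\<^sub>\<infinity>i\<in>hit Q (snd \<gamma> ` {a..b}). ennreal (diameter (Q i))))} = 0"
    (is "carpet_mod _ _ _ ?\<Gamma> = 0")
proof (rule carpet_mod_exempt_eq_0)
  have bad: "\<not> (\<forall>d. negligible (axis_coord d ` (snd \<gamma> ` {a..b} \<inter> S)))"
    if "is_curve \<gamma>" "a \<le> b" "{a..b} \<subseteq> fst \<gamma>" "\<not> ennreal (dist (snd \<gamma> a) (snd \<gamma> b))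
       \<le> 4 * (\<Sum>\<^sub>\<infinity>i\<in>hit Q (snd \<gamma> ` {a..b}). ennreal (diameter (Q i)))" for \<gamma> a b
    using dist_le_diameter_sum[of a b "snd \<gamma>"] that continuous_on_subset[OF curve_continuous_on] by blast
  show "exempt v UNIV Q ?\<Gamma>"
  proof (cases v)
    case Weak
    have "1 \<le> line_integral (\<lambda>z. \<infinity> * indicator S z) \<gamma>" if \<gamma>: "\<gamma> \<in> ?\<Gamma>" for \<gamma>
    proof (rule ccontr)
      assume less: "\<not> 1 \<le> line_integral (\<lambda>z. \<infinity> * indicator S z) \<gamma>"
      obtain a b where ab: "is_curve \<gamma>" "a \<le> b" "{a..b} \<subseteq> fst \<gamma>" "\<not> ennreal (dist (snd \<gamma> a) (snd \<gamma> b))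
         \<le> 4 * (\<Sum>\<^sub>\<infinity>i\<in>hit Q (snd \<gamma> ` {a..b}). ennreal (diameter (Q i)))" using \<gamma> by blast
      have rect: "locally_rectifiable \<gamma>" by (rule ccontr) (use less in \<open>simp add: line_integral_def\<close>)
      have "(\<integral>\<^sup>+ s \<in> {0..enn2real (curve_length (snd \<gamma>) a b)}.
          \<infinity> * indicator S (arc_length_param (snd \<gamma>) a b s) \<partial>lborel)
          \<le> line_integral (\<lambda>z. \<infinity> * indicator S z) \<gamma>"
        unfolding line_integral_def using rect ab by (auto intro!: SUP_upper2[of "(a, b)"])
      also have "\<dots> < \<infinity>" using less by (auto simp: not_le intro: less_trans)
      finally have fin: "(\<integral>\<^sup>+ s \<in> {0..enn2real (curve_length (snd \<gamma>) a b)}.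
          \<infinity> * indicator S (arc_length_param (snd \<gamma>) a b s) \<partial>lborel) < \<infinity>" .
      have "negligible (axis_coord d ` (snd \<gamma> ` {a..b} \<inter> S))" for d
      proof (rule negligible_image_if_line_integral_finite[OF _ closed_S _ ab(2) fin axis_coord_Lipschitz])
        show "continuous_on {a..b} (snd \<gamma>)"
          using curve_continuous_on[OF ab(1)] ab(3) continuous_on_subset by blast
        show "curve_length (snd \<gamma>) a b < \<infinity>"
          using rect ab(2,3) unfolding locally_rectifiable_def by blast
      qed
      then show False using bad[OF ab] by blast
    qed
    moreover have "(\<lambda>z. \<infinity> * indicator S z :: ennreal) \<in> borel_measurable borel"
      using closed_S by simp
    moreover have "(\<integral>\<^sup>+z. (\<infinity> * indicator S z)\<^sup>2 \<partial>lborel) = 0"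
    proof -
      have "(\<integral>\<^sup>+z. (\<infinity> * indicator S z)\<^sup>2 \<partial>lborel) = (\<integral>\<^sup>+z. \<infinity> * indicator S z \<partial>lborel)"
        by (intro nn_integral_cong) (auto simp: indicator_def)
      also have "\<dots> = \<infinity> * emeasure lebesgue S"
        using closed_S by (simp add: nn_integral_cmult)
      finally show ?thesis using negligible_S by (simp add: negligible_iff_null_sets null_setsD1)
    qed
    ultimately have "mod_2 ?\<Gamma> = 0"
      unfolding mod_2_eq_0_iff by (intro allI impI exI[of _ "\<lambda>z. \<infinity> * indicator S z"]) simp
    then show ?thesis using Weak by (simp add: exempt_def)
  next
    case Strong
    have "hausdorff_1 (trace \<gamma> \<inter> S) \<noteq> 0" if \<gamma>: "\<gamma> \<in> ?\<Gamma>" for \<gamma>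
    proof
      assume 0: "hausdorff_1 (trace \<gamma> \<inter> S) = 0"
      obtain a b where ab: "is_curve \<gamma>" "a \<le> b" "{a..b} \<subseteq> fst \<gamma>" "\<not> ennreal (dist (snd \<gamma> a) (snd \<gamma> b))
         \<le> 4 * (\<Sum>\<^sub>\<infinity>i\<in>hit Q (snd \<gamma> ` {a..b}). ennreal (diameter (Q i)))" using \<gamma> by blast
      have "negligible (axis_coord d ` (snd \<gamma> ` {a..b} \<inter> S))" for d
        by (rule negligible_subset[OF negligible_image_if_hausdorff_1_eq_0[OF 0 axis_coord_Lipschitz]])
          (use ab(3) in \<open>auto simp: trace_def\<close>)
      then show False using bad[OF ab] by blast
    qed
    then show ?thesis using Strong by (simp add: exempt_def)
  qed
qed

end

section \<open>Oscillations as upper gradients\<close>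

lemma infsum_sum_ennreal:
  fixes h :: "'k \<Rightarrow> 'i \<Rightarrow> ennreal"
  shows "(\<Sum>\<^sub>\<infinity>i\<in>A. \<Sum>k\<in>G. h k i) = (\<Sum>k\<in>G. \<Sum>\<^sub>\<infinity>i\<in>A. h k i)"
  unfolding infsum_ennreal_eq_nn_integral by (intro nn_integral_sum) auto

lemma ennreal_diff_le_osc:
  assumes "x \<in> frontier U" "y \<in> frontier U"
  shows "ennreal (\<phi> x - \<phi> y) \<le> osc U (\<lambda>x. ereal (\<phi> x))"
proof -
  have "ereal (\<phi> x) - ereal (\<phi> y) \<le> max_disk U (\<lambda>x. ereal (\<phi> x)) - min_disk U (\<lambda>x. ereal (\<phi> x))"
    unfolding max_disk_def min_disk_def
    by (intro ereal_minus_mono SUP_upper INF_lower assms)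
  then have "e2ennreal (ereal (\<phi> x - \<phi> y)) \<le> osc U (\<lambda>x. ereal (\<phi> x))"
    unfolding osc_def by (intro e2ennreal_mono) simp
  then show ?thesis by (simp add: e2ennreal_ereal)
qed

text \<open>The infimum of the parameters with image in \<open>closure U\<close> works: were its
  image in \<open>U\<close>, connectedness would give an earlier crossing of the frontier.\<close>

lemma first_entry:
  fixes f :: "real \<Rightarrow> complex"
  assumes "continuous_on {s..r} f" "s \<le> r" "open U" "f s \<notin> U" "f r \<in> closure U"
  obtains p where "s \<le> p" "p \<le> r" "f p \<in> frontier U" "\<And>x. x \<in> {s..p} \<Longrightarrow> f x \<notin> U"
proof -
  define G where "G = {x\<in>{s..r}. f x \<in> closure U}"
  have "closed G"
    unfolding G_def using continuous_closed_preimage[OF assms(1) closed_atLeastAtMost closed_closure, of U]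
    by (simp add: vimage_def Int_def)
  moreover have ne: "G \<noteq> {}" using assms by (auto simp: G_def)
  moreover have bdd: "bdd_below G" by (rule bdd_belowI[of _ s]) (auto simp: G_def)
  ultimately have "Inf G \<in> G" by (intro closed_contains_Inf)
  define p where "p = Inf G"
  have p: "p \<in> G" "\<And>x. x \<in> G \<Longrightarrow> p \<le> x"
    using \<open>Inf G \<in> G\<close> cInf_lower[OF _ bdd] by (auto simp: p_def)
  have before: "f x \<notin> closure U" if "x \<in> {s..<p}" for x
    using p that by (fastforce simp: G_def)
  have "f p \<notin> U"
  proof
    assume fp: "f p \<in> U"
    then have "s < p" using assms(4) p(1) by (cases "s = p") (auto simp: G_def)
    have "continuous_on {s..p} f" using assms(1) p(1) by (rule_tac continuous_on_subset) (auto simp: G_def)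
    then have "connected (f ` {s..p})" by (intro connected_continuous_image) auto
    then have "f ` {s..p} \<inter> frontier U \<noteq> {}"
    proof (rule connected_Int_frontier)
      show "f ` {s..p} \<inter> U \<noteq> {}" proof -
        have "f p \<in> f ` {s..p} \<inter> U" using fp \<open>s < p\<close> by simp
        then show ?thesis by blast
      qed
      show "f ` {s..p} - U \<noteq> {}" proof -
        have "f s \<in> f ` {s..p} - U" using assms(4) \<open>s < p\<close> by simp
        then show ?thesis by blast
      qed
    qed
    then obtain x where "x \<in> {s..p}" "f x \<in> frontier U" by blast
    then show False
      using before[of x] fp assms(3) by (cases "x = p") (auto simp: frontier_def interior_open)
  qed
  then have "f p \<in> frontier U" using p(1) assms(3) by (auto simp: G_def frontier_def interior_open)
  moreover have "f x \<notin> U" if "x \<in> {s..p}" for x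
    using that before[of x] \<open>f p \<notin> U\<close> closure_subset[of U] by (cases "x = p") auto
  ultimately show ?thesis using that p(1) by (auto simp: G_def)
qed

lemma last_exit:
  fixes f :: "real \<Rightarrow> complex"
  assumes "continuous_on {r..t} f" "r \<le> t" "open U" "f t \<notin> U" "f r \<in> closure U"
  obtains q where "r \<le> q" "q \<le> t" "f q \<in> frontier U" "\<And>x. x \<in> {q..t} \<Longrightarrow> f x \<notin> U"
proof -
  have "continuous_on {-t..-r} (\<lambda>x. f (- x))"
    by (rule continuous_on_compose2[OF assms(1)]) (auto intro!: continuous_intros)
  then obtain p where "-t \<le> p" "p \<le> -r" "f (-p) \<in> frontier U" "\<And>x. x \<in> {-t..p} \<Longrightarrow> f (-x) \<notin> U"
    using first_entry[of "-t" "-r" "\<lambda>x. f (-x)" U] assms by auto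
  then show ?thesis using that[of "-p"] by (metis add.inverse_inverse atLeastAtMost_iff neg_le_iff_le minus_le_iff)
qed

lemma relpow_sub:
  assumes "\<And>i. i < n \<Longrightarrow> (p i, p (Suc i)) \<in> R" "i \<le> k" "k \<le> n"
  shows "(p i, p k) \<in> R ^^ (k - i)"
  unfolding relpow_fun_conv by (rule exI[of _ "\<lambda>m. p (i + m)"]) (use assms in auto)

context plane_carpet
begin

text \<open>A jump between two points on the boundary of a single disk met by the curve; its cost is
  the oscillation on that disk.\<close>

definition disk_link :: "(real \<Rightarrow> complex) \<Rightarrow> real \<Rightarrow> real \<Rightarrow> real \<Rightarrow> real \<Rightarrow> bool" where
  "disk_link f a b s t \<longleftrightarrow> (\<exists>j\<in>hit Q (f ` {a..b}). f s \<in> frontier (Q j) \<and> f t \<in> frontier (Q j))"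

text \<open>One step of a chain: a piece of the curve that avoids the disks of \<open>A\<close>, or
  a jump. Steps may run backwards in the parameter, hence \<open>closed_segment\<close>.\<close>

definition linked :: "(real \<Rightarrow> complex) \<Rightarrow> real \<Rightarrow> real \<Rightarrow> nat set \<Rightarrow> (real \<times> real) set" where
  "linked f a b A = {(s, t). s \<in> {a..b} \<and> t \<in> {a..b} \<and> f s \<in> S \<and> f t \<in> S \<and>
     (hit Q (f ` closed_segment s t) \<inter> A = {} \<or> disk_link f a b s t)}"

lemma linked_sym: "(s, t) \<in> linked f a b A \<Longrightarrow> (t, s) \<in> linked f a b A"
  by (auto simp: linked_def disk_link_def closed_segment_commute)

text \<open>Induction on \<open>A\<close>: a piece meeting the new disk \<open>Q j\<close> is
  replaced by the part up to the first contact with its closure, a jump along its boundary, and the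
  part after the last contact.\<close>

lemma linked_rtrancl:
  assumes "continuous_on {a..b} f" "a \<le> b" "f a \<in> S" "f b \<in> S" "finite A"
  shows "(a, b) \<in> (linked f a b A)\<^sup>*"
  using assms(5)
proof (induction A)
  case empty
  then show ?case using assms by (auto simp: linked_def)
next
  case (insert j A)
  let ?R = "linked f a b (insert j A)"
  have ordered: "(s, t) \<in> ?R\<^sup>*" if "(s, t) \<in> linked f a b A" "s \<le> t" for s t
  proof (cases "(s, t) \<in> ?R")
    case False
    have st: "a \<le> s" "t \<le> b" "f s \<in> S" "f t \<in> S" using that by (auto simp: linked_def)
    have "\<not> disk_link f a b s t" using False that by (auto simp: linked_def)
    then have avoid: "hit Q (f ` {s..t}) \<inter> A = {}" using that by (auto simp: linked_def closed_segment_eq_real_ivl)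
    have "j \<in> hit Q (f ` {s..t})"
      using False avoid st that(2) by (auto simp: linked_def closed_segment_eq_real_ivl)
    then obtain r where r: "s \<le> r" "r \<le> t" "f r \<in> Q j" by (auto simp: hit_def)
    have j: "j \<in> hit Q (f ` {a..b})" using r st by (auto simp: hit_def)
    have fr: "f r \<in> closure (Q j)" using r(3) closure_subset by blast
    have "continuous_on {s..r} f" "continuous_on {r..t} f"
      using assms(1) by (rule continuous_on_subset, use r st in auto)+
    then obtain p q where p: "s \<le> p" "p \<le> r" "f p \<in> frontier (Q j)" "\<And>x. x \<in> {s..p} \<Longrightarrow> f x \<notin> Q j"
      and q: "r \<le> q" "q \<le> t" "f q \<in> frontier (Q j)" "\<And>x. x \<in> {q..t} \<Longrightarrow> f x \<notin> Q j"
      using first_entry[of s r f "Q j"] last_exit[of r t f "Q j"] r st fr in_S_notin_Q by (metis open_Q)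
    have "f p \<in> S" "f q \<in> S" using p(3) q(3) frontier_subset_S by auto
    have sub: "hit Q (f ` {s..p}) \<subseteq> hit Q (f ` {s..t})" "hit Q (f ` {q..t}) \<subseteq> hit Q (f ` {s..t})"
      by (intro hit_mono image_mono; use p(1,2) q(1,2) r in auto)+
    have "j \<notin> hit Q (f ` {s..p})" "j \<notin> hit Q (f ` {q..t})"
      using p(4) q(4) by (auto simp: hit_def)
    then have "hit Q (f ` {s..p}) \<inter> insert j A = {}" "hit Q (f ` {q..t}) \<inter> insert j A = {}"
      using sub avoid by auto
    then have "(s, p) \<in> ?R" "(q, t) \<in> ?R"
      using st p q r \<open>f p \<in> S\<close> \<open>f q \<in> S\<close> by (auto simp: linked_def closed_segment_eq_real_ivl)
    moreover have "(p, q) \<in> ?R"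
      using st p q r \<open>f p \<in> S\<close> \<open>f q \<in> S\<close> j by (auto simp: linked_def disk_link_def)
    ultimately show ?thesis by (meson converse_rtrancl_into_rtrancl r_into_rtrancl)
  qed auto
  have "linked f a b A \<subseteq> ?R\<^sup>*"
  proof
    fix x assume x: "x \<in> linked f a b A"
    obtain s t where st: "x = (s, t)" by (cases x)
    show "x \<in> ?R\<^sup>*"
    proof (cases "s \<le> t")
      case False
      then have "(t, s) \<in> ?R\<^sup>*" using ordered[of t s] linked_sym x st by auto
      moreover have "sym ?R" using linked_sym by (auto intro: symI)
      ultimately show ?thesis using st sym_rtrancl by (metis symD)
    qed (use ordered x st in auto)
  qed
  then show ?case using insert.IH rtrancl_subset_rtrancl by blast
qed

text \<open>
  A shortest chain of links from one end of the curve to the other uses every disk at most once as a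
  link, and no disk meets more than three of its segments, as otherwise that disk gives a shortcut.
\<close>

lemma diff_le_osc_sum_add_tail:
  fixes f :: "real \<Rightarrow> complex" and \<phi> :: "complex \<Rightarrow> real" and \<rho> :: "nat \<Rightarrow> ennreal"
  assumes cont: "continuous_on {a..b} f" and ab: "a \<le> b" "f a \<in> S" "f b \<in> S"
    and est: "\<And>s t. a \<le> s \<Longrightarrow> s \<le> t \<Longrightarrow> t \<le> b \<Longrightarrow> f s \<in> S \<Longrightarrow> f t \<in> S \<Longrightarrow>
      ennreal \<bar>\<phi> (f s) - \<phi> (f t)\<bar> \<le> (\<Sum>\<^sub>\<infinity>i\<in>hit Q (f ` {s..t}). \<rho> i)"
    and A: "finite A"
  shows "ennreal \<bar>\<phi> (f a) - \<phi> (f b)\<bar> \<le> (\<Sum>\<^sub>\<infinity>i\<in>hit Q (f ` {a..b}). osc (Q i) (\<lambda>x. ereal (\<phi> x)))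
      + 3 * (\<Sum>\<^sub>\<infinity>i\<in>hit Q (f ` {a..b}) - A. \<rho> i)"
proof -
  define R where "R = linked f a b A"
  define H where "H = hit Q (f ` {a..b})"
  have "\<exists>n. (a, b) \<in> R ^^ n"
    using linked_rtrancl[OF cont ab A] unfolding R_def by (rule rtrancl_imp_relpow[THEN exE]) blast
  define n where "n = (LEAST n. (a, b) \<in> R ^^ n)"
  have "(a, b) \<in> R ^^ n" unfolding n_def using \<open>\<exists>n. (a, b) \<in> R ^^ n\<close> by (rule LeastI_ex)
  have least: "n \<le> m" if "(a, b) \<in> R ^^ m" for m unfolding n_def using that by (rule Least_le)
  obtain p where p: "p 0 = a" "p n = b" "\<And>i. i < n \<Longrightarrow> (p i, p (Suc i)) \<in> R"
    using \<open>(a, b) \<in> R ^^ n\<close> unfolding relpow_fun_conv by blast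
  \<comment> \<open>By minimality no stretch of the chain can be replaced by fewer links.\<close>
  have shortcut: "k - i \<le> m" if "i \<le> k" "k \<le> n" "(p i, p k) \<in> R ^^ m" for i k m
  proof -
    have "(a, p i) \<in> R ^^ i" using relpow_sub[of n p R 0 i] p that by simp
    moreover have "(p k, b) \<in> R ^^ (n - k)" using relpow_sub[of n p R k n] p that by simp
    ultimately have "(a, b) \<in> R ^^ (i + m + (n - k))"
      using that(3) unfolding relpow_add by blast
    then show ?thesis using least that by fastforce
  qed
  have T: "p i \<in> {a..b}" "f (p i) \<in> S" if "i \<le> n" for i
    using p(3)[of i] p(3)[of "i - 1"] that p(1,2) ab by (cases "i = 0"; auto simp: R_def linked_def)+
  define D where "D = {k. k < n \<and> disk_link f a b (p k) (p (Suc k))}"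
  define G where "G = {k. k < n \<and> \<not> disk_link f a b (p k) (p (Suc k))}"
  define \<sigma> where "\<sigma> k = hit Q (f ` closed_segment (p k) (p (Suc k)))" for k
  have fin: "finite D" "finite G" by (auto simp: D_def G_def)
  have DG: "{..<n} = D \<union> G" "D \<inter> G = {}" by (auto simp: D_def G_def)
  have "\<forall>k\<in>D. \<exists>j. j \<in> H \<and> f (p k) \<in> frontier (Q j) \<and> f (p (Suc k)) \<in> frontier (Q j)"
    by (auto simp: D_def disk_link_def H_def)
  then obtain j where j: "\<And>k. k \<in> D \<Longrightarrow> j k \<in> H \<and> f (p k) \<in> frontier (Q (j k)) \<and> f (p (Suc k)) \<in> frontier (Q (j k))"
    by metis
  \<comment> \<open>Two jumps over the same disk would merge into one, from the start of the first
    to the end of the second.\<close>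
  have "j k \<noteq> j l" if "k \<in> D" "l \<in> D" "k < l" for k l
  proof
    assume "j k = j l"
    then have "(p k, p (Suc l)) \<in> R"
      using j[OF that(1)] j[OF that(2)] T[of k] T[of "Suc l"] that
      by (auto simp: R_def linked_def disk_link_def D_def H_def)
    then have "Suc l - k \<le> 1" using shortcut[of k "Suc l" 1] that by (auto simp: D_def)
    then show False using that by simp
  qed
  then have inj: "inj_on j D" by (metis inj_onI linorder_neqE_nat)
  have sumD: "(\<Sum>k\<in>D. ennreal \<bar>\<phi> (f (p k)) - \<phi> (f (p (Suc k)))\<bar>)
      \<le> (\<Sum>\<^sub>\<infinity>i\<in>H. osc (Q i) (\<lambda>x. ereal (\<phi> x)))"
  proof -
    have "(\<Sum>k\<in>D. ennreal \<bar>\<phi> (f (p k)) - \<phi> (f (p (Suc k)))\<bar>) \<le> (\<Sum>k\<in>D. osc (Q (j k)) (\<lambda>x. ereal (\<phi> x)))"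
    proof (rule sum_mono)
      fix k assume "k \<in> D"
      then show "ennreal \<bar>\<phi> (f (p k)) - \<phi> (f (p (Suc k)))\<bar> \<le> osc (Q (j k)) (\<lambda>x. ereal (\<phi> x))"
        using j[of k] ennreal_diff_le_osc[of "f (p k)" "Q (j k)" "f (p (Suc k))" \<phi>]
          ennreal_diff_le_osc[of "f (p (Suc k))" "Q (j k)" "f (p k)" \<phi>]
        by (auto simp: abs_real_def)
    qed
    also have "\<dots> = (\<Sum>i\<in>j ` D. osc (Q i) (\<lambda>x. ereal (\<phi> x)))"
      using inj by (simp add: sum.reindex)
    also have "\<dots> = (\<Sum>\<^sub>\<infinity>i\<in>j ` D. osc (Q i) (\<lambda>x. ereal (\<phi> x)))" using fin by simp
    also have "\<dots> \<le> (\<Sum>\<^sub>\<infinity>i\<in>H. osc (Q i) (\<lambda>x. ereal (\<phi> x)))"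
      using j by (intro infsum_mono_ennreal) auto
    finally show ?thesis .
  qed
  have \<sigma>: "\<sigma> k \<subseteq> H - A" if "k \<in> G" for k
  proof -
    have "(p k, p (Suc k)) \<in> R" using p(3) that by (auto simp: G_def)
    then have "\<sigma> k \<inter> A = {}" using that by (auto simp: G_def R_def linked_def \<sigma>_def)
    moreover have "closed_segment (p k) (p (Suc k)) \<subseteq> {a..b}"
      using T[of k] T[of "Suc k"] that by (auto simp: G_def closed_segment_eq_real_ivl)
    then have "\<sigma> k \<subseteq> H" unfolding \<sigma>_def H_def by (intro hit_mono image_mono)
    ultimately show ?thesis by blast
  qed
  have cross: "\<exists>x\<in>closed_segment u r. f x \<in> frontier (Q i)"
    if "closed_segment u r \<subseteq> {a..b}" "f u \<in> S" "f r \<in> Q i" for u r i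
  proof -
    have "connected (f ` closed_segment u r)"
      using cont that(1) by (intro connected_continuous_image continuous_on_subset[OF cont]) auto
    then have "f ` closed_segment u r \<inter> frontier (Q i) \<noteq> {}"
    proof (rule connected_Int_frontier)
      show "f ` closed_segment u r \<inter> Q i \<noteq> {}" using that(3) by auto
      show "f ` closed_segment u r - Q i \<noteq> {}" using that(2) in_S_notin_Q by auto
    qed
    then show ?thesis by auto
  qed
  \<comment> \<open>If \<open>l\<close> were at least \<open>k + 3\<close>, walking along segment
    \<open>k\<close> to the boundary of \<open>Q i\<close>, jumping, and walking on to
    \<open>p (Suc l)\<close> would replace at least four links by three. The two walks stay inside
    segments that avoid \<open>A\<close>, so they are legitimate steps.\<close>
  have near: "l \<le> k + 2" if kl: "k \<in> G" "l \<in> G" "i \<in> \<sigma> k" "i \<in> \<sigma> l" for k l i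
  proof (rule ccontr)
    assume "\<not> l \<le> k + 2"
    have kn: "k < n" "l < n" using kl by (auto simp: G_def)
    obtain r where r: "r \<in> closed_segment (p k) (p (Suc k))" "f r \<in> Q i" using kl(3) by (auto simp: \<sigma>_def hit_def)
    obtain r' where r': "r' \<in> closed_segment (p l) (p (Suc l))" "f r' \<in> Q i" using kl(4) by (auto simp: \<sigma>_def hit_def)
    have seg: "closed_segment (p m) (p (Suc m)) \<subseteq> {a..b}" if "m < n" for m
      using T[of m] T[of "Suc m"] that by (auto simp: closed_segment_eq_real_ivl)
    have sub: "closed_segment (p k) r \<subseteq> closed_segment (p k) (p (Suc k))"
      "closed_segment (p (Suc l)) r' \<subseteq> closed_segment (p l) (p (Suc l))"
      using r(1) r'(1) by (auto simp: subset_closed_segment)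
    obtain x where x: "x \<in> closed_segment (p k) r" "f x \<in> frontier (Q i)"
      using cross[of "p k" r i] r(2) sub seg[OF kn(1)] T[of k] kn by auto
    obtain y where y: "y \<in> closed_segment (p (Suc l)) r'" "f y \<in> frontier (Q i)"
      using cross[of "p (Suc l)" r' i] r'(2) sub seg[OF kn(2)] T[of "Suc l"] kn by auto
    have xy: "x \<in> {a..b}" "y \<in> {a..b}" "f x \<in> S" "f y \<in> S"
      using x y sub seg kn frontier_subset_S by blast+
    have "closed_segment (p k) x \<subseteq> closed_segment (p k) (p (Suc k))"
      "closed_segment y (p (Suc l)) \<subseteq> closed_segment (p l) (p (Suc l))"
    proof -
      have "x \<in> closed_segment (p k) (p (Suc k))" "y \<in> closed_segment (p l) (p (Suc l))"
        using x(1) y(1) sub by blast+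
      then show "closed_segment (p k) x \<subseteq> closed_segment (p k) (p (Suc k))"
        "closed_segment y (p (Suc l)) \<subseteq> closed_segment (p l) (p (Suc l))"
        by (auto simp: subset_closed_segment)
    qed
    then have "hit Q (f ` closed_segment (p k) x) \<subseteq> \<sigma> k" "hit Q (f ` closed_segment y (p (Suc l))) \<subseteq> \<sigma> l"
      unfolding \<sigma>_def using hit_mono[OF image_mono] by blast+
    then have avoid: "hit Q (f ` closed_segment (p k) x) \<inter> A = {}" "hit Q (f ` closed_segment y (p (Suc l))) \<inter> A = {}"
      using \<sigma> kl(1,2) by blast+
    have "(p k, x) \<in> R" "(y, p (Suc l)) \<in> R"
      using avoid T[of k] T[of "Suc l"] kn xy by (simp_all add: R_def linked_def)
    moreover have "i \<in> H" using \<sigma> kl by blast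
    then have "(x, y) \<in> R"
      using x y xy by (auto simp: R_def linked_def disk_link_def H_def)
    ultimately have "(p k, p (Suc l)) \<in> R ^^ 3" by (auto simp: numeral_3_eq_3)
    then have "Suc l - k \<le> 3" using shortcut[of k "Suc l" 3] kn \<open>\<not> l \<le> k + 2\<close> by simp
    then show False using \<open>\<not> l \<le> k + 2\<close> by simp
  qed
  have sumG: "(\<Sum>k\<in>G. ennreal \<bar>\<phi> (f (p k)) - \<phi> (f (p (Suc k)))\<bar>) \<le> 3 * (\<Sum>\<^sub>\<infinity>i\<in>H - A. \<rho> i)"
  proof -
    have "(\<Sum>k\<in>G. ennreal \<bar>\<phi> (f (p k)) - \<phi> (f (p (Suc k)))\<bar>) \<le> (\<Sum>k\<in>G. \<Sum>\<^sub>\<infinity>i\<in>H - A. \<rho> i * indicator (\<sigma> k) i)"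
    proof (rule sum_mono)
      fix k assume k: "k \<in> G"
      then have kn: "k < n" by (simp add: G_def)
      have "ennreal \<bar>\<phi> (f (p k)) - \<phi> (f (p (Suc k)))\<bar> \<le> infsum \<rho> (\<sigma> k)"
      proof (cases "p k \<le> p (Suc k)")
        case True
        then show ?thesis using est[of "p k" "p (Suc k)"] T[of k] T[of "Suc k"] kn
          by (simp add: \<sigma>_def closed_segment_eq_real_ivl)
      next
        case False
        then show ?thesis using est[of "p (Suc k)" "p k"] T[of k] T[of "Suc k"] kn
          by (simp add: \<sigma>_def closed_segment_eq_real_ivl abs_minus_commute)
      qed
      also have "infsum \<rho> (\<sigma> k) = (\<Sum>\<^sub>\<infinity>i\<in>\<sigma> k. \<rho> i * indicator (\<sigma> k) i)"
        by (intro infsum_cong) simp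
      also have "\<dots> = (\<Sum>\<^sub>\<infinity>i\<in>H - A. \<rho> i * indicator (\<sigma> k) i)"
        using \<sigma>[OF k] by (intro infsum_zero_outside_ennreal[symmetric]) auto
      finally show "ennreal \<bar>\<phi> (f (p k)) - \<phi> (f (p (Suc k)))\<bar> \<le> (\<Sum>\<^sub>\<infinity>i\<in>H - A. \<rho> i * indicator (\<sigma> k) i)" .
    qed
    also have "\<dots> = (\<Sum>\<^sub>\<infinity>i\<in>H - A. \<Sum>k\<in>G. \<rho> i * indicator (\<sigma> k) i)"
      by (simp add: infsum_sum_ennreal)
    also have "\<dots> \<le> (\<Sum>\<^sub>\<infinity>i\<in>H - A. 3 * \<rho> i)"
    proof (rule infsum_mono_ennreal)
      fix i
      define K where "K = {k\<in>G. i \<in> \<sigma> k}"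
      have "card K \<le> 3"
      proof (cases "K = {}")
        case False
        have finK: "finite K" using fin by (simp add: K_def)
        \<comment> \<open>The segments meeting \<open>Q i\<close> have indices within two of the
          smallest one, which gives the factor 3.\<close>
        have "K \<subseteq> {Min K..Min K + 2}"
        proof
          fix l assume l: "l \<in> K"
          have "Min K \<in> K" using finK False by (rule Min_in)
          then have "l \<le> Min K + 2" using near[of "Min K" l i] l by (auto simp: K_def)
          then show "l \<in> {Min K..Min K + 2}" using l finK by simp
        qed
        then have "card K \<le> card {Min K..Min K + 2}" by (intro card_mono) auto
        then show ?thesis by simp
      qed simp
      have "(\<Sum>k\<in>G. \<rho> i * indicator (\<sigma> k) i) = \<rho> i * (\<Sum>k\<in>G. indicator (\<sigma> k) i)"
        by (simp add: sum_distrib_left)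
      also have "(\<Sum>k\<in>G. indicator (\<sigma> k) i) = (of_nat (card K) :: ennreal)"
      proof -
        have "(\<Sum>k\<in>G. indicator (\<sigma> k) i) = (\<Sum>k\<in>K. 1 :: ennreal)"
          using fin by (intro sum.mono_neutral_cong_right) (auto simp: K_def)
        then show ?thesis by simp
      qed
      also have "\<rho> i * of_nat (card K) \<le> \<rho> i * of_nat 3"
        using \<open>card K \<le> 3\<close> by (intro mult_left_mono of_nat_mono) auto
      finally show "(\<Sum>k\<in>G. \<rho> i * indicator (\<sigma> k) i) \<le> 3 * \<rho> i" by (simp add: mult.commute)
    qed simp
    also have "\<dots> = 3 * (\<Sum>\<^sub>\<infinity>i\<in>H - A. \<rho> i)" by (rule infsum_cmult_ennreal)
    finally show ?thesis .
  qed
  have "\<bar>\<phi> (f a) - \<phi> (f b)\<bar> \<le> (\<Sum>k<n. \<bar>\<phi> (f (p k)) - \<phi> (f (p (Suc k)))\<bar>)"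
  proof -
    have "\<bar>\<phi> (f (p 0)) - \<phi> (f (p m))\<bar> \<le> (\<Sum>k<m. \<bar>\<phi> (f (p k)) - \<phi> (f (p (Suc k)))\<bar>)" for m
    proof (induction m)
      case (Suc m)
      then show ?case
        using abs_triangle_ineq4[of "\<phi> (f (p 0)) - \<phi> (f (p m))" "\<phi> (f (p (Suc m))) - \<phi> (f (p m))"]
        by (simp add: abs_minus_commute)
    qed simp
    from this[of n] show ?thesis using p by simp
  qed
  then have "ennreal \<bar>\<phi> (f a) - \<phi> (f b)\<bar> \<le> (\<Sum>k<n. ennreal \<bar>\<phi> (f (p k)) - \<phi> (f (p (Suc k)))\<bar>)"
    by (simp add: sum_ennreal ennreal_leI)
  also have "\<dots> = (\<Sum>k\<in>D. ennreal \<bar>\<phi> (f (p k)) - \<phi> (f (p (Suc k)))\<bar>)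
      + (\<Sum>k\<in>G. ennreal \<bar>\<phi> (f (p k)) - \<phi> (f (p (Suc k)))\<bar>)"
    unfolding DG(1) using fin DG(2) by (intro sum.union_disjoint)
  also have "\<dots> \<le> (\<Sum>\<^sub>\<infinity>i\<in>H. osc (Q i) (\<lambda>x. ereal (\<phi> x))) + 3 * (\<Sum>\<^sub>\<infinity>i\<in>H - A. \<rho> i)"
    by (intro add_mono sumD sumG)
  finally show ?thesis by (simp add: H_def)
qed

text \<open>Self-improvement: in the previous estimate \<open>\<rho>\<close> enters only through the
  disks outside \<open>A\<close>, and a finite \<open>A\<close> can exhaust the finite sum up to
  \<open>e / 3\<close>. What survives is the oscillation of \<open>\<phi>\<close> itself, whatever
  its relation to \<open>\<rho>\<close>.\<close>

lemma diff_le_osc_sum: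
  fixes f :: "real \<Rightarrow> complex" and \<phi> :: "complex \<Rightarrow> real" and \<rho> :: "nat \<Rightarrow> ennreal"
  assumes "continuous_on {a..b} f" "a \<le> b" "f a \<in> S" "f b \<in> S"
    and "\<And>s t. a \<le> s \<Longrightarrow> s \<le> t \<Longrightarrow> t \<le> b \<Longrightarrow> f s \<in> S \<Longrightarrow> f t \<in> S \<Longrightarrow>
      ennreal \<bar>\<phi> (f s) - \<phi> (f t)\<bar> \<le> (\<Sum>\<^sub>\<infinity>i\<in>hit Q (f ` {s..t}). \<rho> i)"
    and "(\<Sum>\<^sub>\<infinity>i\<in>hit Q (f ` {a..b}). \<rho> i) < \<infinity>"
  shows "ennreal \<bar>\<phi> (f a) - \<phi> (f b)\<bar> \<le> (\<Sum>\<^sub>\<infinity>i\<in>hit Q (f ` {a..b}). osc (Q i) (\<lambda>x. ereal (\<phi> x)))"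
proof (rule ennreal_le_epsilon)
  fix e :: real assume e: "0 < e"
  then have "0 < ennreal (e / 3)" by simp
  then obtain A where A: "finite A" "A \<subseteq> hit Q (f ` {a..b})"
      "infsum \<rho> (hit Q (f ` {a..b}) - A) < ennreal (e / 3)"
    using infsum_tail_ennreal[OF assms(6)] by metis
  have "ennreal \<bar>\<phi> (f a) - \<phi> (f b)\<bar> \<le> (\<Sum>\<^sub>\<infinity>i\<in>hit Q (f ` {a..b}). osc (Q i) (\<lambda>x. ereal (\<phi> x)))
      + 3 * (\<Sum>\<^sub>\<infinity>i\<in>hit Q (f ` {a..b}) - A. \<rho> i)"
    by (rule diff_le_osc_sum_add_tail[OF assms(1-5) A(1)])
  also have "\<dots> \<le> (\<Sum>\<^sub>\<infinity>i\<in>hit Q (f ` {a..b}). osc (Q i) (\<lambda>x. ereal (\<phi> x))) + 3 * ennreal (e / 3)"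
    using A(3) by (intro add_left_mono mult_left_mono) auto
  also have "3 * ennreal (e / 3) = ennreal e"
    using e by (simp flip: ennreal_numeral ennreal_mult)
  finally show "ennreal \<bar>\<phi> (f a) - \<phi> (f b)\<bar>
      \<le> (\<Sum>\<^sub>\<infinity>i\<in>hit Q (f ` {a..b}). osc (Q i) (\<lambda>x. ereal (\<phi> x))) + ennreal e" .
qed

end

section \<open>The Caccioppoli inequality\<close>

lemma osc_le:
  assumes "\<And>x. x \<in> frontier U \<Longrightarrow> \<phi> x \<le> B" "\<And>x. x \<in> frontier U \<Longrightarrow> b \<le> \<phi> x"
  shows "osc U (\<lambda>x. ereal (\<phi> x)) \<le> ennreal (B - b)"
proof -
  have "max_disk U (\<lambda>x. ereal (\<phi> x)) - min_disk U (\<lambda>x. ereal (\<phi> x)) \<le> ereal B - ereal b"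
    unfolding max_disk_def min_disk_def
    by (intro ereal_minus_mono SUP_least INF_greatest) (use assms in auto)
  then have "osc U (\<lambda>x. ereal (\<phi> x)) \<le> e2ennreal (ereal (B - b))"
    unfolding osc_def by (intro e2ennreal_mono) simp
  then show ?thesis by (simp add: e2ennreal_ereal)
qed

lemma abs_ereal_diff_le_iff:
  "\<bar>ereal a - ereal b\<bar> \<le> enn2ereal X \<longleftrightarrow> ennreal \<bar>a - b\<bar> \<le> X"
  by (simp add: less_eq_ennreal.rep_eq)

lemma subcurve_is_curve:
  assumes "is_curve \<gamma>" "{s..t} \<subseteq> fst \<gamma>" "s \<le> t"
  shows "is_curve ({s..t}, snd \<gamma>)" "subcurve ({s..t}, snd \<gamma>) \<gamma>"
proof -
  obtain h where h: "continuous_on (closure (fst \<gamma>)) h" "\<forall>t\<in>fst \<gamma>. h t = snd \<gamma> t"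
    using assms(1) unfolding is_curve_def by blast
  have "{s..t} \<subseteq> closure (fst \<gamma>)" using assms(2) closure_subset by (rule order_trans)
  then have "continuous_on {s..t} h" using h(1) continuous_on_subset by blast
  moreover have "\<forall>x\<in>{s..t}. h x = snd \<gamma> x" using h(2) assms(2) by blast
  ultimately show "is_curve ({s..t}, snd \<gamma>)"
    using assms(3) unfolding is_curve_def by (auto simp: is_interval_cc)
  show "subcurve ({s..t}, snd \<gamma>) \<gamma>" using assms by (simp add: subcurve_def is_interval_cc)
qed

lemma sobolev_sums_finite_subset:
  assumes "sobolev_sums_finite Q g I" "J \<subseteq> I"
  shows "sobolev_sums_finite Q g J"
  using assms infsum_mono_ennreal[OF assms(2), of "\<lambda>i. (osc (Q i) g)\<^sup>2" "\<lambda>i. (osc (Q i) g)\<^sup>2"]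
    infsum_mono_ennreal[OF assms(2), of "\<lambda>i. e2ennreal ((max_disk (Q i) g)\<^sup>2) * ennreal ((diameter (Q i))\<^sup>2)"
      "\<lambda>i. e2ennreal ((max_disk (Q i) g)\<^sup>2) * ennreal ((diameter (Q i))\<^sup>2)"]
  by (auto simp: sobolev_sums_finite_def intro: order_le_less_trans)

lemma ennreal_square_add_le: "(a + b)\<^sup>2 \<le> 2 * (a\<^sup>2 + b\<^sup>2 :: ennreal)"
proof (cases "a = \<infinity> \<or> b = \<infinity>")
  case False
  then obtain x y where xy: "a = ennreal x" "b = ennreal y" "0 \<le> x" "0 \<le> y"
    by (metis ennreal_cases infinity_ennreal_def)
  have "(x + y)\<^sup>2 \<le> 2 * (x\<^sup>2 + y\<^sup>2)"
    using zero_le_power2[of "x - y"] by (simp add: power2_eq_square algebra_simps)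
  then show ?thesis using xy by (simp add: ennreal_power ennreal_leI flip: ennreal_plus ennreal_numeral ennreal_mult)
qed (auto simp: power2_eq_square ennreal_mult_top)

lemma infsum_square_add_finite:
  fixes f g :: "'i \<Rightarrow> ennreal"
  assumes "(\<Sum>\<^sub>\<infinity>i\<in>I. (f i)\<^sup>2) < \<infinity>" "(\<Sum>\<^sub>\<infinity>i\<in>I. (g i)\<^sup>2) < \<infinity>"
  shows "(\<Sum>\<^sub>\<infinity>i\<in>I. (f i + g i)\<^sup>2) < \<infinity>"
proof -
  have "(\<Sum>\<^sub>\<infinity>i\<in>I. (f i + g i)\<^sup>2) \<le> (\<Sum>\<^sub>\<infinity>i\<in>I. 2 * ((f i)\<^sup>2 + (g i)\<^sup>2))"
    by (intro infsum_mono_ennreal ennreal_square_add_le) auto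
  also have "\<dots> = 2 * ((\<Sum>\<^sub>\<infinity>i\<in>I. (f i)\<^sup>2) + (\<Sum>\<^sub>\<infinity>i\<in>I. (g i)\<^sup>2))"
    by (simp add: infsum_cmult_ennreal infsum_add_ennreal)
  also have "\<dots> < \<infinity>" using assms by (simp add: ennreal_mult_less_top)
  finally show ?thesis .
qed

lemma infsum_square_cmult_finite:
  fixes f :: "'i \<Rightarrow> ennreal"
  assumes "(\<Sum>\<^sub>\<infinity>i\<in>I. (f i)\<^sup>2) < \<infinity>"
  shows "(\<Sum>\<^sub>\<infinity>i\<in>I. (ennreal c * f i)\<^sup>2) < \<infinity>"
proof -
  have "(ennreal c)\<^sup>2 < \<infinity>" by (simp add: power2_eq_square ennreal_mult_less_top)
  then show ?thesis using assms by (simp add: power_mult_distrib infsum_cmult_ennreal ennreal_mult_less_top)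
qed

lemma summable_on_of_infsum_ennreal:
  fixes h :: "'i \<Rightarrow> real"
  assumes "(\<Sum>\<^sub>\<infinity>i\<in>I. ennreal (h i)) < \<infinity>" "\<And>i. i \<in> I \<Longrightarrow> 0 \<le> h i"
  shows "h summable_on I" "ennreal (infsum h I) = (\<Sum>\<^sub>\<infinity>i\<in>I. ennreal (h i))"
proof -
  obtain B where B: "0 \<le> B" "(\<Sum>\<^sub>\<infinity>i\<in>I. ennreal (h i)) = ennreal B"
    using assms(1) by (cases "\<Sum>\<^sub>\<infinity>i\<in>I. ennreal (h i)") auto
  show s: "h summable_on I"
  proof (rule nonneg_bdd_above_summable_on)
    show "bdd_above (sum h ` {F. F \<subseteq> I \<and> finite F})"
    proof (rule bdd_aboveI2)
      fix F assume F: "F \<in> {F. F \<subseteq> I \<and> finite F}"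
      have "ennreal (sum h F) = (\<Sum>i\<in>F. ennreal (h i))"
        using F assms(2) by (subst sum_ennreal) auto
      also have "\<dots> \<le> ennreal B"
        using F infsum_le_iff_ennreal[of "\<lambda>i. ennreal (h i)" I "ennreal B"] B(2) by auto
      finally show "sum h F \<le> B" using B by (simp add: ennreal_le_iff)
    qed
  qed (use assms(2) in auto)
  have "ennreal (infsum h I) = (SUP F\<in>{F. finite F \<and> F \<subseteq> I}. ennreal (sum h F))"
    by (rule infsum_nonneg_is_SUPREMUM_ennreal[OF s assms(2)])
  also have "\<dots> = (SUP F\<in>{F. finite F \<and> F \<subseteq> I}. \<Sum>i\<in>F. ennreal (h i))"
    by (intro SUP_cong refl, subst sum_ennreal) (use assms(2) in auto)
  also have "\<dots> = (\<Sum>\<^sub>\<infinity>i\<in>I. ennreal (h i))"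
    by (rule nonneg_infsum_complete[symmetric]) simp
  finally show "ennreal (infsum h I) = (\<Sum>\<^sub>\<infinity>i\<in>I. ennreal (h i))" .
qed

text \<open>For fixed \<open>k\<close> the increment from \<open>x\<close> to \<open>X\<close> has
  the sign of \<open>x * X - t * k\<close>, and \<open>t * k \<le> 1 \<le> x * X\<close>. This is
  why \<open>U\<close> is normalized to be at least 1 while \<open>t\<close> and the cutoff are at
  most 1.\<close>

lemma add_quotient_mono:
  fixes x :: real
  assumes "1 \<le> x" "x \<le> X" "0 \<le> k" "k \<le> K" "k \<le> 1" "0 \<le> t" "t \<le> 1"
  shows "x + t * k / x \<le> X + t * K / X"
proof -
  have "t * k \<le> 1 * 1" using assms by (intro mult_mono) auto
  moreover have "1 * 1 \<le> x * X" using assms by (intro mult_mono) auto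
  ultimately have "0 \<le> (X - x) * (x * X - t * k)" using assms by (intro mult_nonneg_nonneg) auto
  then have "x + t * k / x \<le> X + t * k / X"
    using assms by (simp add: field_simps)
  moreover have "t * k / X \<le> t * K / X" using assms by (intro divide_right_mono mult_left_mono) auto
  ultimately show ?thesis by linarith
qed

text \<open>\<open>M\<close> and \<open>m\<close> are the extremes of \<open>U\<close> on one disk,
  \<open>E\<close> and \<open>e\<close> those of the cutoff. The product on the right equals
  \<open>r * \<delta> * (2 * e + \<delta>) - p\<close>. Its mixed term is absorbed by \<open>4 * r *
  e * \<delta> \<le> r\<^sup>2 * e\<^sup>2 + 4 * \<delta>\<^sup>2\<close> and
  \<open>r\<^sup>2 * e\<^sup>2 \<le> p\<close>; the constant 6 is this 4 plus the 2 from
  \<open>2 * r * \<delta>\<^sup>2\<close>.\<close>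

lemma first_variation_bound:
  fixes m :: real
  assumes "1 \<le> m" "m \<le> M" "0 \<le> e" "e \<le> E" "E - e \<le> d"
  shows "(M - m)\<^sup>2 * e\<^sup>2 / (M * m) \<le> 6 * d\<^sup>2 - 2 * ((M - m) * (E\<^sup>2 / M - e\<^sup>2 / m))"
proof -
  define r where "r = (M - m) / M"
  define p where "p = (M - m)\<^sup>2 * e\<^sup>2 / (M * m)"
  define \<delta> where "\<delta> = E - e"
  have r: "0 \<le> r" "r \<le> 1" using assms by (auto simp: r_def field_simps)
  have \<delta>: "0 \<le> \<delta>" "\<delta>\<^sup>2 \<le> d\<^sup>2" using assms by (auto simp: \<delta>_def intro: power_mono)
  have "r\<^sup>2 * e\<^sup>2 \<le> p"
  proof -
    have "M * m \<le> M\<^sup>2" "0 < M * m" "0 < M\<^sup>2 * (M * m)" using assms by (auto simp: power2_eq_square)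
    then have "(M - m)\<^sup>2 * e\<^sup>2 / M\<^sup>2 \<le> (M - m)\<^sup>2 * e\<^sup>2 / (M * m)"
      by (intro divide_left_mono) simp_all
    then show ?thesis by (simp add: r_def p_def power_divide)
  qed
  moreover have "4 * r * e * \<delta> \<le> r\<^sup>2 * e\<^sup>2 + 4 * \<delta>\<^sup>2"
    using zero_le_power2[of "r * e - 2 * \<delta>"] by (simp add: power2_eq_square algebra_simps)
  moreover have "2 * r * \<delta>\<^sup>2 \<le> 2 * \<delta>\<^sup>2" using r by (simp add: mult_left_le_one_le)
  moreover have "2 * r * \<delta> * (2 * e + \<delta>) = 4 * r * e * \<delta> + 2 * r * \<delta>\<^sup>2"
    by (simp add: power2_eq_square algebra_simps)
  ultimately have *: "2 * r * \<delta> * (2 * e + \<delta>) \<le> p + 6 * d\<^sup>2" using \<delta> by linarith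
  have "(M - m) * (E\<^sup>2 / M - e\<^sup>2 / m) = r * \<delta> * (2 * e + \<delta>) - p"
    using assms unfolding r_def p_def \<delta>_def by (simp add: field_simps power2_eq_square)
  then show ?thesis using * by (simp add: p_def)
qed

section \<open>Sobolev functions along generic curves and admissible test functions\<close>

context plane_carpet
begin

text \<open>The definition of an upper gradient sums over the whole trace; here the sum runs only
  over the piece between the two points. Curves with a bad piece contain a curve of the null
  family.\<close>

lemma carpet_mod_upper_gradient_fails_eq_0:
  assumes "upper_gradient v UNIV Q g \<rho>"
  shows "carpet_mod v UNIV Q {\<gamma>. is_curve \<gamma> \<and> (\<exists>s t. s \<le> t \<and> {s..t} \<subseteq> fst \<gamma> \<and>
    snd \<gamma> s \<in> S \<and> snd \<gamma> t \<in> S \<and> \<not> (\<bar>g (snd \<gamma> s)\<bar> \<noteq> \<infinity> \<and> \<bar>g (snd \<gamma> t)\<bar> \<noteq> \<infinity> \<and>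
      \<bar>g (snd \<gamma> s) - g (snd \<gamma> t)\<bar> \<le> enn2ereal (\<Sum>\<^sub>\<infinity>i\<in>hit Q (snd \<gamma> ` {s..t}). \<rho> i)))} = 0"
proof -
  obtain \<Gamma>\<^sub>0 where \<Gamma>\<^sub>0: "carpet_mod v UNIV Q \<Gamma>\<^sub>0 = 0"
    "\<forall>\<gamma>\<in>curves_in UNIV - \<Gamma>\<^sub>0. \<forall>x\<in>trace \<gamma> \<inter> S. \<forall>y\<in>trace \<gamma> \<inter> S.
      \<bar>g x\<bar> \<noteq> \<infinity> \<and> \<bar>g y\<bar> \<noteq> \<infinity> \<and> \<bar>g x - g y\<bar> \<le> enn2ereal (\<Sum>\<^sub>\<infinity>i\<in>hit Q (trace \<gamma>). \<rho> i)"
    using assms unfolding upper_gradient_def by (elim exE conjE)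
  from \<Gamma>\<^sub>0(1) show ?thesis
  proof (rule carpet_mod_eq_0_mono, clarify)
    fix I f s t
    assume c: "is_curve (I, f)" and st: "s \<le> t" "{s..t} \<subseteq> fst (I, f)" "snd (I, f) s \<in> S" "snd (I, f) t \<in> S"
      and bad: "\<not> (\<bar>g (snd (I, f) s)\<bar> \<noteq> \<infinity> \<and> \<bar>g (snd (I, f) t)\<bar> \<noteq> \<infinity> \<and>
      \<bar>g (snd (I, f) s) - g (snd (I, f) t)\<bar> \<le> enn2ereal (\<Sum>\<^sub>\<infinity>i\<in>hit Q (snd (I, f) ` {s..t}). \<rho> i))"
    have tr: "trace ({s..t}, f) = f ` {s..t}" by (simp add: trace_def)
    have "({s..t}, f) \<in> \<Gamma>\<^sub>0"
    proof (rule ccontr)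
      assume "({s..t}, f) \<notin> \<Gamma>\<^sub>0"
      then have c1: "({s..t}, f) \<in> curves_in UNIV - \<Gamma>\<^sub>0"
        using subcurve_is_curve(1)[OF c st(2,1)] by (simp add: curves_in_def)
      have xy: "f s \<in> trace ({s..t}, f) \<inter> S" "f t \<in> trace ({s..t}, f) \<inter> S"
        using st by (auto simp: tr)
      have "\<bar>g (f s)\<bar> \<noteq> \<infinity> \<and> \<bar>g (f t)\<bar> \<noteq> \<infinity> \<and>
          \<bar>g (f s) - g (f t)\<bar> \<le> enn2ereal (\<Sum>\<^sub>\<infinity>i\<in>hit Q (trace ({s..t}, f)). \<rho> i)"
        by (rule \<Gamma>\<^sub>0(2)[THEN bspec, OF c1, THEN bspec, OF xy(1), THEN bspec, OF xy(2)])
      then show False using bad by (simp add: tr)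
    qed
    moreover have "subcurve ({s..t}, f) (I, f)" using subcurve_is_curve(2)[OF c st(2,1)] by simp
    ultimately show "\<exists>\<gamma>'\<in>\<Gamma>\<^sub>0. subcurve \<gamma>' (I, f) \<or> \<gamma>' = (I, f)" by blast
  qed
qed

lemma frontier_disjoint_ball:
  assumes "i \<notin> hit Q (ball z r)" "x \<in> frontier (Q i)"
  shows "x \<notin> ball z r"
proof
  assume "x \<in> ball z r"
  moreover have "Q i \<inter> ball z r = {}" using assms(1) by (simp add: hit_def)
  then have "closure (Q i) \<inter> ball z r = {}" by (simp add: open_Int_closure_eq_empty Int_commute)
  ultimately show False using assms(2) frontier_subset_closure by blast
qed

lemma sobolev_loc_disk_bounds:
  assumes "g \<in> sobolev_loc v UNIV Q"
  shows "\<exists>M m. \<forall>i. max_disk (Q i) g = ereal (M i) \<and> min_disk (Q i) g = ereal (m i) \<and> m i \<le> M i \<and>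
    osc (Q i) g = ennreal (M i - m i) \<and> (\<forall>x\<in>frontier (Q i). ereal (m i) \<le> g x \<and> g x \<le> ereal (M i))"
proof -
  define M where "M i = real_of_ereal (max_disk (Q i) g)" for i
  define m where "m i = real_of_ereal (min_disk (Q i) g)" for i
  have M: "max_disk (Q i) g = ereal (M i)" and m: "min_disk (Q i) g = ereal (m i)" for i
    using assms by (auto simp: sobolev_loc_def M_def m_def ereal_real)
  have b: "ereal (m i) \<le> g x \<and> g x \<le> ereal (M i)" if "x \<in> frontier (Q i)" for i x
    unfolding M[symmetric] m[symmetric] max_disk_def min_disk_def
    using that by (auto intro: SUP_upper INF_lower)
  have "m i \<le> M i" for i
  proof -
    obtain x where "x \<in> frontier (Q i)" using frontier_Q_nonempty by blast
    then have "ereal (m i) \<le> ereal (M i)" using b by (meson order_trans)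
    then show ?thesis by simp
  qed
  moreover have "osc (Q i) g = ennreal (M i - m i)" for i
    by (simp add: osc_def M m e2ennreal_ereal)
  ultimately show ?thesis using M m b by (intro exI[of _ M] exI[of _ m]) simp
qed

lemma sobolev_loc_osc_finite:
  assumes "g \<in> sobolev_loc v UNIV Q" "0 < r"
  shows "(\<Sum>\<^sub>\<infinity>i\<in>hit Q (ball x r). (osc (Q i) g)\<^sup>2) < \<infinity>"
proof -
  have "compactly_contained (ball x r) UNIV" by (simp add: compactly_contained_def assms(2))
  then show ?thesis using assms by (auto simp: sobolev_loc_def sobolev_sums_finite_def)
qed

text \<open>Supplies the test functions: boundedness, support in a ball and Lipschitz dependence on
  \<open>u\<close> and on position suffice. Along generic curves they yield the crude bound
  \<open>\<rho>\<close>, which \<open>diff_le_osc_sum\<close> sharpens to the oscillations of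
  \<open>\<zeta>\<close>.\<close>

lemma sobolevI:
  fixes u \<zeta> :: "complex \<Rightarrow> real"
  assumes u: "(\<lambda>x. ereal (u x)) \<in> sobolev_loc v UNIV Q" and L: "0 \<le> L" and R: "0 < R"
    and lip: "\<And>x y. x \<in> S \<Longrightarrow> y \<in> S \<Longrightarrow> \<bar>\<zeta> x - \<zeta> y\<bar> \<le> L * (\<bar>u x - u y\<bar> + dist x y)"
    and bound: "\<And>x. x \<in> S \<Longrightarrow> \<bar>\<zeta> x\<bar> \<le> L"
    and supp: "\<And>x. x \<in> S \<Longrightarrow> x \<notin> ball z R \<Longrightarrow> \<zeta> x = 0"
  shows "(\<lambda>x. ereal (\<zeta> x)) \<in> sobolev v UNIV Q"
proof -
  define g where "g = (\<lambda>x. ereal (\<zeta> x))"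
  define o\<^sub>u where "o\<^sub>u i = osc (Q i) (\<lambda>x. ereal (u x))" for i
  define diam where "diam i = ennreal (diameter (Q i))" for i
  have fr: "frontier (Q i) \<subseteq> S" for i by (rule frontier_subset_S)
  have disk: "\<bar>x\<bar> \<le> ereal L" if "x = max_disk (Q i) g \<or> x = min_disk (Q i) g" for x i
  proof -
    have "- ereal L \<le> ereal (\<zeta> w) \<and> ereal (\<zeta> w) \<le> ereal L" if "w \<in> frontier (Q i)" for w
      using bound[of w] fr[of i] that by (auto simp: abs_le_iff)
    then have "max_disk (Q i) g \<le> ereal L" "- ereal L \<le> min_disk (Q i) g"
      unfolding max_disk_def min_disk_def g_def by (auto intro!: SUP_least INF_greatest)
    moreover have "min_disk (Q i) g \<le> max_disk (Q i) g"
      unfolding max_disk_def min_disk_def using frontier_Q_nonempty by (intro INF_le_SUP)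
    ultimately have "- ereal L \<le> x" "x \<le> ereal L" using that by (auto intro: order_trans)
    then show ?thesis by (cases x) auto
  qed
  have finite_disk: "\<bar>max_disk (Q i) g\<bar> \<noteq> \<infinity> \<and> \<bar>min_disk (Q i) g\<bar> \<noteq> \<infinity>" for i
    using disk[of "max_disk (Q i) g" i] disk[of "min_disk (Q i) g" i] by auto
  define I where "I = hit Q (ball z R)"
  have zero: "g x = 0" if "i \<notin> I" "x \<in> frontier (Q i)" for i x
    using frontier_disjoint_ball[of i z R x] that fr[of i] supp[of x] by (auto simp: I_def g_def zero_ereal_def)
  have outside: "max_disk (Q i) g = 0 \<and> min_disk (Q i) g = 0" if "i \<notin> I" for i
    using zero[OF that] frontier_Q_nonempty[of i] by (simp add: max_disk_def min_disk_def)
  have osc_le': "osc (Q i) g \<le> ennreal L * (o\<^sub>u i + diam i)" for i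
  proof -
    obtain M m where Mm: "\<forall>i. max_disk (Q i) (\<lambda>x. ereal (u x)) = ereal (M i) \<and>
        min_disk (Q i) (\<lambda>x. ereal (u x)) = ereal (m i) \<and> m i \<le> M i \<and>
        osc (Q i) (\<lambda>x. ereal (u x)) = ennreal (M i - m i) \<and>
        (\<forall>x\<in>frontier (Q i). ereal (m i) \<le> ereal (u x) \<and> ereal (u x) \<le> ereal (M i))"
      using sobolev_loc_disk_bounds[OF u] by (elim exE)
    have M: "\<And>i. m i \<le> M i" "\<And>i. osc (Q i) (\<lambda>x. ereal (u x)) = ennreal (M i - m i)"
        "\<And>i x. x \<in> frontier (Q i) \<Longrightarrow> m i \<le> u x \<and> u x \<le> M i"
      using Mm by simp_all
    define c where "c = L * ((M i - m i) + diameter (Q i))"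
    have c: "\<zeta> x - \<zeta> y \<le> c" if "x \<in> frontier (Q i)" "y \<in> frontier (Q i)" for x y
    proof -
      have "\<bar>u x - u y\<bar> \<le> M i - m i" using M(3)[OF that(1)] M(3)[OF that(2)] by auto
      moreover have "dist x y \<le> diameter (Q i)"
        using that frontier_subset_closure by (intro dist_le_diameter_closure) auto
      ultimately have "L * (\<bar>u x - u y\<bar> + dist x y) \<le> c"
        unfolding c_def using L by (intro mult_left_mono) auto
      then show ?thesis using lip[of x y] that fr by fastforce
    qed
    \<comment> \<open>Measuring from the infimum turns the bound on differences into one on the
      oscillation, which is a supremum minus an infimum.\<close>
    define b where "b = Inf (\<zeta> ` frontier (Q i))"
    have ne: "\<zeta> ` frontier (Q i) \<noteq> {}" using frontier_Q_nonempty by simp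
    have bdd: "bdd_below (\<zeta> ` frontier (Q i))"
      using bound fr by (intro bdd_belowI2[of _ "-L"]) (fastforce simp: abs_le_iff)
    have "b \<le> \<zeta> x" if "x \<in> frontier (Q i)" for x
      unfolding b_def using bdd that by (intro cInf_lower) auto
    moreover have "\<zeta> x \<le> b + c" if "x \<in> frontier (Q i)" for x
    proof -
      have "\<zeta> x - c \<le> b" unfolding b_def using ne c[OF that] by (intro cInf_greatest) (auto simp: algebra_simps)
      then show ?thesis by simp
    qed
    ultimately have "osc (Q i) g \<le> ennreal (b + c - b)" unfolding g_def by (intro osc_le)
    also have "\<dots> = ennreal L * (o\<^sub>u i + diam i)"
      using M(1)[of i] L diameter_Q_pos[of i]
      by (simp add: c_def M(2) o\<^sub>u_def diam_def ennreal_mult flip: ennreal_plus)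
    finally show ?thesis .
  qed
  have I_finite: "(\<Sum>\<^sub>\<infinity>i\<in>hit Q (ball w r). (ennreal L * (o\<^sub>u i + diam i))\<^sup>2) < \<infinity>" if "0 < r" for w r
    unfolding o\<^sub>u_def diam_def
    by (intro infsum_square_cmult_finite infsum_square_add_finite sobolev_loc_osc_finite[OF u that]
        diameter_square_sum_finite that)
  have sums: "sobolev_sums_finite Q g UNIV"
    unfolding sobolev_sums_finite_def
  proof (intro conjI)
    have "(\<Sum>\<^sub>\<infinity>i\<in>UNIV. e2ennreal ((max_disk (Q i) g)\<^sup>2) * ennreal ((diameter (Q i))\<^sup>2))
        = (\<Sum>\<^sub>\<infinity>i\<in>I. e2ennreal ((max_disk (Q i) g)\<^sup>2) * ennreal ((diameter (Q i))\<^sup>2))"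
      using outside by (intro infsum_zero_outside_ennreal) (auto simp: power2_eq_square e2ennreal_neg)
    also have "\<dots> \<le> (\<Sum>\<^sub>\<infinity>i\<in>I. ennreal (L\<^sup>2) * (diam i)\<^sup>2)"
    proof (rule infsum_mono_ennreal)
      fix i
      obtain M where M: "max_disk (Q i) g = ereal M" using finite_disk[of i] by (cases "max_disk (Q i) g") auto
      then have "\<bar>M\<bar> \<le> L" using disk[of "max_disk (Q i) g" i] by simp
      then have "M\<^sup>2 \<le> L\<^sup>2" by (metis abs_le_square_iff abs_of_nonneg L)
      then have "e2ennreal ((max_disk (Q i) g)\<^sup>2) \<le> ennreal (L\<^sup>2)"
        by (simp add: M e2ennreal_ereal ennreal_leI)
      then show "e2ennreal ((max_disk (Q i) g)\<^sup>2) * ennreal ((diameter (Q i))\<^sup>2) \<le> ennreal (L\<^sup>2) * (diam i)\<^sup>2"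
        using diameter_Q_pos[of i] by (simp add: diam_def ennreal_power mult_right_mono)
    qed simp
    also have "\<dots> < \<infinity>"
      using diameter_square_sum_finite[OF R, of z]
      by (simp add: infsum_cmult_ennreal ennreal_mult_less_top I_def diam_def)
    finally show "(\<Sum>\<^sub>\<infinity>i\<in>UNIV. e2ennreal ((max_disk (Q i) g)\<^sup>2) * ennreal ((diameter (Q i))\<^sup>2)) < \<infinity>" .
    have "(\<Sum>\<^sub>\<infinity>i\<in>UNIV. (osc (Q i) g)\<^sup>2) = (\<Sum>\<^sub>\<infinity>i\<in>I. (osc (Q i) g)\<^sup>2)"
      using outside by (intro infsum_zero_outside_ennreal) (auto simp: osc_def e2ennreal_neg)
    also have "\<dots> \<le> (\<Sum>\<^sub>\<infinity>i\<in>I. (ennreal L * (o\<^sub>u i + diam i))\<^sup>2)"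
      by (intro infsum_mono_ennreal power_mono osc_le') auto
    also have "\<dots> < \<infinity>" unfolding I_def by (rule I_finite[OF R])
    finally show "(\<Sum>\<^sub>\<infinity>i\<in>UNIV. (osc (Q i) g)\<^sup>2) < \<infinity>" .
  qed
  \<comment> \<open>The factor 4 is that of \<open>carpet_mod_dist_le_diameter_sum_eq_0\<close>.
    \<open>B\<^sub>1\<close> and \<open>B\<^sub>2\<close> collect the curves with a piece on which
    the estimate for \<open>u\<close> or for distances fails, \<open>B\<^sub>3\<close> those along
    which \<open>\<rho>\<close> has infinite sum, so that no tail would be small.\<close>
  define \<rho> where "\<rho> i = ennreal L * (o\<^sub>u i + 4 * diam i)" for i
  define B\<^sub>1 where "B\<^sub>1 = {\<gamma>. is_curve \<gamma> \<and> (\<exists>s t. s \<le> t \<and> {s..t} \<subseteq> fst \<gamma> \<and>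
    snd \<gamma> s \<in> S \<and> snd \<gamma> t \<in> S \<and> \<not> (\<bar>ereal (u (snd \<gamma> s))\<bar> \<noteq> \<infinity> \<and> \<bar>ereal (u (snd \<gamma> t))\<bar> \<noteq> \<infinity> \<and>
      \<bar>ereal (u (snd \<gamma> s)) - ereal (u (snd \<gamma> t))\<bar> \<le> enn2ereal (\<Sum>\<^sub>\<infinity>i\<in>hit Q (snd \<gamma> ` {s..t}). o\<^sub>u i)))}"
  define B\<^sub>2 where "B\<^sub>2 = {\<gamma>. is_curve \<gamma> \<and> (\<exists>a b. a \<le> b \<and> {a..b} \<subseteq> fst \<gamma> \<and>
     \<not> ennreal (dist (snd \<gamma> a) (snd \<gamma> b)) \<le> 4 * (\<Sum>\<^sub>\<infinity>i\<in>hit Q (snd \<gamma> ` {a..b}). diam i))}"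
  define B\<^sub>3 where "B\<^sub>3 = {\<gamma>. is_curve \<gamma> \<and> (\<Sum>\<^sub>\<infinity>i\<in>hit Q (trace \<gamma>). \<rho> i) = \<infinity>}"
  have "carpet_mod v UNIV Q B\<^sub>1 = 0"
    unfolding B\<^sub>1_def o\<^sub>u_def
    by (rule carpet_mod_upper_gradient_fails_eq_0) (use u in \<open>simp add: sobolev_loc_def\<close>)
  moreover have "carpet_mod v UNIV Q B\<^sub>2 = 0"
    unfolding B\<^sub>2_def diam_def by (rule carpet_mod_dist_le_diameter_sum_eq_0)
  moreover have "carpet_mod v UNIV Q B\<^sub>3 = 0"
    unfolding B\<^sub>3_def
  proof (rule carpet_mod_locally_infinite_sum_eq_0)
    fix r :: real assume r: "0 < r"
    have "(\<Sum>\<^sub>\<infinity>i\<in>hit Q (ball 0 r). (ennreal 4 * diam i)\<^sup>2) < \<infinity>"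
      unfolding diam_def by (intro infsum_square_cmult_finite diameter_square_sum_finite r)
    then show "(\<Sum>\<^sub>\<infinity>i\<in>hit Q (ball 0 r). (\<rho> i)\<^sup>2) < \<infinity>"
      unfolding \<rho>_def o\<^sub>u_def
      by (intro infsum_square_cmult_finite infsum_square_add_finite sobolev_loc_osc_finite[OF u r]) simp
  qed
  ultimately have null: "carpet_mod v UNIV Q (B\<^sub>1 \<union> B\<^sub>2 \<union> B\<^sub>3) = 0"
    by (intro carpet_mod_Un_eq_0)
  have good: "ennreal \<bar>\<zeta> (snd \<gamma> a) - \<zeta> (snd \<gamma> b)\<bar> \<le> (\<Sum>\<^sub>\<infinity>i\<in>hit Q (trace \<gamma>). osc (Q i) g)"
    if \<gamma>: "is_curve \<gamma>" "\<gamma> \<notin> B\<^sub>1 \<union> B\<^sub>2 \<union> B\<^sub>3" and ab: "a \<in> fst \<gamma>" "b \<in> fst \<gamma>" "a \<le> b" "snd \<gamma> a \<in> S" "snd \<gamma> b \<in> S"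
    for \<gamma> a b
  proof -
    have int: "{a..b} \<subseteq> fst \<gamma>"
      using \<gamma>(1) ab unfolding is_curve_def by (meson atLeastAtMost_iff is_interval_1 subsetI)
    have sub: "snd \<gamma> ` {a..b} \<subseteq> trace \<gamma>" using int by (auto simp: trace_def)
    have "ennreal \<bar>\<zeta> (snd \<gamma> a) - \<zeta> (snd \<gamma> b)\<bar> \<le> (\<Sum>\<^sub>\<infinity>i\<in>hit Q (snd \<gamma> ` {a..b}). osc (Q i) (\<lambda>x. ereal (\<zeta> x)))"
    proof (rule diff_le_osc_sum)
      show "continuous_on {a..b} (snd \<gamma>)"
        using curve_continuous_on[OF \<gamma>(1)] int continuous_on_subset by blast
      show "(\<Sum>\<^sub>\<infinity>i\<in>hit Q (snd \<gamma> ` {a..b}). \<rho> i) < \<infinity>"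
      proof -
        have "(\<Sum>\<^sub>\<infinity>i\<in>hit Q (snd \<gamma> ` {a..b}). \<rho> i) \<le> (\<Sum>\<^sub>\<infinity>i\<in>hit Q (trace \<gamma>). \<rho> i)"
          by (intro infsum_mono_ennreal hit_mono sub) simp
        also have "\<dots> < \<infinity>" using \<gamma> by (auto simp: B\<^sub>3_def less_top)
        finally show ?thesis .
      qed
      fix s t assume st: "a \<le> s" "s \<le> t" "t \<le> b" "snd \<gamma> s \<in> S" "snd \<gamma> t \<in> S"
      let ?H = "hit Q (snd \<gamma> ` {s..t})"
      have st': "{s..t} \<subseteq> fst \<gamma>" using int st by auto
      have u_le: "ennreal \<bar>u (snd \<gamma> s) - u (snd \<gamma> t)\<bar> \<le> (\<Sum>\<^sub>\<infinity>i\<in>?H. o\<^sub>u i)"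
      proof -
        have "\<bar>ereal (u (snd \<gamma> s)) - ereal (u (snd \<gamma> t))\<bar> \<le> enn2ereal (\<Sum>\<^sub>\<infinity>i\<in>?H. o\<^sub>u i)"
          using \<gamma> st st' unfolding B\<^sub>1_def by blast
        then show ?thesis by (simp only: abs_ereal_diff_le_iff)
      qed
      have d_le: "ennreal (dist (snd \<gamma> s) (snd \<gamma> t)) \<le> 4 * (\<Sum>\<^sub>\<infinity>i\<in>?H. diam i)"
        using \<gamma> st st' unfolding B\<^sub>2_def by blast
      have "ennreal \<bar>\<zeta> (snd \<gamma> s) - \<zeta> (snd \<gamma> t)\<bar>
          \<le> ennreal (L * (\<bar>u (snd \<gamma> s) - u (snd \<gamma> t)\<bar> + dist (snd \<gamma> s) (snd \<gamma> t)))"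
        using lip st by (intro ennreal_leI) auto
      also have "\<dots> = ennreal L * (ennreal \<bar>u (snd \<gamma> s) - u (snd \<gamma> t)\<bar> + ennreal (dist (snd \<gamma> s) (snd \<gamma> t)))"
        using L by (simp add: ennreal_mult)
      also have "\<dots> \<le> ennreal L * ((\<Sum>\<^sub>\<infinity>i\<in>?H. o\<^sub>u i) + 4 * (\<Sum>\<^sub>\<infinity>i\<in>?H. diam i))"
        by (intro mult_left_mono add_mono u_le d_le) simp
      also have "\<dots> = (\<Sum>\<^sub>\<infinity>i\<in>?H. \<rho> i)"
        unfolding \<rho>_def by (simp add: infsum_cmult_ennreal infsum_add_ennreal)
      finally show "ennreal \<bar>\<zeta> (snd \<gamma> s) - \<zeta> (snd \<gamma> t)\<bar> \<le> (\<Sum>\<^sub>\<infinity>i\<in>?H. \<rho> i)" .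
    qed (use ab in auto)
    also have "\<dots> \<le> (\<Sum>\<^sub>\<infinity>i\<in>hit Q (trace \<gamma>). osc (Q i) g)"
      unfolding g_def by (intro infsum_mono_ennreal hit_mono sub) simp
    finally show ?thesis .
  qed
  have ug: "upper_gradient v UNIV Q g (\<lambda>i. osc (Q i) g)"
    unfolding upper_gradient_def
  proof (intro exI conjI ballI)
    show "(B\<^sub>1 \<union> B\<^sub>2 \<union> B\<^sub>3) \<subseteq> curves_in UNIV"
      by (auto simp: B\<^sub>1_def B\<^sub>2_def B\<^sub>3_def curves_in_def)
    show "carpet_mod v UNIV Q (B\<^sub>1 \<union> B\<^sub>2 \<union> B\<^sub>3) = 0" by (rule null)
    fix \<gamma> x y assume \<gamma>: "\<gamma> \<in> curves_in UNIV - (B\<^sub>1 \<union> B\<^sub>2 \<union> B\<^sub>3)" and xy: "x \<in> trace \<gamma> \<inter> S" "y \<in> trace \<gamma> \<inter> S"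
    obtain a b where ab: "a \<in> fst \<gamma>" "b \<in> fst \<gamma>" "x = snd \<gamma> a" "y = snd \<gamma> b" using xy by (auto simp: trace_def)
    have "ennreal \<bar>\<zeta> x - \<zeta> y\<bar> \<le> (\<Sum>\<^sub>\<infinity>i\<in>hit Q (trace \<gamma>). osc (Q i) g)"
    proof (cases "a \<le> b")
      case True
      then show ?thesis using good[of \<gamma> a b] \<gamma> ab xy by (simp add: curves_in_def)
    next
      case False
      then show ?thesis using good[of \<gamma> b a] \<gamma> ab xy by (simp add: curves_in_def abs_minus_commute)
    qed
    then show "\<bar>g x - g y\<bar> \<le> enn2ereal (\<Sum>\<^sub>\<infinity>i\<in>hit Q (trace \<gamma>). osc (Q i) g)"
      unfolding g_def by (simp only: abs_ereal_diff_le_iff)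
  qed (simp_all add: g_def)
  show ?thesis
    using finite_disk ug sums sobolev_sums_finite_subset[OF sums]
    unfolding g_def[symmetric] by (simp add: sobolev_def sobolev_loc_def)
qed

end

section \<open>First variation of the energy\<close>

lemma quotient_Lipschitz:
  fixes X :: real
  assumes "1 \<le> X" "1 \<le> Y" "0 \<le> p" "p \<le> 1" "0 \<le> q" "q \<le> 1"
  shows "\<bar>p\<^sup>2 / X - q\<^sup>2 / Y\<bar> \<le> 2 * \<bar>p - q\<bar> + \<bar>X - Y\<bar>"
proof -
  have "\<bar>p\<^sup>2 / X - q\<^sup>2 / X\<bar> = \<bar>p - q\<bar> * (p + q) / X"
    using assms by (simp add: power2_eq_square abs_mult square_diff_square_factored flip: diff_divide_distrib)
  also have "\<dots> \<le> \<bar>p - q\<bar> * 2 / 1" using assms by (intro frac_le mult_left_mono) auto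
  finally have 1: "\<bar>p\<^sup>2 / X - q\<^sup>2 / X\<bar> \<le> 2 * \<bar>p - q\<bar>" by simp
  have "q\<^sup>2 / X - q\<^sup>2 / Y = q\<^sup>2 * (Y - X) / (X * Y)" using assms by (simp add: field_simps)
  then have "\<bar>q\<^sup>2 / X - q\<^sup>2 / Y\<bar> = q\<^sup>2 * \<bar>X - Y\<bar> / (X * Y)"
    using assms by (simp add: abs_mult abs_minus_commute)
  also have "\<dots> \<le> 1 * \<bar>X - Y\<bar> / 1"
  proof (intro frac_le mult_right_mono)
    show "1 \<le> X * Y" using mult_mono[of 1 X 1 Y] assms by simp
  qed (use assms in \<open>auto simp: power_le_one\<close>)
  finally have "\<bar>q\<^sup>2 / X - q\<^sup>2 / Y\<bar> \<le> \<bar>X - Y\<bar>" by simp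
  then show ?thesis using 1 by linarith
qed

context plane_carpet
begin

text \<open>The sign \<open>\<sigma>\<close> treats functions bounded below and above alike. The
  summed inequality is read off at the single disk \<open>j\<close>, on whose boundary the cutoff is
  1 and the product of the extremes is at most \<open>B\<^sup>2\<close>.\<close>

lemma caccioppoli:
  fixes u \<eta> :: "complex \<Rightarrow> real" and d :: "nat \<Rightarrow> real"
  assumes harm: "carpet_harmonic v UNIV Q (\<lambda>x. ereal (u x))"
    and \<sigma>: "\<sigma> = 1 \<or> \<sigma> = -1" and U: "\<And>x. x \<in> S \<Longrightarrow> 1 \<le> \<sigma> * u x + c"
    and \<eta>: "\<And>x. 0 \<le> \<eta> x" "\<And>x. \<eta> x \<le> 1" "\<And>x y. \<bar>\<eta> x - \<eta> y\<bar> \<le> L * dist x y" "0 \<le> L"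
    and R: "0 < R" "\<And>x. x \<notin> ball 0 R \<Longrightarrow> \<eta> x = 0"
    and d: "\<And>i x y. x \<in> frontier (Q i) \<Longrightarrow> y \<in> frontier (Q i) \<Longrightarrow> \<bar>\<eta> x - \<eta> y\<bar> \<le> d i" "\<And>i. 0 \<le> d i"
    and D: "0 \<le> D" "(\<Sum>\<^sub>\<infinity>i\<in>UNIV. ennreal ((d i)\<^sup>2)) \<le> ennreal D"
    and j: "\<And>x. x \<in> frontier (Q j) \<Longrightarrow> \<eta> x = 1" "\<And>x. x \<in> frontier (Q j) \<Longrightarrow> \<sigma> * u x + c \<le> B"
      "osc (Q j) (\<lambda>x. ereal (u x)) = ennreal a\<^sub>j" "0 \<le> a\<^sub>j"
  shows "a\<^sub>j\<^sup>2 \<le> 6 * D * B\<^sup>2"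
proof -
  have u: "(\<lambda>x. ereal (u x)) \<in> sobolev_loc v UNIV Q" using harm by (simp add: carpet_harmonic_def)
  obtain M m where Mm: "\<forall>i. max_disk (Q i) (\<lambda>x. ereal (u x)) = ereal (M i) \<and>
        min_disk (Q i) (\<lambda>x. ereal (u x)) = ereal (m i) \<and> m i \<le> M i \<and>
        osc (Q i) (\<lambda>x. ereal (u x)) = ennreal (M i - m i) \<and>
        (\<forall>x\<in>frontier (Q i). ereal (m i) \<le> ereal (u x) \<and> ereal (u x) \<le> ereal (M i))"
    using sobolev_loc_disk_bounds[OF u] by (elim exE)
  \<comment> \<open>\<open>MU\<close> and \<open>mU\<close> are the extremes of
    \<open>\<sigma> * u x + c\<close> on the boundary; for \<open>\<sigma> = -1\<close> maximum and
    minimum of \<open>u\<close> trade places.\<close>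
  define MU where "MU i = (if \<sigma> = 1 then M i + c else c - m i)" for i
  define mU where "mU i = (if \<sigma> = 1 then m i + c else c - M i)" for i
  define a where "a i = M i - m i" for i
  have a: "a i = MU i - mU i" "0 \<le> a i" "osc (Q i) (\<lambda>x. ereal (u x)) = ennreal (a i)" "mU i \<le> MU i" for i
    using Mm by (auto simp: a_def MU_def mU_def)
  have Ub: "mU i \<le> \<sigma> * u x + c \<and> \<sigma> * u x + c \<le> MU i" if "x \<in> frontier (Q i)" for i x
    using Mm that \<sigma> by (auto simp: MU_def mU_def)
  have mU: "1 \<le> mU i" for i
  proof (cases "\<sigma> = 1")
    case True
    have "ereal (1 - c) \<le> min_disk (Q i) (\<lambda>x. ereal (u x))"
      unfolding min_disk_def using U frontier_subset_S[of i] True by (fastforce intro!: INF_greatest)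
    then show ?thesis using Mm True by (simp add: mU_def)
  next
    case False
    then have "\<sigma> = -1" using \<sigma> by simp
    then have "max_disk (Q i) (\<lambda>x. ereal (u x)) \<le> ereal (c - 1)"
      unfolding max_disk_def using U frontier_subset_S[of i] by (fastforce intro!: SUP_least)
    then show ?thesis using Mm False by (simp add: mU_def)
  qed
  have MUj: "MU j \<le> B"
  proof (cases "\<sigma> = 1")
    case True
    have "max_disk (Q j) (\<lambda>x. ereal (u x)) \<le> ereal (B - c)"
      unfolding max_disk_def using j(2) True by (fastforce intro!: SUP_least)
    then show ?thesis using Mm True by (simp add: MU_def)
  next
    case False
    then have "\<sigma> = -1" using \<sigma> by simp
    then have "ereal (c - B) \<le> min_disk (Q j) (\<lambda>x. ereal (u x))"
      unfolding min_disk_def using j(2) by (fastforce intro!: INF_greatest)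
    then show ?thesis using Mm False by (simp add: MU_def)
  qed
  have cont: "continuous_on A \<eta>" for A
  proof -
    have "L-lipschitz_on A \<eta>" using \<eta>(3,4) by (intro lipschitz_onI) (auto simp: dist_real_def)
    then show ?thesis by (rule lipschitz_on_continuous_on)
  qed
  have "\<forall>i. \<exists>x. x \<in> frontier (Q i) \<and> (\<forall>z\<in>frontier (Q i). \<eta> z \<le> \<eta> x)"
    using continuous_attains_sup[OF compact_frontier_Q frontier_Q_nonempty cont] by blast
  then obtain xE where xE: "\<And>i. xE i \<in> frontier (Q i)" "\<And>i z. z \<in> frontier (Q i) \<Longrightarrow> \<eta> z \<le> \<eta> (xE i)"
    by metis
  have "\<forall>i. \<exists>x. x \<in> frontier (Q i) \<and> (\<forall>z\<in>frontier (Q i). \<eta> x \<le> \<eta> z)"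
    using continuous_attains_inf[OF compact_frontier_Q frontier_Q_nonempty cont] by blast
  then obtain xe where xe: "\<And>i. xe i \<in> frontier (Q i)" "\<And>i z. z \<in> frontier (Q i) \<Longrightarrow> \<eta> (xe i) \<le> \<eta> z"
    by metis
  define E where "E i = \<eta> (xE i)" for i
  define e where "e i = \<eta> (xe i)" for i
  have Ee: "0 \<le> e i" "e i \<le> E i" "E i \<le> 1" "E i - e i \<le> d i" for i
    using \<eta> xE xe d(1)[of "xE i" i "xe i"] by (auto simp: E_def e_def)
  \<comment> \<open>\<open>a i + t * b i\<close> will bound the oscillation of the competitor on
    disk \<open>i\<close>, so \<open>b i\<close> bounds its rate of change.\<close>
  define b where "b i = (E i)\<^sup>2 / MU i - (e i)\<^sup>2 / mU i" for i
  define I where "I = hit Q (ball 0 R)"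
  have b_le: "\<bar>b i\<bar> \<le> 2 * d i + a i" for i
    using quotient_Lipschitz[of "MU i" "mU i" "E i" "e i"] mU[of i] a[of i] Ee[of i]
    by (simp add: b_def)
  have a_sum: "(\<Sum>\<^sub>\<infinity>i\<in>I. ennreal ((a i)\<^sup>2)) < \<infinity>"
    using sobolev_loc_osc_finite[OF u R(1), of 0] a(2,3) by (simp add: I_def ennreal_power)
  have d_sum: "(\<Sum>\<^sub>\<infinity>i\<in>I. ennreal ((d i)\<^sup>2)) \<le> ennreal D"
    by (rule order_trans[OF infsum_mono_ennreal D(2)]) auto
  have b_sum: "(\<Sum>\<^sub>\<infinity>i\<in>I. ennreal ((b i)\<^sup>2)) < \<infinity>"
  proof -
    have "(\<Sum>\<^sub>\<infinity>i\<in>I. (ennreal 2 * ennreal (d i) + ennreal (a i))\<^sup>2) < \<infinity>"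
    proof (intro infsum_square_add_finite infsum_square_cmult_finite)
      show "(\<Sum>\<^sub>\<infinity>i\<in>I. (ennreal (d i))\<^sup>2) < \<infinity>"
        using d_sum d(2) by (simp add: ennreal_power order_le_less_trans)
      show "(\<Sum>\<^sub>\<infinity>i\<in>I. (ennreal (a i))\<^sup>2) < \<infinity>"
        using a_sum a(2) by (simp add: ennreal_power)
    qed
    moreover have "(\<Sum>\<^sub>\<infinity>i\<in>I. ennreal ((b i)\<^sup>2)) \<le> (\<Sum>\<^sub>\<infinity>i\<in>I. (ennreal 2 * ennreal (d i) + ennreal (a i))\<^sup>2)"
    proof (rule infsum_mono_ennreal)
      fix i
      have "(b i)\<^sup>2 \<le> (2 * d i + a i)\<^sup>2" using b_le[of i] by (metis abs_ge_zero power2_abs power_mono)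
      then have "ennreal ((b i)\<^sup>2) \<le> ennreal ((2 * d i + a i)\<^sup>2)" by (rule ennreal_leI)
      also have "\<dots> = (ennreal 2 * ennreal (d i) + ennreal (a i))\<^sup>2"
      proof -
        have "ennreal 2 * ennreal (d i) + ennreal (a i) = ennreal (2 * d i + a i)"
          using d(2)[of i] a(2)[of i] by (simp add: ennreal_mult)
        then show ?thesis using d(2)[of i] a(2)[of i] by (simp only: ennreal_power)
      qed
      finally show "ennreal ((b i)\<^sup>2) \<le> (ennreal 2 * ennreal (d i) + ennreal (a i))\<^sup>2" .
    qed simp
    ultimately show ?thesis by (rule order_le_less_trans[rotated])
  qed
  have sa: "(\<lambda>i. (a i)\<^sup>2) summable_on I" and sb: "(\<lambda>i. (b i)\<^sup>2) summable_on I"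
    by (rule summable_on_of_infsum_ennreal; use a_sum b_sum in simp)+
  have sd: "(\<lambda>i. (d i)\<^sup>2) summable_on I" "infsum (\<lambda>i. (d i)\<^sup>2) I \<le> D"
  proof -
    have fin: "(\<Sum>\<^sub>\<infinity>i\<in>I. ennreal ((d i)\<^sup>2)) < \<infinity>" using d_sum by (simp add: order_le_less_trans)
    show "(\<lambda>i. (d i)\<^sup>2) summable_on I" by (rule summable_on_of_infsum_ennreal(1)[OF fin]) simp
    have "ennreal (infsum (\<lambda>i. (d i)\<^sup>2) I) \<le> ennreal D"
      using summable_on_of_infsum_ennreal(2)[OF fin] d_sum by simp
    then show "infsum (\<lambda>i. (d i)\<^sup>2) I \<le> D" using D(1) by (simp add: ennreal_le_iff)
  qed
  \<comment> \<open>Summability of the products \<open>a i * b i\<close> follows by polarization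
    from that of the squares.\<close>
  have "(\<lambda>i. (a i + b i)\<^sup>2) summable_on I"
  proof (rule summable_on_comparison_test)
    show "(\<lambda>i. 2 * ((a i)\<^sup>2 + (b i)\<^sup>2)) summable_on I"
      by (intro summable_on_cmult_right summable_on_add sa sb)
    show "(a i + b i)\<^sup>2 \<le> 2 * ((a i)\<^sup>2 + (b i)\<^sup>2)" for i
      using zero_le_power2[of "a i - b i"] by (simp add: power2_eq_square algebra_simps)
  qed simp
  then have "(\<lambda>i. 1 / 2 * ((a i + b i)\<^sup>2 + (- 1) * (a i)\<^sup>2 + (- 1) * (b i)\<^sup>2)) summable_on I"
    by (intro summable_on_cmult_right summable_on_add sa sb)
  then have sab: "(\<lambda>i. a i * b i) summable_on I"
    by (rule summable_on_cong[THEN iffD1, rotated]) (simp add: power2_eq_square algebra_simps)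
  define P where "P = infsum (\<lambda>i. a i * b i) I"
  define B\<^sub>2 where "B\<^sub>2 = infsum (\<lambda>i. (b i)\<^sup>2) I"
  \<comment> \<open>Minimality bounds the sum of the squares of \<open>a i\<close> by that of
    \<open>a i + t * b i\<close>; expanding and dividing by \<open>t\<close> leaves this
    inequality.\<close>
  have variation: "0 \<le> 2 * P + t * B\<^sub>2" if t: "0 < t" "t \<le> 1" for t
  proof -
    \<comment> \<open>With \<open>U = \<sigma> * u x + c\<close>, the outer factor
      \<open>\<sigma>\<close> turns \<open>\<sigma> * (u x + \<zeta> x) + c\<close> into
      \<open>U + t * \<eta>\<^sup>2 / U\<close> for either sign.\<close>
    define \<zeta> where "\<zeta> x = \<sigma> * (t * ((\<eta> x)\<^sup>2 / (\<sigma> * u x + c)))" for x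
    have "(\<lambda>x. ereal (\<zeta> x)) \<in> sobolev v UNIV Q"
    proof (rule sobolevI[OF u _ R(1), of "2 * L + 1"])
      show "0 \<le> 2 * L + 1" using \<eta>(4) by simp
      show "\<zeta> x = 0" if "x \<notin> ball 0 R" for x using R(2)[OF that] by (simp add: \<zeta>_def)
      show "\<bar>\<zeta> x\<bar> \<le> 2 * L + 1" if "x \<in> S" for x
      proof -
        have "\<bar>\<zeta> x\<bar> = t * ((\<eta> x)\<^sup>2 / (\<sigma> * u x + c))"
          using \<sigma> t U[OF that] by (auto simp: \<zeta>_def abs_mult)
        also have "\<dots> \<le> 1 * (1 / 1)"
          using t U[OF that] \<eta>(1,2)[of x] by (intro mult_mono frac_le) (auto simp: power_le_one)
        finally show ?thesis using \<eta>(4) by simp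
      qed
      show "\<bar>\<zeta> x - \<zeta> y\<bar> \<le> (2 * L + 1) * (\<bar>u x - u y\<bar> + dist x y)" if xy: "x \<in> S" "y \<in> S" for x y
      proof -
        have "\<zeta> x - \<zeta> y = \<sigma> * (t * ((\<eta> x)\<^sup>2 / (\<sigma> * u x + c) - (\<eta> y)\<^sup>2 / (\<sigma> * u y + c)))"
          by (simp add: \<zeta>_def algebra_simps)
        then have "\<bar>\<zeta> x - \<zeta> y\<bar> = t * \<bar>(\<eta> x)\<^sup>2 / (\<sigma> * u x + c) - (\<eta> y)\<^sup>2 / (\<sigma> * u y + c)\<bar>"
          using \<sigma> t by (auto simp: abs_mult)
        also have "\<dots> \<le> 1 * \<bar>(\<eta> x)\<^sup>2 / (\<sigma> * u x + c) - (\<eta> y)\<^sup>2 / (\<sigma> * u y + c)\<bar>"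
          using t by (intro mult_right_mono) auto
        also have "\<dots> \<le> 2 * \<bar>\<eta> x - \<eta> y\<bar> + \<bar>(\<sigma> * u x + c) - (\<sigma> * u y + c)\<bar>"
          using quotient_Lipschitz[OF U[OF xy(1)] U[OF xy(2)]] \<eta>(1,2) by simp
        also have "\<bar>(\<sigma> * u x + c) - (\<sigma> * u y + c)\<bar> = \<bar>u x - u y\<bar>" using \<sigma> by auto
        also have "2 * \<bar>\<eta> x - \<eta> y\<bar> + \<bar>u x - u y\<bar> \<le> 2 * (L * dist x y) + \<bar>u x - u y\<bar>"
          using \<eta>(3)[of x y] by simp
        also have "\<dots> \<le> (2 * L + 1) * (\<bar>u x - u y\<bar> + dist x y)"
          using \<eta>(4) mult_nonneg_nonneg[OF \<eta>(4) abs_ge_zero[of "u x - u y"]] by (simp add: algebra_simps)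
        finally show ?thesis .
      qed
    qed
    moreover have "\<forall>x\<in>S - ball 0 R. ereal (\<zeta> x) = 0" using R(2) by (simp add: \<zeta>_def zero_ereal_def)
    moreover have "compactly_contained (ball 0 R) UNIV" using R(1) by (simp add: compactly_contained_def)
    ultimately have "dirichlet_energy Q (ball 0 R) (\<lambda>x. ereal (u x))
        \<le> dirichlet_energy Q (ball 0 R) (\<lambda>x. ereal (u x) + ereal (\<zeta> x))"
      using harm unfolding carpet_harmonic_def by (meson open_ball)
    then have "(\<Sum>\<^sub>\<infinity>i\<in>I. ennreal ((a i)\<^sup>2)) \<le> (\<Sum>\<^sub>\<infinity>i\<in>I. (osc (Q i) (\<lambda>x. ereal (u x + \<zeta> x)))\<^sup>2)"
      using a(2,3) by (simp add: dirichlet_energy_def I_def ennreal_power)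
    also have "\<dots> \<le> (\<Sum>\<^sub>\<infinity>i\<in>I. ennreal ((a i + t * b i)\<^sup>2))"
    proof (rule infsum_mono_ennreal)
      fix i
      define up where "up = MU i + t * (E i)\<^sup>2 / MU i"
      define lo where "lo = mU i + t * (e i)\<^sup>2 / mU i"
      have "lo \<le> (\<sigma> * u x + c) + t * (\<eta> x)\<^sup>2 / (\<sigma> * u x + c) \<and>
          (\<sigma> * u x + c) + t * (\<eta> x)\<^sup>2 / (\<sigma> * u x + c) \<le> up" if x: "x \<in> frontier (Q i)" for x
      proof -
        have "1 \<le> \<sigma> * u x + c" using U frontier_subset_S x by blast
        moreover have "(e i)\<^sup>2 \<le> (\<eta> x)\<^sup>2" "(\<eta> x)\<^sup>2 \<le> (E i)\<^sup>2"
          using xe(2)[OF x] xE(2)[OF x] \<eta>(1) by (auto simp: e_def E_def intro!: power_mono)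
        moreover have "(e i)\<^sup>2 \<le> 1" "(\<eta> x)\<^sup>2 \<le> 1" using \<eta>(1,2) by (auto simp: e_def power_le_one)
        ultimately show ?thesis
          unfolding lo_def up_def using Ub[OF x] mU[of i] t
          by (intro conjI add_quotient_mono) auto
      qed
      then have w: "lo \<le> \<sigma> * (u x + \<zeta> x) + c \<and> \<sigma> * (u x + \<zeta> x) + c \<le> up" if "x \<in> frontier (Q i)" for x
        using that \<sigma> by (auto simp: \<zeta>_def algebra_simps)
      have "osc (Q i) (\<lambda>x. ereal (u x + \<zeta> x)) \<le> ennreal (up - lo)"
      proof (cases "\<sigma> = 1")
        case True
        have "osc (Q i) (\<lambda>x. ereal (u x + \<zeta> x)) \<le> ennreal ((up - c) - (lo - c))"
          by (rule osc_le) (use w True in \<open>auto simp: algebra_simps\<close>)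
        then show ?thesis by simp
      next
        case False
        then have "\<sigma> = -1" using \<sigma> by simp
        have "osc (Q i) (\<lambda>x. ereal (u x + \<zeta> x)) \<le> ennreal ((c - lo) - (c - up))"
          by (rule osc_le) (use w \<open>\<sigma> = -1\<close> in \<open>force simp: algebra_simps\<close>)+
        then show ?thesis by simp
      qed
      also have "up - lo = a i + t * b i"
        by (simp add: up_def lo_def a(1) b_def algebra_simps)
      finally have "(osc (Q i) (\<lambda>x. ereal (u x + \<zeta> x)))\<^sup>2 \<le> (ennreal (a i + t * b i))\<^sup>2"
        by (intro power_mono) auto
      also have "\<dots> \<le> ennreal ((a i + t * b i)\<^sup>2)"
        by (cases "0 \<le> a i + t * b i") (auto simp: ennreal_power ennreal_neg)
      finally show "(osc (Q i) (\<lambda>x. ereal (u x + \<zeta> x)))\<^sup>2 \<le> ennreal ((a i + t * b i)\<^sup>2)" .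
    qed simp
    finally have le: "(\<Sum>\<^sub>\<infinity>i\<in>I. ennreal ((a i)\<^sup>2)) \<le> (\<Sum>\<^sub>\<infinity>i\<in>I. ennreal ((a i + t * b i)\<^sup>2))" .
    have expand: "(\<lambda>i. (a i + t * b i)\<^sup>2) = (\<lambda>i. (a i)\<^sup>2 + (2 * t) * (a i * b i) + t\<^sup>2 * (b i)\<^sup>2)"
      by (rule ext) (simp add: power2_eq_square algebra_simps)
    have sat: "(\<lambda>i. (a i + t * b i)\<^sup>2) summable_on I"
      unfolding expand by (intro summable_on_cmult_right summable_on_add sa sb sab)
    have "infsum (\<lambda>i. (a i + t * b i)\<^sup>2) I = infsum (\<lambda>i. (a i)\<^sup>2) I + (2 * t) * P + t\<^sup>2 * B\<^sub>2"
      unfolding expand P_def B\<^sub>2_def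
      by (simp add: infsum_add infsum_cmult_right' summable_on_cmult_right summable_on_add sa sb sab)
    moreover have "infsum (\<lambda>i. (a i)\<^sup>2) I \<le> infsum (\<lambda>i. (a i + t * b i)\<^sup>2) I"
    proof -
      have fin: "(\<Sum>\<^sub>\<infinity>i\<in>I. ennreal ((a i + t * b i)\<^sup>2)) < \<infinity>"
      proof -
        have "(\<Sum>\<^sub>\<infinity>i\<in>I. ennreal ((a i + t * b i)\<^sup>2)) \<le> ennreal (infsum (\<lambda>i. (a i + t * b i)\<^sup>2) I)"
          unfolding infsum_le_iff_ennreal
        proof (intro allI impI)
          fix F assume F: "finite F \<and> F \<subseteq> I"
          have "sum (\<lambda>i. (a i + t * b i)\<^sup>2) F \<le> infsum (\<lambda>i. (a i + t * b i)\<^sup>2) I"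
            using F by (intro finite_sum_le_infsum sat) auto
          then show "(\<Sum>i\<in>F. ennreal ((a i + t * b i)\<^sup>2)) \<le> ennreal (infsum (\<lambda>i. (a i + t * b i)\<^sup>2) I)"
            by (subst sum_ennreal) (auto intro: ennreal_leI)
        qed
        then show ?thesis by (simp add: order_le_less_trans)
      qed
      have "ennreal (infsum (\<lambda>i. (a i)\<^sup>2) I) \<le> ennreal (infsum (\<lambda>i. (a i + t * b i)\<^sup>2) I)"
        using le summable_on_of_infsum_ennreal(2)[OF a_sum] summable_on_of_infsum_ennreal(2)[OF fin] by simp
      then show ?thesis by (simp add: ennreal_le_iff infsum_nonneg)
    qed
    ultimately have "0 \<le> t * (2 * P + t * B\<^sub>2)" by (simp add: power2_eq_square algebra_simps)
    then show ?thesis using t(1) by (simp add: zero_le_mult_iff)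
  qed
  \<comment> \<open>A negative \<open>P\<close> would outweigh \<open>t * B\<^sub>2\<close> for
    small \<open>t\<close>; the summand 1 in the denominator guards against
    \<open>B\<^sub>2 = 0\<close>.\<close>
  have "0 \<le> P"
  proof (rule ccontr)
    assume "\<not> 0 \<le> P"
    have B2: "0 \<le> B\<^sub>2" unfolding B\<^sub>2_def by (intro infsum_nonneg) simp
    define t where "t = min 1 (- P / (B\<^sub>2 + 1))"
    have "0 < t" "t \<le> 1" using \<open>\<not> 0 \<le> P\<close> B2 by (auto simp: t_def intro!: divide_neg_pos)
    moreover have "t * B\<^sub>2 \<le> - P"
    proof -
      have "t * B\<^sub>2 \<le> (- P / (B\<^sub>2 + 1)) * (B\<^sub>2 + 1)"
        using \<open>\<not> 0 \<le> P\<close> B2 by (intro mult_mono) (auto simp: t_def intro!: divide_nonpos_nonneg)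
      then show ?thesis using B2 by simp
    qed
    ultimately show False using variation[of t] \<open>\<not> 0 \<le> P\<close> by linarith
  qed
  \<comment> \<open>By \<open>first_variation_bound\<close>, \<open>q i\<close> dominates the
    weighted square of the oscillation on disk \<open>i\<close>; because \<open>P\<close> is
    nonnegative, the \<open>q i\<close> add up to at most \<open>6 * D\<close>.\<close>
  define q where "q i = 6 * (d i)\<^sup>2 + (- 2) * (a i * b i)" for i
  have p_le: "(a i)\<^sup>2 * (e i)\<^sup>2 / (MU i * mU i) \<le> q i" for i
    using first_variation_bound[OF mU[of i] a(4)[of i] Ee(1,2,4)[of i]]
    by (simp add: q_def a(1) b_def)
  have q_nonneg: "0 \<le> q i" for i
    using p_le[of i] mU[of i] a(4)[of i]
    by (rule_tac order_trans[rotated]) (auto intro!: divide_nonneg_nonneg mult_nonneg_nonneg)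
  have sq: "q summable_on I" unfolding q_def by (intro summable_on_cmult_right summable_on_add sd sab)
  have "infsum q I = 6 * infsum (\<lambda>i. (d i)\<^sup>2) I + (- 2) * P"
    unfolding q_def P_def by (subst infsum_add) (simp_all only: infsum_cmult_right' summable_on_cmult_right sd sab)
  then have q_le: "infsum q I \<le> 6 * D" using sd(2) \<open>0 \<le> P\<close> by simp
  have "j \<in> I"
  proof (rule ccontr)
    assume "j \<notin> I"
    obtain x where x: "x \<in> frontier (Q j)" using frontier_Q_nonempty by blast
    then have "x \<notin> ball 0 R" using frontier_disjoint_ball[of j 0 R x] \<open>j \<notin> I\<close> unfolding I_def by blast
    then show False using R(2) j(1)[OF x] by auto
  qed
  then have "q j \<le> infsum q I"
    using finite_sum_le_infsum[OF sq, of "{j}"] q_nonneg by simp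
  moreover have "e j = 1" using j(1) xe(1) by (simp add: e_def)
  ultimately have "(a j)\<^sup>2 / (MU j * mU j) \<le> 6 * D" using p_le[of j] q_le by simp
  then have "(a j)\<^sup>2 \<le> 6 * D * (MU j * mU j)"
    using mU[of j] a(4)[of j] by (simp add: pos_divide_le_eq)
  also have "\<dots> \<le> 6 * D * (B * B)"
    using mU[of j] a(4)[of j] MUj D(1) by (intro mult_left_mono mult_mono) auto
  finally have "(a j)\<^sup>2 \<le> 6 * D * B\<^sup>2" by (simp add: power2_eq_square)
  moreover have "a j = a\<^sub>j" using a(2,3)[of j] j(3,4) by simp
  ultimately show ?thesis by simp
qed

end

text \<open>Orthogonality from disjoint supports. For an average of \<open>N\<close> terms of
  bounded energy it yields energy of order \<open>1 / N\<close> where the triangle inequality would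
  only give order 1.\<close>

lemma square_sum_single:
  fixes f :: "'a \<Rightarrow> real"
  assumes "finite A" "\<And>x y. x \<in> A \<Longrightarrow> y \<in> A \<Longrightarrow> x \<noteq> y \<Longrightarrow> f x = 0 \<or> f y = 0"
  shows "(\<Sum>x\<in>A. f x)\<^sup>2 = (\<Sum>x\<in>A. (f x)\<^sup>2)"
proof -
  have "(\<Sum>x\<in>A. f x)\<^sup>2 = (\<Sum>x\<in>A. \<Sum>y\<in>A. f x * f y)"
    by (simp add: power2_eq_square sum_product)
  also have "\<dots> = (\<Sum>x\<in>A. (f x)\<^sup>2)"
  proof (rule sum.cong[OF refl])
    fix x assume x: "x \<in> A"
    have "(\<Sum>y\<in>A. f x * f y) = (\<Sum>y\<in>{x}. f x * f y)"
      using assms x by (intro sum.mono_neutral_right) auto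
    then show "(\<Sum>y\<in>A. f x * f y) = (f x)\<^sup>2" by (simp add: power2_eq_square)
  qed
  finally show ?thesis .
qed

section \<open>Cutoffs of small energy and vanishing of the oscillations\<close>

context plane_carpet
begin

text \<open>
  The cutoff is the average of \<open>N\<close> cutoffs that live at such different scales that no peripheral
  disk sees two of them. Each has energy bounded by a constant, hence the average has energy \<open>O(1/N)\<close>.
\<close>

lemma exists_cutoff:
  assumes "0 < \<epsilon>"
  shows "\<exists>(\<eta> :: complex \<Rightarrow> real) L R d. (\<forall>x. 0 \<le> \<eta> x \<and> \<eta> x \<le> 1) \<and> (\<forall>x y. \<bar>\<eta> x - \<eta> y\<bar> \<le> L * dist x y) \<and> 0 \<le> L \<and>
    0 < R \<and> (\<forall>x. x \<notin> ball 0 R \<longrightarrow> \<eta> x = 0) \<and>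
    (\<forall>i x y. x \<in> frontier (Q i) \<longrightarrow> y \<in> frontier (Q i) \<longrightarrow> \<bar>\<eta> x - \<eta> y\<bar> \<le> d i) \<and> (\<forall>i. 0 \<le> d i) \<and>
    (\<Sum>\<^sub>\<infinity>i\<in>UNIV. ennreal ((d i)\<^sup>2)) \<le> ennreal \<epsilon> \<and> (\<forall>x\<in>frontier (Q j). \<eta> x = 1)"
proof -
  obtain C where C: "0 < C" "\<And>x s. 0 < s \<Longrightarrow>
    (\<Sum>\<^sub>\<infinity>i\<in>hit Q (ball x s). (ennreal (min (diameter (Q i)) s))\<^sup>2) \<le> ennreal (C * s\<^sup>2)"
    by (rule packing) blast
  \<comment> \<open>The \<open>N\<close> scales will contribute at most
    \<open>4 * C / (real N)\<^sup>2\<close> each, hence the threshold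
    \<open>4 * C / \<epsilon>\<close>.\<close>
  obtain N :: nat where "4 * C / \<epsilon> < real N" using reals_Archimedean2 by blast
  then have "4 * C < real N * \<epsilon>" using assms by (simp add: pos_divide_less_eq)
  moreover have "0 < 4 * C" using C(1) by simp
  ultimately have "0 < real N * \<epsilon>" by linarith
  then have N: "0 < real N" "4 * C / real N \<le> \<epsilon>"
    using assms \<open>4 * C < real N * \<epsilon>\<close> by (auto simp: zero_less_mult_iff pos_divide_le_eq mult.commute)
  \<comment> \<open>The next radius has to swallow every disk meeting the support of the present
    cutoff; it exists because diameters of disks meeting a given ball are bounded.\<close>
  have "\<exists>r'. r < r' \<and> (\<forall>i\<in>hit Q (ball 0 (2 * r)). closure (Q i) \<subseteq> ball 0 r')" if r: "0 < r" for r
  proof -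
    obtain D where D: "0 < D" "\<And>i. i \<in> hit Q (ball 0 (2 * r)) \<Longrightarrow> diameter (Q i) \<le> D"
      by (rule diameter_bound_in_ball[of "2 * r" 0]) (use r in auto)
    have "closure (Q i) \<subseteq> ball 0 (2 * r + D)" if i: "i \<in> hit Q (ball 0 (2 * r))" for i
    proof
      fix z assume z: "z \<in> closure (Q i)"
      obtain w where w: "w \<in> Q i" "w \<in> ball 0 (2 * r)" using i by (auto simp: hit_def)
      have "dist z w \<le> D"
        using dist_le_diameter_closure[OF z] w(1) closure_subset D(2)[OF i] by (meson order_trans subsetD)
      moreover have "dist 0 z \<le> dist 0 w + dist z w" by (metis dist_commute dist_triangle)
      ultimately show "z \<in> ball 0 (2 * r + D)" using w(2) by simp
    qed
    then show ?thesis using r D(1) by (intro exI[of _ "2 * r + D"]) auto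
  qed
  then have "\<forall>r. \<exists>r'. 0 < r \<longrightarrow> r < r' \<and> (\<forall>i\<in>hit Q (ball 0 (2 * r)). closure (Q i) \<subseteq> ball 0 r')" by blast
  then obtain G where G: "\<And>r. 0 < r \<Longrightarrow> r < G r \<and> (\<forall>i\<in>hit Q (ball 0 (2 * r)). closure (Q i) \<subseteq> ball 0 (G r))"
    by metis
  obtain r\<^sub>0 where r\<^sub>0: "0 < r\<^sub>0" "closure (Q j) \<subseteq> ball 0 r\<^sub>0"
    using bounded_subset_ballD[of "closure (Q j)" 0] by (auto simp: bounded_closure)
  define r where "r n = (G ^^ n) r\<^sub>0" for n
  have r_pos: "0 < r n" for n
    by (induction n) (use r\<^sub>0 G in \<open>auto simp: r_def intro: less_trans\<close>)
  have r_Suc: "r n < r (Suc n)" "\<And>i. i \<in> hit Q (ball 0 (2 * r n)) \<Longrightarrow> closure (Q i) \<subseteq> ball 0 (r (Suc n))" for n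
    using G[OF r_pos[of n]] by (auto simp: r_def)
  have r_mono: "r m \<le> r n" if "m \<le> n" for m n
    using lift_Suc_mono_le[of r m n] r_Suc(1) that by (simp add: less_imp_le)
  have inner: "closure (Q i) \<subseteq> ball 0 (r n)" if "m < n" "i \<in> hit Q (ball 0 (2 * r m))" for m n i
  proof -
    have "ball (0 :: complex) (r (Suc m)) \<subseteq> ball 0 (r n)"
      using r_mono[of "Suc m" n] that(1) by (intro subset_ball) auto
    then show ?thesis using r_Suc(2)[OF that(2)] by blast
  qed
  \<comment> \<open>Linear in the norm between the value 1 on \<open>ball 0 (r n)\<close> and the
    value 0 off \<open>ball 0 (2 * r n)\<close>, so \<open>1 / r n\<close> is a Lipschitz
    constant.\<close>
  define c where "c n z = max 0 (min 1 (2 - norm z / r n))" for n and z :: complex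
  \<comment> \<open>Bounds the oscillation of \<open>c n\<close> on disk \<open>i\<close>; it is set
    to zero when the boundary lies where \<open>c n\<close> is constantly 0 or constantly 1.\<close>
  define \<delta> where "\<delta> n i = (if i \<in> hit Q (ball 0 (2 * r n)) \<and> \<not> closure (Q i) \<subseteq> ball 0 (r n)
      then min 1 (diameter (Q i) / r n) else 0)" for n i
  have c_Lip: "\<bar>c n x - c n y\<bar> \<le> dist x y / r n" for n x y
  proof -
    have "\<bar>c n x - c n y\<bar> \<le> \<bar>norm x / r n - norm y / r n\<bar>" by (auto simp: c_def)
    also have "\<dots> = \<bar>norm x - norm y\<bar> / r n" using r_pos[of n] by (simp add: abs_div_pos diff_divide_distrib)
    also have "\<dots> \<le> dist x y / r n"
      using r_pos[of n] norm_triangle_ineq3[of x y] by (intro divide_right_mono) (auto simp: dist_norm)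
    finally show ?thesis .
  qed
  have c_outer: "c n x = 0" if "x \<notin> ball 0 (2 * r n)" for n x
    using that r_pos[of n] by (simp add: c_def field_simps)
  have c_inner: "c n x = 1" if "x \<in> ball 0 (r n)" for n x
    using that r_pos[of n] by (simp add: c_def field_simps)
  have c_range: "0 \<le> c n x" "c n x \<le> 1" for n x by (auto simp: c_def)
  have c_\<delta>: "\<bar>c n x - c n y\<bar> \<le> \<delta> n i" if xy: "x \<in> frontier (Q i)" "y \<in> frontier (Q i)" for n i x y
  proof -
    have cl: "x \<in> closure (Q i)" "y \<in> closure (Q i)" using xy frontier_subset_closure by blast+
    consider "i \<notin> hit Q (ball 0 (2 * r n))" | "closure (Q i) \<subseteq> ball 0 (r n)"
      | "i \<in> hit Q (ball 0 (2 * r n))" "\<not> closure (Q i) \<subseteq> ball 0 (r n)" by blast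
    then show ?thesis
    proof cases
      case 1
      then have "c n x = 0" "c n y = 0" using frontier_disjoint_ball xy by (blast intro: c_outer)+
      then show ?thesis by (simp add: \<delta>_def diameter_Q_pos less_imp_le r_pos)
    next
      case 2
      then have "c n x = 1" "c n y = 1" using cl c_inner by blast+
      then show ?thesis by (simp add: \<delta>_def diameter_Q_pos less_imp_le r_pos)
    next
      case 3
      have "\<bar>c n x - c n y\<bar> \<le> diameter (Q i) / r n"
        using c_Lip[of n x y] dist_le_diameter_closure[OF cl] r_pos[of n]
        by (meson divide_right_mono less_imp_le order_trans)
      moreover have "\<bar>c n x - c n y\<bar> \<le> 1" using c_range[of n x] c_range[of n y] by auto
      ultimately show ?thesis using 3 by (simp add: \<delta>_def)
    qed
  qed
  have \<delta>_nonneg: "0 \<le> \<delta> n i" for n i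
    using diameter_Q_pos[of i] r_pos[of n] by (simp add: \<delta>_def)
  \<comment> \<open>A disk that counts at the smaller scale meets the support of that cutoff, so it
    lies well inside the region where the larger cutoff is 1.\<close>
  have \<delta>_single: "\<delta> m i = 0 \<or> \<delta> n i = 0" if "m \<noteq> n" for m n i
    using that
  proof (induction m n rule: linorder_wlog)
    case (le m n)
    show ?case
    proof (cases "i \<in> hit Q (ball 0 (2 * r m))")
      case True
      then have "closure (Q i) \<subseteq> ball 0 (r n)" using inner[of m n i] le by simp
      then show ?thesis by (simp add: \<delta>_def)
    qed (simp add: \<delta>_def)
  qed blast
  define \<eta> where "\<eta> z = (\<Sum>n<N. c n z) / N" for z
  define d where "d i = (\<Sum>n<N. \<delta> n i) / N" for i
  have \<eta>_diff: "\<bar>\<eta> x - \<eta> y\<bar> \<le> (\<Sum>n<N. B n) / N" if "\<And>n. \<bar>c n x - c n y\<bar> \<le> B n" for x y B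
  proof -
    have "\<eta> x - \<eta> y = (\<Sum>n<N. c n x - c n y) / N" by (simp add: \<eta>_def sum_subtractf diff_divide_distrib)
    then have "\<bar>\<eta> x - \<eta> y\<bar> = \<bar>\<Sum>n<N. c n x - c n y\<bar> / N" by simp
    also have "\<dots> \<le> (\<Sum>n<N. B n) / N"
      using that by (intro divide_right_mono order_trans[OF sum_abs] sum_mono) auto
    finally show ?thesis .
  qed
  have \<eta>_const: "\<eta> x = k" if "\<And>n. n < N \<Longrightarrow> c n x = k" for x k
    using that N(1) by (simp add: \<eta>_def)
  have d_sum: "(\<Sum>\<^sub>\<infinity>i\<in>UNIV. ennreal ((d i)\<^sup>2)) \<le> ennreal \<epsilon>"
  proof -
    have "(d i)\<^sup>2 = (\<Sum>n<N. (\<delta> n i)\<^sup>2 / (real N)\<^sup>2)" for i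
      unfolding d_def power_divide
      by (subst square_sum_single) (auto simp: \<delta>_single sum_divide_distrib)
    then have "(\<Sum>\<^sub>\<infinity>i\<in>UNIV. ennreal ((d i)\<^sup>2)) = (\<Sum>\<^sub>\<infinity>i\<in>UNIV. \<Sum>n<N. ennreal ((\<delta> n i)\<^sup>2 / (real N)\<^sup>2))"
      by simp
    also have "\<dots> = (\<Sum>n<N. \<Sum>\<^sub>\<infinity>i\<in>UNIV. ennreal ((\<delta> n i)\<^sup>2 / (real N)\<^sup>2))"
      by (rule infsum_sum_ennreal)
    also have "\<dots> \<le> (\<Sum>n<N. ennreal (4 * C / (real N)\<^sup>2))"
    proof (rule sum_mono)
      fix n
      define k where "k = 1 / ((real N)\<^sup>2 * (r n)\<^sup>2)"
      have k: "0 \<le> k" by (simp add: k_def)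
      let ?H = "hit Q (ball 0 (2 * r n))"
      have "(\<Sum>\<^sub>\<infinity>i\<in>UNIV. ennreal ((\<delta> n i)\<^sup>2 / (real N)\<^sup>2)) = (\<Sum>\<^sub>\<infinity>i\<in>?H. ennreal ((\<delta> n i)\<^sup>2 / (real N)\<^sup>2))"
        by (rule infsum_zero_outside_ennreal) (auto simp: \<delta>_def)
      also have "\<dots> \<le> (\<Sum>\<^sub>\<infinity>i\<in>?H. ennreal k * (ennreal (min (diameter (Q i)) (2 * r n)))\<^sup>2)"
      proof (rule infsum_mono_ennreal)
        fix i
        define l where "l = min (diameter (Q i)) (2 * r n)"
        have l: "0 \<le> l" using diameter_Q_pos[of i] r_pos[of n] by (simp add: l_def)
        have "\<delta> n i \<le> l / r n"
          using r_pos[of n] diameter_Q_pos[of i] by (auto simp: \<delta>_def l_def min_def field_simps)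
        then have "(\<delta> n i)\<^sup>2 \<le> (l / r n)\<^sup>2" using \<delta>_nonneg by (intro power_mono)
        then have "(\<delta> n i)\<^sup>2 / (real N)\<^sup>2 \<le> (l / r n)\<^sup>2 / (real N)\<^sup>2" by (intro divide_right_mono) auto
        also have "\<dots> = k * l\<^sup>2" by (simp add: k_def power_divide)
        finally have "ennreal ((\<delta> n i)\<^sup>2 / (real N)\<^sup>2) \<le> ennreal (k * l\<^sup>2)" by (rule ennreal_leI)
        also have "\<dots> = ennreal k * (ennreal l)\<^sup>2" using k l by (simp add: ennreal_mult ennreal_power)
        finally show "ennreal ((\<delta> n i)\<^sup>2 / (real N)\<^sup>2) \<le> ennreal k * (ennreal (min (diameter (Q i)) (2 * r n)))\<^sup>2"
          by (simp add: l_def)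
      qed simp
      also have "\<dots> = ennreal k * (\<Sum>\<^sub>\<infinity>i\<in>?H. (ennreal (min (diameter (Q i)) (2 * r n)))\<^sup>2)"
        by (rule infsum_cmult_ennreal)
      also have "\<dots> \<le> ennreal k * ennreal (C * (2 * r n)\<^sup>2)"
        using r_pos[of n] by (intro mult_left_mono C(2)) auto
      also have "\<dots> = ennreal (k * (C * (2 * r n)\<^sup>2))" using k C(1) by (simp add: ennreal_mult)
      also have "k * (C * (2 * r n)\<^sup>2) = 4 * C / (real N)\<^sup>2"
        using r_pos[of n] by (simp add: k_def power_mult_distrib)
      finally show "(\<Sum>\<^sub>\<infinity>i\<in>UNIV. ennreal ((\<delta> n i)\<^sup>2 / (real N)\<^sup>2)) \<le> ennreal (4 * C / (real N)\<^sup>2)" .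
    qed
    also have "\<dots> = ennreal (\<Sum>n<N. 4 * C / (real N)\<^sup>2)" using C(1) by (intro sum_ennreal) auto
    also have "(\<Sum>n<N. 4 * C / (real N)\<^sup>2) = 4 * C / real N" by (simp add: power2_eq_square)
    also have "ennreal (4 * C / real N) \<le> ennreal \<epsilon>" using N(2) by (rule ennreal_leI)
    finally show ?thesis .
  qed
  show ?thesis
  proof (intro exI conjI allI impI ballI)
    fix x :: complex
    show "0 \<le> \<eta> x" unfolding \<eta>_def using c_range by (intro divide_nonneg_nonneg sum_nonneg) auto
    have "(\<Sum>n<N. c n x) \<le> (\<Sum>n<N. 1)" using c_range by (intro sum_mono)
    then show "\<eta> x \<le> 1" using N(1) by (simp add: \<eta>_def)
  next
    fix x y :: complex
    have "\<bar>\<eta> x - \<eta> y\<bar> \<le> (\<Sum>n<N. dist x y / r\<^sub>0) / N"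
    proof (rule \<eta>_diff)
      fix n
      have "r\<^sub>0 \<le> r n" using r_mono[of 0 n] by (simp add: r_def)
      then have "dist x y / r n \<le> dist x y / r\<^sub>0" using r\<^sub>0(1) by (intro divide_left_mono) auto
      then show "\<bar>c n x - c n y\<bar> \<le> dist x y / r\<^sub>0" using c_Lip[of n x y] by linarith
    qed
    also have "\<dots> = (1 / r\<^sub>0) * dist x y" using N(1) by simp
    finally show "\<bar>\<eta> x - \<eta> y\<bar> \<le> (1 / r\<^sub>0) * dist x y" .
  next
    show "0 \<le> 1 / r\<^sub>0" using r\<^sub>0 by simp
    show "0 < 2 * r N" using r_pos by simp
    fix x :: complex assume x: "x \<notin> ball 0 (2 * r N)"
    show "\<eta> x = 0"
    proof (rule \<eta>_const, rule c_outer)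
      fix n assume "n < N"
      then show "x \<notin> ball 0 (2 * r n)" using x r_mono[of n N] by auto
    qed
  next
    show "\<bar>\<eta> x - \<eta> y\<bar> \<le> d i" if "x \<in> frontier (Q i)" "y \<in> frontier (Q i)" for i x y
      unfolding d_def using c_\<delta>[OF that] by (rule \<eta>_diff)
    show "0 \<le> d i" for i unfolding d_def using \<delta>_nonneg by (intro divide_nonneg_nonneg sum_nonneg) auto
    show "(\<Sum>\<^sub>\<infinity>i\<in>UNIV. ennreal ((d i)\<^sup>2)) \<le> ennreal \<epsilon>" by (rule d_sum)
    show "\<eta> x = 1" if "x \<in> frontier (Q j)" for x
    proof (rule \<eta>_const, rule c_inner)
      fix n
      have "x \<in> ball 0 r\<^sub>0" using that r\<^sub>0(2) frontier_subset_closure[of "Q j"] by blast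
      then have "x \<in> ball 0 (r 0)" by (simp add: r_def)
      then show "x \<in> ball 0 (r n)" using r_mono[of 0 n] by auto
    qed
  qed
qed

text \<open>In the bound from \<open>caccioppoli\<close>, \<open>B\<close> depends on
  \<open>u\<close> and \<open>j\<close> but not on the cutoff, whose energy can be made arbitrarily
  small.\<close>

lemma harmonic_osc_eq_0:
  fixes u :: "complex \<Rightarrow> real"
  assumes harm: "carpet_harmonic v UNIV Q (\<lambda>x. ereal (u x))"
    and bdd: "(\<exists>B. \<forall>x\<in>S. u x \<le> B) \<or> (\<exists>B. \<forall>x\<in>S. B \<le> u x)"
  shows "osc (Q j) (\<lambda>x. ereal (u x)) = 0"
proof -
  obtain \<sigma> c where \<sigma>: "\<sigma> = 1 \<or> \<sigma> = (-1 :: real)" and U: "\<And>x. x \<in> S \<Longrightarrow> 1 \<le> \<sigma> * u x + c"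
  proof -
    from bdd show ?thesis
    proof (elim disjE exE)
      fix B assume "\<forall>x\<in>S. u x \<le> B"
      then show ?thesis by (intro that[of "-1" "B + 1"]) auto
    next
      fix B assume "\<forall>x\<in>S. B \<le> u x"
      then show ?thesis by (intro that[of 1 "1 - B"]) auto
    qed
  qed
  have u: "(\<lambda>x. ereal (u x)) \<in> sobolev_loc v UNIV Q" using harm by (simp add: carpet_harmonic_def)
  obtain M m where Mm: "\<forall>i. max_disk (Q i) (\<lambda>x. ereal (u x)) = ereal (M i) \<and>
        min_disk (Q i) (\<lambda>x. ereal (u x)) = ereal (m i) \<and> m i \<le> M i \<and>
        osc (Q i) (\<lambda>x. ereal (u x)) = ennreal (M i - m i) \<and>
        (\<forall>x\<in>frontier (Q i). ereal (m i) \<le> ereal (u x) \<and> ereal (u x) \<le> ereal (M i))"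
    using sobolev_loc_disk_bounds[OF u] by (elim exE)
  define B where "B = \<bar>M j\<bar> + \<bar>m j\<bar> + \<bar>c\<bar>"
  define a where "a = M j - m j"
  have B: "\<sigma> * u x + c \<le> B" if "x \<in> frontier (Q j)" for x
    using Mm that \<sigma> by (fastforce simp: B_def)
  have a: "0 \<le> a" "osc (Q j) (\<lambda>x. ereal (u x)) = ennreal a" using Mm by (auto simp: a_def)
  have key: "a\<^sup>2 \<le> 6 * \<epsilon> * B\<^sup>2" if \<epsilon>: "0 < \<epsilon>" for \<epsilon>
  proof -
    obtain \<eta> :: "complex \<Rightarrow> real" and L R d where \<eta>: "\<forall>x. 0 \<le> \<eta> x \<and> \<eta> x \<le> 1" "\<forall>x y. \<bar>\<eta> x - \<eta> y\<bar> \<le> L * dist x y" "0 \<le> L"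
      "0 < R" "\<forall>x. x \<notin> ball 0 R \<longrightarrow> \<eta> x = 0"
      "\<forall>i x y. x \<in> frontier (Q i) \<longrightarrow> y \<in> frontier (Q i) \<longrightarrow> \<bar>\<eta> x - \<eta> y\<bar> \<le> d i" "\<forall>i. 0 \<le> d i"
      "(\<Sum>\<^sub>\<infinity>i\<in>UNIV. ennreal ((d i)\<^sup>2)) \<le> ennreal \<epsilon>" "\<forall>x\<in>frontier (Q j). \<eta> x = 1"
      using exists_cutoff[OF \<epsilon>, of j] by (elim exE conjE)
    show ?thesis
      by (rule caccioppoli[OF harm \<sigma> U, of \<eta> L R d \<epsilon> j B a]) (use \<eta> \<epsilon> B a in \<open>auto\<close>)
  qed
  have "a = 0"
  proof (rule ccontr)
    assume "a \<noteq> 0"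
    define K where "K = B\<^sup>2 + 1"
    \<comment> \<open>With this value the bound becomes
      \<open>a\<^sup>2 \<le> a\<^sup>2 / 2\<close>.\<close>
    define \<epsilon> where "\<epsilon> = a\<^sup>2 / (12 * K)"
    have K: "0 < K" by (simp add: K_def add_nonneg_pos)
    have "0 < a\<^sup>2" using \<open>a \<noteq> 0\<close> by simp
    then have "0 < \<epsilon>" using K by (simp add: \<epsilon>_def)
    then have "a\<^sup>2 \<le> 6 * \<epsilon> * B\<^sup>2" by (rule key)
    also have "\<dots> \<le> 6 * \<epsilon> * K" using \<open>0 < \<epsilon>\<close> by (simp add: K_def)
    also have "\<dots> = a\<^sup>2 / 2" using K by (simp add: \<epsilon>_def)
    finally show False using \<open>0 < a\<^sup>2\<close> by simp
  qed
  then show ?thesis using a(2) by simp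
qed

end

section \<open>Values along generic lines and squares\<close>

lemma exists_not_in_negligible:
  fixes N :: "real set"
  assumes "negligible N" "a < b"
  shows "\<exists>h. a < h \<and> h < b \<and> h \<notin> N"
proof (rule ccontr)
  assume "\<not> ?thesis"
  then have "{a<..<b} \<subseteq> N" by auto
  then have "negligible {a<..<b}" using assms(1) negligible_subset by blast
  then show False using assms(2) open_not_negligible[of "{a<..<b}"] by auto
qed

lemma exists_axis_line_meeting_open:
  assumes "open U" "U \<noteq> {}" "negligible N"
  shows "\<exists>h t. h \<notin> N \<and> axis_line d h t \<in> U"
proof -
  obtain p where "p \<in> U" using assms(2) by blast
  then obtain e where e: "0 < e" "ball p e \<subseteq> U" using assms(1) open_contains_ball by blast
  define h\<^sub>0 where "h\<^sub>0 = axis_coord d p"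
  define t where "t = axis_coord (\<not> d) p"
  have p: "p = axis_line d h\<^sub>0 t" by (auto simp: h\<^sub>0_def t_def axis_coord_def axis_line_def complex_eq_iff)
  obtain h where h: "h\<^sub>0 < h" "h < h\<^sub>0 + e" "h \<notin> N"
    using exists_not_in_negligible[OF assms(3), of h\<^sub>0 "h\<^sub>0 + e"] e(1) by auto
  have "dist p (axis_line d h t) = \<bar>h - h\<^sub>0\<bar>"
    unfolding p by (auto simp: axis_line_def dist_norm cmod_def)
  then have "axis_line d h t \<in> ball p e" using h by simp
  then show ?thesis using e h by blast
qed

text \<open>With \<open>s\<close> of either sign, \<open>c + s * r\<close> is the offset of a side
  of the square of radius \<open>r\<close>; exceptional lines thus give only a null set of
  exceptional radii.\<close>

lemma negligible_affine_preimage: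
  fixes N :: "real set"
  assumes "negligible N" "s = 1 \<or> s = -1"
  shows "negligible {r. c + s * r \<in> N}"
proof -
  have "{r. c + s * r \<in> N} \<subseteq> (\<lambda>h. s * (h - c)) ` N"
  proof
    fix r assume "r \<in> {r. c + s * r \<in> N}"
    then show "r \<in> (\<lambda>h. s * (h - c)) ` N"
      using assms(2) by (intro image_eqI[of _ _ "c + s * r"]) auto
  qed
  moreover have "negligible ((\<lambda>h. s * (h - c)) ` N)"
    by (rule negligible_Lipschitz_real_image[of "\<lambda>h. h"]) (use assms in auto)
  ultimately show ?thesis by (metis negligible_subset)
qed

text \<open>Chebyshev: if \<open>F\<close> exceeded \<open>e\<close> on the interval from 0 to
  \<open>l\<close> off the null set, its integral would be at least \<open>e * l\<close>. The
  hypothesis is squared because \<open>length_area\<close> delivers a squared integral.\<close>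

lemma exists_small_value:
  fixes F :: "real \<Rightarrow> ennreal"
  assumes "F \<in> borel_measurable borel" "negligible E" "0 < l" "0 < e"
    and "(\<integral>\<^sup>+h. F h \<partial>lborel)\<^sup>2 < ennreal ((e * l)\<^sup>2)"
  shows "\<exists>r. 0 < r \<and> r < l \<and> r \<notin> E \<and> F r \<le> ennreal e"
proof (rule ccontr)
  assume contra: "\<not> ?thesis"
  have "E \<in> null_sets lebesgue" using assms(2) by (simp add: negligible_iff_null_sets)
  then obtain N where N: "N \<in> null_sets lborel" "E \<subseteq> N" by (auto simp: null_sets_completion_iff2)
  have "ennreal (e * l) = (\<integral>\<^sup>+h. ennreal e * indicator {0<..<l} h \<partial>lborel)"
    using assms(3,4) by (simp add: nn_integral_cmult ennreal_mult)
  also have "\<dots> \<le> (\<integral>\<^sup>+h. F h \<partial>lborel)"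
  proof (rule nn_integral_mono_AE, rule AE_I'[OF N(1)])
    show "{h \<in> space lborel. \<not> ennreal e * indicator {0<..<l} h \<le> F h} \<subseteq> N"
    proof
      fix h assume h: "h \<in> {h \<in> space lborel. \<not> ennreal e * indicator {0<..<l} h \<le> F h}"
      have "h \<in> {0<..<l}" by (rule ccontr) (use h in simp)
      then have "0 < h" "h < l" "\<not> ennreal e \<le> F h" using h by simp_all
      then have "h \<in> E" using contra by (meson le_cases)
      then show "h \<in> N" using N(2) by blast
    qed
  qed
  finally have "(ennreal (e * l))\<^sup>2 \<le> (\<integral>\<^sup>+h. F h \<partial>lborel)\<^sup>2" by (intro power_mono) auto
  then show False using assms(3-5) by (simp add: ennreal_power)
qed

text \<open>Distance in the maximum norm: its level sets are boundaries of axis-parallel squares,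
  whose sides can be taken on generic lines, and being 1-Lipschitz it can serve as the projection in
  \<open>length_area\<close>.\<close>

definition sup_dist :: "complex \<Rightarrow> complex \<Rightarrow> real" where
  "sup_dist x z = max \<bar>Re z - Re x\<bar> \<bar>Im z - Im x\<bar>"

lemma sup_dist_Lipschitz: "\<bar>sup_dist x z - sup_dist x w\<bar> \<le> dist z w"
proof -
  have "\<bar>sup_dist x z - sup_dist x w\<bar> \<le> max \<bar>Re z - Re w\<bar> \<bar>Im z - Im w\<bar>"
    by (auto simp: sup_dist_def max_def abs_real_def)
  also have "\<dots> \<le> dist z w"
    using abs_Re_le_cmod[of "z - w"] abs_Im_le_cmod[of "z - w"] by (auto simp: dist_norm)
  finally show ?thesis .
qed

lemma sup_dist_le: "sup_dist x z \<le> dist x z"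
  using abs_Re_le_cmod[of "z - x"] abs_Im_le_cmod[of "z - x"] by (auto simp: sup_dist_def dist_norm norm_minus_commute)

lemma dist_le_sup_dist: "dist x z \<le> 2 * sup_dist x z"
proof -
  have "\<bar>Re (z - x)\<bar> \<le> sup_dist x z" "\<bar>Im (z - x)\<bar> \<le> sup_dist x z" by (auto simp: sup_dist_def)
  then show ?thesis using cmod_le[of "z - x"] by (simp add: dist_norm norm_minus_commute)
qed

lemma sup_dist_eq_0_iff [simp]: "sup_dist x z = 0 \<longleftrightarrow> z = x"
  by (auto simp: sup_dist_def complex_eq_iff max_def)

lemma sup_dist_nonneg: "0 \<le> sup_dist x z"
  by (simp add: sup_dist_def)

lemma continuous_on_sup_dist: "continuous_on A (sup_dist x)"
  unfolding sup_dist_def by (intro continuous_intros)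

section \<open>Comparison of values along generic lines and squares\<close>

context plane_carpet
begin

definition good_line :: "(complex \<Rightarrow> ereal) \<Rightarrow> bool \<Rightarrow> real \<Rightarrow> bool" where
  "good_line g d h \<longleftrightarrow> (\<forall>s t. s \<le> t \<longrightarrow> axis_line d h s \<in> S \<longrightarrow> axis_line d h t \<in> S \<longrightarrow>
     \<bar>g (axis_line d h s)\<bar> \<noteq> \<infinity> \<and> \<bar>g (axis_line d h t)\<bar> \<noteq> \<infinity> \<and>
     \<bar>g (axis_line d h s) - g (axis_line d h t)\<bar>
       \<le> enn2ereal (\<Sum>\<^sub>\<infinity>i\<in>hit Q (axis_line d h ` {s..t}). osc (Q i) g))"

lemma negligible_not_good_line:
  assumes "g \<in> sobolev_loc v UNIV Q"
  shows "negligible {h. \<not> good_line g d h}"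
proof -
  define \<Gamma> where "\<Gamma> = {\<gamma>. is_curve \<gamma> \<and> (\<exists>s t. s \<le> t \<and> {s..t} \<subseteq> fst \<gamma> \<and>
    snd \<gamma> s \<in> S \<and> snd \<gamma> t \<in> S \<and> \<not> (\<bar>g (snd \<gamma> s)\<bar> \<noteq> \<infinity> \<and> \<bar>g (snd \<gamma> t)\<bar> \<noteq> \<infinity> \<and>
      \<bar>g (snd \<gamma> s) - g (snd \<gamma> t)\<bar> \<le> enn2ereal (\<Sum>\<^sub>\<infinity>i\<in>hit Q (snd \<gamma> ` {s..t}). osc (Q i) g)))}"
  have "carpet_mod v UNIV Q \<Gamma> = 0"
    unfolding \<Gamma>_def by (rule carpet_mod_upper_gradient_fails_eq_0) (use assms in \<open>simp add: sobolev_loc_def\<close>)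
  then have "negligible {h. \<exists>a b. a \<le> b \<and> ({a..b}, axis_line d h) \<in> \<Gamma>}" by (rule negligible_bad_lines)
  moreover have "{h. \<not> good_line g d h} \<subseteq> {h. \<exists>a b. a \<le> b \<and> ({a..b}, axis_line d h) \<in> \<Gamma>}"
  proof clarify
    fix h assume "\<not> good_line g d h"
    then obtain s t where st: "s \<le> t" "axis_line d h s \<in> S" "axis_line d h t \<in> S"
      "\<not> (\<bar>g (axis_line d h s)\<bar> \<noteq> \<infinity> \<and> \<bar>g (axis_line d h t)\<bar> \<noteq> \<infinity> \<and>
     \<bar>g (axis_line d h s) - g (axis_line d h t)\<bar>
       \<le> enn2ereal (\<Sum>\<^sub>\<infinity>i\<in>hit Q (axis_line d h ` {s..t}). osc (Q i) g))"
      unfolding good_line_def not_all not_imp by (elim exE conjE)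
    have "is_curve ({s..t}, axis_line d h)"
      using st(1) continuous_on_axis_line[of "{s..t}" d h] by (auto simp: is_curve_def is_interval_cc)
    then have "({s..t}, axis_line d h) \<in> \<Gamma>"
      unfolding \<Gamma>_def using st by (intro CollectI conjI exI[of _ s] exI[of _ t]) simp_all
    then show "\<exists>a b. a \<le> b \<and> ({a..b}, axis_line d h) \<in> \<Gamma>" using st(1) by blast
  qed
  ultimately show ?thesis by (rule negligible_subset)
qed

text \<open>The number attached to a disk in the definition of the normalized version, as a
  real.\<close>

definition disk_value :: "(complex \<Rightarrow> ereal) \<Rightarrow> nat \<Rightarrow> real" where
  "disk_value g i = real_of_ereal (max_disk (Q i) g)"

definition disk_osc :: "(complex \<Rightarrow> ereal) \<Rightarrow> nat \<Rightarrow> real" where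
  "disk_osc g i = real_of_ereal (max_disk (Q i) g) - real_of_ereal (min_disk (Q i) g)"

text \<open>Filling each disk with its value makes every point of the plane a possible end of a
  segment, in particular a corner of a square that happens to lie in a disk.\<close>

definition extended_value :: "(complex \<Rightarrow> ereal) \<Rightarrow> complex \<Rightarrow> real" where
  "extended_value g z = (if z \<in> S then real_of_ereal (g z) else disk_value g (THE i. z \<in> Q i))"

lemma extended_value_disk:
  assumes "z \<in> Q i"
  shows "extended_value g z = disk_value g i"
proof -
  have "(THE i. z \<in> Q i) = i" using assms Q_disjoint by (intro the_equality) auto
  moreover have "z \<notin> S" using assms in_S_notin_Q by blast
  ultimately show ?thesis by (simp add: extended_value_def)
qed

lemma disk_value_osc:
  assumes "g \<in> sobolev_loc v UNIV Q"
  shows "max_disk (Q i) g = ereal (disk_value g i)" "osc (Q i) g = ennreal (disk_osc g i)" "0 \<le> disk_osc g i"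
    "\<And>x. x \<in> frontier (Q i) \<Longrightarrow> \<bar>disk_value g i - real_of_ereal (g x)\<bar> \<le> disk_osc g i"
proof -
  obtain M m where Mm: "\<forall>i. max_disk (Q i) g = ereal (M i) \<and> min_disk (Q i) g = ereal (m i) \<and> m i \<le> M i \<and>
    osc (Q i) g = ennreal (M i - m i) \<and> (\<forall>x\<in>frontier (Q i). ereal (m i) \<le> g x \<and> g x \<le> ereal (M i))"
    using sobolev_loc_disk_bounds[OF assms] by (elim exE)
  then show "max_disk (Q i) g = ereal (disk_value g i)" "osc (Q i) g = ennreal (disk_osc g i)" "0 \<le> disk_osc g i"
    by (auto simp: disk_value_def disk_osc_def)
  fix x assume "x \<in> frontier (Q i)"
  then have "ereal (m i) \<le> g x \<and> g x \<le> ereal (M i)" using Mm by blast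
  then show "\<bar>disk_value g i - real_of_ereal (g x)\<bar> \<le> disk_osc g i"
    using Mm by (cases "g x") (auto simp: disk_value_def disk_osc_def)
qed

text \<open>One \<open>\<Theta>\<close> at each end, to pass from inside a disk to a boundary point
  on the line, and one for the upper gradient inequality between the two carpet points so
  reached.\<close>

lemma extended_value_line_diff:
  assumes g: "g \<in> sobolev_loc v UNIV Q" and line: "good_line g d h"
    and \<Theta>: "(\<Sum>\<^sub>\<infinity>i\<in>hit Q (axis_line d h ` {a..b}). osc (Q i) g) \<le> ennreal \<Theta>" "0 \<le> \<Theta>"
    and st: "s \<in> {a..b}" "t \<in> {a..b}"
  shows "\<bar>extended_value g (axis_line d h s) - extended_value g (axis_line d h t)\<bar> \<le> 3 * \<Theta>"
proof -
  let ?l = "axis_line d h"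
  have osc: "disk_osc g i \<le> \<Theta>" if "i \<in> hit Q (?l ` {a..b})" for i
  proof -
    have "ennreal (disk_osc g i) \<le> ennreal \<Theta>"
      using infsum_ge_member_ennreal[OF that, of "\<lambda>i. osc (Q i) g"] \<Theta>(1) disk_value_osc(2)[OF g, of i] by simp
    then show ?thesis using \<Theta>(2) by (simp add: ennreal_le_iff)
  qed
  \<comment> \<open>A second parameter \<open>q\<close> whose point is outside \<open>Q i\<close>
    forces the segment to cross the boundary of \<open>Q i\<close>.\<close>
  have to_S: "\<exists>r'\<in>{a..b}. ?l r' \<in> S \<and> \<bar>extended_value g (?l r) - real_of_ereal (g (?l r'))\<bar> \<le> \<Theta>"
    if r: "r \<in> {a..b}" "q \<in> {a..b}" "\<And>i. ?l r \<in> Q i \<Longrightarrow> ?l q \<notin> Q i" for r q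
  proof (cases "?l r \<in> S")
    case True
    then show ?thesis using r(1) \<Theta>(2) by (intro bexI[of _ r]) (auto simp: extended_value_def)
  next
    case False
    then obtain i where i: "?l r \<in> Q i" using not_in_S by blast
    have "connected (?l ` {a..b})"
      by (intro connected_continuous_image continuous_on_axis_line) simp
    then have "?l ` {a..b} \<inter> frontier (Q i) \<noteq> {}"
      by (rule connected_Int_frontier) (use i r in blast)+
    then obtain r' where r': "r' \<in> {a..b}" "?l r' \<in> frontier (Q i)" by blast
    have "i \<in> hit Q (?l ` {a..b})" using i r(1) by (auto simp: hit_def)
    then have "\<bar>disk_value g i - real_of_ereal (g (?l r'))\<bar> \<le> \<Theta>"
      using osc[of i] disk_value_osc(4)[OF g r'(2)] by simp
    then show ?thesis using r' frontier_subset_S extended_value_disk[OF i] by (intro bexI[of _ r']) auto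
  qed
  show ?thesis
  proof (cases "\<exists>i. ?l s \<in> Q i \<and> ?l t \<in> Q i")
    case True
    then obtain i where "?l s \<in> Q i" "?l t \<in> Q i" by blast
    then show ?thesis using \<Theta>(2) by (simp add: extended_value_disk)
  next
    case False
    obtain s' where s': "s' \<in> {a..b}" "?l s' \<in> S" "\<bar>extended_value g (?l s) - real_of_ereal (g (?l s'))\<bar> \<le> \<Theta>"
      using to_S[OF st(1) st(2)] False by blast
    obtain t' where t': "t' \<in> {a..b}" "?l t' \<in> S" "\<bar>extended_value g (?l t) - real_of_ereal (g (?l t'))\<bar> \<le> \<Theta>"
      using to_S[OF st(2) st(1)] False by blast
    have mid: "\<bar>real_of_ereal (g (?l p)) - real_of_ereal (g (?l q))\<bar> \<le> \<Theta>"
      if pq: "p \<in> {a..b}" "q \<in> {a..b}" "?l p \<in> S" "?l q \<in> S" "p \<le> q" for p q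
    proof -
      have fin: "\<bar>g (?l p)\<bar> \<noteq> \<infinity>" "\<bar>g (?l q)\<bar> \<noteq> \<infinity>"
        and le: "\<bar>g (?l p) - g (?l q)\<bar> \<le> enn2ereal (\<Sum>\<^sub>\<infinity>i\<in>hit Q (?l ` {p..q}). osc (Q i) g)"
        using line[unfolded good_line_def, THEN spec, THEN spec, THEN mp, OF pq(5), THEN mp, OF pq(3), THEN mp, OF pq(4)]
        by simp_all
      obtain x y where xy: "g (?l p) = ereal x" "g (?l q) = ereal y" using fin by auto
      have "ennreal \<bar>x - y\<bar> \<le> (\<Sum>\<^sub>\<infinity>i\<in>hit Q (?l ` {p..q}). osc (Q i) g)"
        using le unfolding xy by (simp only: abs_ereal_diff_le_iff)
      also have "\<dots> \<le> (\<Sum>\<^sub>\<infinity>i\<in>hit Q (?l ` {a..b}). osc (Q i) g)"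
        using pq by (intro infsum_mono_ennreal hit_mono image_mono) auto
      also have "\<dots> \<le> ennreal \<Theta>" by (rule \<Theta>(1))
      finally show ?thesis using \<Theta>(2) xy by (simp add: ennreal_le_iff)
    qed
    have "\<bar>real_of_ereal (g (?l s')) - real_of_ereal (g (?l t'))\<bar> \<le> \<Theta>"
      using mid[of s' t'] mid[of t' s'] s' t' by (cases "s' \<le> t'") (auto simp: abs_minus_commute)
    then show ?thesis using s'(3) t'(3) by linarith
  qed
qed

text \<open>From any point of the square one fixed corner is reached along at most two sides, at
  cost \<open>3 * \<Theta>\<close> each; the two given points are compared through that
  corner.\<close>

lemma extended_value_square_diff:
  assumes g: "g \<in> sobolev_loc v UNIV Q"
    and lines: "\<And>s. s = 1 \<or> s = -1 \<Longrightarrow> good_line g True (Im x + s * r) \<and> good_line g False (Re x + s * r)"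
    and \<Theta>: "(\<Sum>\<^sub>\<infinity>i\<in>hit Q {z. sup_dist x z = r}. osc (Q i) g) \<le> ennreal \<Theta>" "0 \<le> \<Theta>"
    and r: "0 < r" and zw: "sup_dist x z = r" "sup_dist x w = r"
  shows "\<bar>extended_value g z - extended_value g w\<bar> \<le> 12 * \<Theta>"
proof -
  let ?V = "extended_value g"
  have side: "\<bar>?V (axis_line d h p) - ?V (axis_line d h q)\<bar> \<le> 3 * \<Theta>"
    if good: "good_line g d h" and sq: "\<And>t. t \<in> {c - r..c + r} \<Longrightarrow> sup_dist x (axis_line d h t) = r"
      and pq: "p \<in> {c - r..c + r}" "q \<in> {c - r..c + r}" for d h c p q
  proof (rule extended_value_line_diff[OF g good _ \<Theta>(2) pq])
    have "axis_line d h ` {c - r..c + r} \<subseteq> {z. sup_dist x z = r}" using sq by auto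
    then show "(\<Sum>\<^sub>\<infinity>i\<in>hit Q (axis_line d h ` {c - r..c + r}). osc (Q i) g) \<le> ennreal \<Theta>"
      using infsum_mono_ennreal[OF hit_mono, of _ _ Q "\<lambda>i. osc (Q i) g" "\<lambda>i. osc (Q i) g"] \<Theta>(1) order_trans by blast
  qed
  have hor: "\<bar>?V (Complex p (Im x + s * r)) - ?V (Complex q (Im x + s * r))\<bar> \<le> 3 * \<Theta>"
    if "s = 1 \<or> s = -1" "p \<in> {Re x - r..Re x + r}" "q \<in> {Re x - r..Re x + r}" for s p q
  proof -
    have "\<bar>?V (axis_line True (Im x + s * r) p) - ?V (axis_line True (Im x + s * r) q)\<bar> \<le> 3 * \<Theta>"
    proof (rule side[OF _ _ that(2,3)])
      show "good_line g True (Im x + s * r)" using lines[OF that(1)] by simp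
      show "sup_dist x (axis_line True (Im x + s * r) t) = r" if "t \<in> {Re x - r..Re x + r}" for t
        using that \<open>s = 1 \<or> s = -1\<close> r by (auto simp: axis_line_def sup_dist_def max_def)
    qed
    then show ?thesis by (simp add: axis_line_def)
  qed
  have ver: "\<bar>?V (Complex (Re x + s * r) p) - ?V (Complex (Re x + s * r) q)\<bar> \<le> 3 * \<Theta>"
    if "s = 1 \<or> s = -1" "p \<in> {Im x - r..Im x + r}" "q \<in> {Im x - r..Im x + r}" for s p q
  proof -
    have "\<bar>?V (axis_line False (Re x + s * r) p) - ?V (axis_line False (Re x + s * r) q)\<bar> \<le> 3 * \<Theta>"
    proof (rule side[OF _ _ that(2,3)])
      show "good_line g False (Re x + s * r)" using lines[OF that(1)] by simp
      show "sup_dist x (axis_line False (Re x + s * r) t) = r" if "t \<in> {Im x - r..Im x + r}" for t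
        using that \<open>s = 1 \<or> s = -1\<close> r by (auto simp: axis_line_def sup_dist_def max_def)
    qed
    then show ?thesis by (simp add: axis_line_def)
  qed
  define c where "c = Complex (Re x + 1 * r) (Im x + 1 * r)"
  have corner: "\<bar>?V z - ?V c\<bar> \<le> 6 * \<Theta>" if z: "sup_dist x z = r" for z
  proof -
    have range: "Re z \<in> {Re x - r..Re x + r}" "Im z \<in> {Im x - r..Im x + r}"
      and cases: "\<bar>Re z - Re x\<bar> = r \<or> \<bar>Im z - Im x\<bar> = r"
      using z by (auto simp: sup_dist_def max_def abs_le_iff split: if_splits)
    from cases show ?thesis
    proof
      assume "\<bar>Re z - Re x\<bar> = r"
      then obtain s where s: "s = 1 \<or> s = -1" "Re z = Re x + s * r"
        by (metis abs_real_def add.commute diff_add_cancel minus_diff_eq mult_1 mult_minus1)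
      have "z = Complex (Re x + s * r) (Im z)" using s(2) by (simp add: complex_eq_iff)
      then have "\<bar>?V z - ?V (Complex (Re x + s * r) (Im x + 1 * r))\<bar> \<le> 3 * \<Theta>"
        using ver[OF s(1) range(2), of "Im x + 1 * r"] r by simp
      moreover have "\<bar>?V (Complex (Re x + s * r) (Im x + 1 * r)) - ?V c\<bar> \<le> 3 * \<Theta>"
        unfolding c_def using s(1) r by (intro hor) auto
      ultimately show ?thesis by linarith
    next
      assume "\<bar>Im z - Im x\<bar> = r"
      then obtain s where s: "s = 1 \<or> s = -1" "Im z = Im x + s * r"
        by (metis abs_real_def add.commute diff_add_cancel minus_diff_eq mult_1 mult_minus1)
      have "z = Complex (Re z) (Im x + s * r)" using s(2) by (simp add: complex_eq_iff)
      then have "\<bar>?V z - ?V (Complex (Re x + 1 * r) (Im x + s * r))\<bar> \<le> 3 * \<Theta>"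
        using hor[OF s(1) range(1), of "Re x + 1 * r"] r by simp
      moreover have "\<bar>?V (Complex (Re x + 1 * r) (Im x + s * r)) - ?V c\<bar> \<le> 3 * \<Theta>"
        unfolding c_def using s(1) r by (intro ver) auto
      ultimately show ?thesis by linarith
    qed
  qed
  show ?thesis using corner[OF zw(1)] corner[OF zw(2)] by linarith
qed

text \<open>A generic horizontal line through \<open>Q i\<close> and a generic vertical line through
  \<open>Q j\<close> cross; with all oscillations zero, the line estimate holds with
  \<open>\<Theta> = 0\<close> on both, across any number of disks.\<close>

lemma disk_value_eq_if_osc_eq_0:
  assumes g: "g \<in> sobolev_loc v UNIV Q" and 0: "\<And>i. osc (Q i) g = 0"
  shows "disk_value g i = disk_value g j"
proof -
  let ?N = "\<lambda>d. {h. \<not> good_line g d h}"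
  have sum0: "(\<Sum>\<^sub>\<infinity>i\<in>I. osc (Q i) g) \<le> ennreal 0" for I using 0 by simp
  obtain h\<^sub>1 t\<^sub>1 where 1: "h\<^sub>1 \<notin> ?N True" "axis_line True h\<^sub>1 t\<^sub>1 \<in> Q i"
    using exists_axis_line_meeting_open[OF open_Q Q_nonempty negligible_not_good_line[OF g]] by blast
  obtain h\<^sub>2 t\<^sub>2 where 2: "h\<^sub>2 \<notin> ?N False" "axis_line False h\<^sub>2 t\<^sub>2 \<in> Q j"
    using exists_axis_line_meeting_open[OF open_Q Q_nonempty negligible_not_good_line[OF g]] by blast
  have "\<bar>extended_value g (axis_line True h\<^sub>1 t\<^sub>1) - extended_value g (axis_line True h\<^sub>1 h\<^sub>2)\<bar> \<le> 3 * 0"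
    by (rule extended_value_line_diff[OF g _ sum0, where a = "min t\<^sub>1 h\<^sub>2" and b = "max t\<^sub>1 h\<^sub>2"]) (use 1 in auto)
  moreover have "\<bar>extended_value g (axis_line False h\<^sub>2 t\<^sub>2) - extended_value g (axis_line False h\<^sub>2 h\<^sub>1)\<bar> \<le> 3 * 0"
    by (rule extended_value_line_diff[OF g _ sum0, where a = "min t\<^sub>2 h\<^sub>1" and b = "max t\<^sub>2 h\<^sub>1"]) (use 2 in auto)
  moreover have "axis_line False h\<^sub>2 h\<^sub>1 = axis_line True h\<^sub>1 h\<^sub>2" by (simp add: axis_line_def)
  ultimately show ?thesis using 1(2) 2(2) by (simp add: extended_value_disk)
qed

lemma avoid_finitely_many_disks:
  assumes "finite A" "x \<in> frontier (Q k)"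
  shows "\<exists>e>0. \<forall>i\<in>A - {k}. Q i \<inter> ball x e = {}"
proof -
  define U where "U = - (\<Union>i\<in>A - {k}. closure (Q i))"
  have "x \<in> closure (Q k)" using assms(2) frontier_subset_closure by blast
  then have "x \<in> U" using closure_Q_disjoint by (auto simp: U_def)
  moreover have "open U" unfolding U_def using assms(1) by (intro open_Compl closed_UN) auto
  ultimately obtain e where "0 < e" "ball x e \<subseteq> U" using open_contains_ball by blast
  then show ?thesis using closure_subset by (intro exI[of _ e]) (fastforce simp: U_def)
qed

end

section \<open>Accessible points\<close>

lemma eventually_disks_to:
  "eventually P (disks_to Q x \<gamma>) \<longleftrightarrow>
     (\<exists>\<epsilon>>0. \<forall>i\<in>hit Q (trace \<gamma>). Q i \<subseteq> ball x \<epsilon> \<longrightarrow> P i)"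
  unfolding disks_to_def
proof (subst eventually_INF_base)
  show "{0 :: real<..} \<noteq> {}" by auto
  show "\<exists>c\<in>{0<..}. principal {i \<in> hit Q (trace \<gamma>). Q i \<subseteq> ball x c}
      \<le> inf (principal {i \<in> hit Q (trace \<gamma>). Q i \<subseteq> ball x a}) (principal {i \<in> hit Q (trace \<gamma>). Q i \<subseteq> ball x b})"
    if "a \<in> {0<..}" "b \<in> {0<..}" for a b
    using that by (intro bexI[of _ "min a b"]) (auto simp: ball_min_Int)
qed (auto simp: eventually_principal)

lemma open_bounded_interval_eq:
  fixes I :: "real set"
  assumes "is_interval I" "open I" "bounded I" "I \<noteq> {}"
  obtains \<alpha> \<beta> where "\<alpha> < \<beta>" "I = {\<alpha><..<\<beta>}"
proof -
  have bdd: "bdd_below I" "bdd_above I"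
    using assms(3) by (auto intro: bounded_imp_bdd_below bounded_imp_bdd_above)
  have "I = {Inf I<..<Sup I}"
  proof (intro equalityI subsetI)
    fix t assume t: "t \<in> I"
    then obtain e where e: "0 < e" "ball t e \<subseteq> I" using assms(2) open_contains_ball by blast
    have "t - e / 2 \<in> I" "t + e / 2 \<in> I" using e by (auto intro!: subsetD[OF e(2)] simp: dist_real_def)
    then have "Inf I \<le> t - e / 2" "t + e / 2 \<le> Sup I" using bdd by (auto intro: cInf_lower cSup_upper)
    then show "t \<in> {Inf I<..<Sup I}" using e(1) by auto
  next
    fix t assume "t \<in> {Inf I<..<Sup I}"
    then obtain a b where "a \<in> I" "a < t" "b \<in> I" "t < b"
      using cInf_less_iff[OF assms(4) bdd(1)] less_cSup_iff[OF assms(4) bdd(2)] by auto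
    then show "t \<in> I" using assms(1) unfolding is_interval_1 by (meson less_imp_le)
  qed
  moreover have "Inf I < Sup I" using calculation assms(4) by (metis greaterThanLessThan_empty_iff not_le)
  ultimately show ?thesis using that by blast
qed

text \<open>The limit defining the normalized version sees only the positions of disks. Here
  closeness to \<open>x\<close> becomes closeness in parameter to an end of the curve that tends to
  \<open>x\<close>, which yields a piece staying near \<open>x\<close> and running into it.\<close>

lemma tail_near_accumulation_point:
  fixes f :: "real \<Rightarrow> complex"
  assumes \<gamma>: "is_curve (I, f)" "open I" and x: "x \<notin> f ` I" and e: "0 < e"
  obtains \<delta> where "0 < \<delta>" "\<And>t. t \<in> I \<Longrightarrow> dist (f t) x < \<delta> \<Longrightarrow>
    \<exists>J. t \<in> J \<and> is_interval J \<and> J \<subseteq> I \<and> f ` J \<subseteq> ball x e \<and> x \<in> closure (f ` J)"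
proof -
  obtain h where h: "continuous_on (closure I) h" "\<And>t. t \<in> I \<Longrightarrow> h t = f t" and I: "I \<noteq> {}" "is_interval I" "bounded I"
    using \<gamma>(1) unfolding is_curve_def by auto
  obtain \<alpha> \<beta> where ab: "\<alpha> < \<beta>" "I = {\<alpha><..<\<beta>}" using open_bounded_interval_eq[OF I(2) \<gamma>(2) I(3,1)] by blast
  have cont: "continuous_on {\<alpha>..\<beta>} h" using h(1) ab by simp
  then obtain \<kappa> where \<kappa>: "0 < \<kappa>" "\<And>s t. s \<in> {\<alpha>..\<beta>} \<Longrightarrow> t \<in> {\<alpha>..\<beta>} \<Longrightarrow> dist s t < \<kappa> \<Longrightarrow> dist (h s) (h t) < e"
    using compact_uniformly_continuous[OF cont compact_Icc] e unfolding uniformly_continuous_on_def by (metis dist_commute)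
  \<comment> \<open>Once the neighbourhoods of the ends mapped to \<open>x\<close> are removed, the
    image is compact and misses \<open>x\<close>, so it keeps a distance \<open>\<delta>\<close>.
    Parameters outside \<open>K\<close> are within \<open>\<kappa>\<close> of such an end.\<close>
  define K where "K = {if h \<alpha> = x then \<alpha> + \<kappa> else \<alpha> .. if h \<beta> = x then \<beta> - \<kappa> else \<beta>}"
  have K: "K \<subseteq> {\<alpha>..\<beta>}" using \<kappa>(1) by (auto simp: K_def split: if_splits)
  have "h t \<noteq> x" if t: "t \<in> K" for t
  proof -
    consider "t = \<alpha>" | "t = \<beta>" | "t \<in> I" using t K ab by fastforce
    then show ?thesis
    proof cases
      case 1
      then show ?thesis using t \<kappa>(1) by (auto simp: K_def split: if_splits)
    next
      case 2
      then show ?thesis using t \<kappa>(1) by (auto simp: K_def split: if_splits)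
    next
      case 3
      then show ?thesis using x h(2)[OF 3] by (metis imageI)
    qed
  qed
  then have "x \<notin> h ` K" by auto
  moreover have "compact (h ` K)"
    using continuous_on_subset[OF cont K] by (intro compact_continuous_image) (auto simp: K_def)
  then have "closed (h ` K)" by (rule compact_imp_closed)
  ultimately obtain \<delta> where \<delta>: "0 < \<delta>" "ball x \<delta> \<inter> h ` K = {}"
    by (metis Compl_iff Int_commute disjoint_eq_subset_Compl open_Compl open_contains_ball)
  show ?thesis
  proof (rule that[OF \<delta>(1)])
    fix t assume t: "t \<in> I" "dist (f t) x < \<delta>"
    then have "h t \<in> ball x \<delta>" using h(2)[OF t(1)] by (simp add: dist_commute)
    then have "t \<notin> K" using \<delta>(2) by blast
    then consider "h \<alpha> = x" "t < \<alpha> + \<kappa>" | "h \<beta> = x" "\<beta> - \<kappa> < t"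
      using t(1) ab by (auto simp: K_def split: if_splits)
    then obtain p J where pJ: "h p = x" "p \<in> {\<alpha>..\<beta>}" "t \<in> J" "is_interval J" "J \<subseteq> I" "\<And>s. s \<in> J \<Longrightarrow> dist s p < \<kappa>" "p \<in> closure J"
    proof cases
      case 1
      have "{\<alpha><..<min (\<alpha> + \<kappa>) \<beta>} \<subseteq> I" using ab by auto
      moreover have "\<alpha> \<in> closure {\<alpha><..<min (\<alpha> + \<kappa>) \<beta>}" using ab \<kappa>(1) by (subst closure_greaterThanLessThan) auto
      ultimately show ?thesis
        using 1 t(1) ab by (intro that[of \<alpha> "{\<alpha><..<min (\<alpha> + \<kappa>) \<beta>}"]) (auto simp: is_interval_1 dist_real_def)
    next
      case 2
      have "{max (\<beta> - \<kappa>) \<alpha><..<\<beta>} \<subseteq> I" using ab by auto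
      moreover have "\<beta> \<in> closure {max (\<beta> - \<kappa>) \<alpha><..<\<beta>}" using ab \<kappa>(1) by (subst closure_greaterThanLessThan) auto
      ultimately show ?thesis
        using 2 t(1) ab by (intro that[of \<beta> "{max (\<beta> - \<kappa>) \<alpha><..<\<beta>}"]) (auto simp: is_interval_1 dist_real_def)
    qed
    have fJ: "f ` J = h ` J" using h(2) pJ(5) by (auto intro!: image_cong)
    have "f ` J \<subseteq> ball x e"
    proof
      fix z assume "z \<in> f ` J"
      then obtain s where s: "s \<in> J" "z = h s" using fJ by auto
      then have "s \<in> {\<alpha>..\<beta>}" using pJ(5) ab by auto
      then have "dist (h s) (h p) < e" using \<kappa>(2) pJ(2,6) s(1) by blast
      then show "z \<in> ball x e" using s pJ(1) by (simp add: dist_commute)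
    qed
    moreover have "closure J \<subseteq> closure I" using pJ(5) by (rule closure_mono)
    then have "continuous_on (closure J) h" using h(1) continuous_on_subset by blast
    then have "h ` closure J \<subseteq> closure (h ` J)" by (rule image_closure_subset) (auto simp: closure_subset)
    then have "x \<in> closure (f ` J)" using pJ(1,7) fJ by auto
    ultimately show "\<exists>J. t \<in> J \<and> is_interval J \<and> J \<subseteq> I \<and> f ` J \<subseteq> ball x e \<and> x \<in> closure (f ` J)"
      using pJ(3-5) by blast
  qed
qed

context plane_carpet
begin

text \<open>\<open>Q k\<close> has \<open>x\<close> on its boundary and meets all small squares, so
  it is left out. The other disks near \<open>x\<close> carry little square oscillation, because
  finitely many of them can be avoided by shrinking the ball; length-area then yields a good
  radius.\<close>

lemma small_osc_square:
  assumes g: "g \<in> sobolev_loc v UNIV Q" and x: "x \<in> frontier (Q k)" and e: "0 < e" and l: "0 < l"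
    and E: "negligible E"
  shows "\<exists>r. 0 < r \<and> r < l \<and> r \<notin> E \<and>
    (\<Sum>\<^sub>\<infinity>i\<in>hit Q {z. sup_dist x z = r} - {k}. osc (Q i) g) \<le> ennreal e"
proof -
  obtain C where C: "0 < C" "\<And>(\<rho> :: nat \<Rightarrow> ennreal) x s (\<pi> :: complex \<Rightarrow> real). 0 < s \<Longrightarrow>
    (\<And>z w. \<bar>\<pi> z - \<pi> w\<bar> \<le> dist z w) \<Longrightarrow>
    \<exists>F. F \<in> borel_measurable borel \<and>
      (\<forall>h. (\<Sum>\<^sub>\<infinity>i\<in>{i. h \<in> \<pi> ` (Q i \<inter> ball x s)}. \<rho> i) \<le> F h) \<and>
      (\<integral>\<^sup>+h. F h \<partial>lborel)\<^sup>2 \<le> ennreal (C * s\<^sup>2) * (\<Sum>\<^sub>\<infinity>i\<in>hit Q (ball x s). (\<rho> i)\<^sup>2)"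
    by (rule length_area) blast
  \<comment> \<open>Makes \<open>C * s\<^sup>2 * \<tau>\<close> half of
    \<open>(e * (s / 2))\<^sup>2\<close>, whence the strict inequality below.\<close>
  define \<tau> where "\<tau> = e\<^sup>2 / (8 * C)"
  have \<tau>: "0 < \<tau>" using e C(1) by (simp add: \<tau>_def)
  define \<rho> where "\<rho> i = (if i = k then 0 else osc (Q i) g)" for i
  have fin: "(\<Sum>\<^sub>\<infinity>i\<in>hit Q (ball x 1). (osc (Q i) g)\<^sup>2) < \<infinity>"
    by (rule sobolev_loc_osc_finite[OF g]) simp
  have pos: "0 < ennreal \<tau>" using \<tau> by simp
  obtain A where "finite A" "A \<subseteq> hit Q (ball x 1)"
      "(\<Sum>\<^sub>\<infinity>i\<in>hit Q (ball x 1) - A. (osc (Q i) g)\<^sup>2) < ennreal \<tau>"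
    by (rule infsum_tail_ennreal[OF fin pos])
  then have A: "finite A" "(\<Sum>\<^sub>\<infinity>i\<in>hit Q (ball x 1) - A. (osc (Q i) g)\<^sup>2) < ennreal \<tau>"
    by simp_all
  obtain s\<^sub>0 where s\<^sub>0: "0 < s\<^sub>0" "\<And>i. i \<in> A - {k} \<Longrightarrow> Q i \<inter> ball x s\<^sub>0 = {}"
    using avoid_finitely_many_disks[OF A(1) x] by blast
  define s where "s = min (min s\<^sub>0 1) l"
  have s: "0 < s" "s \<le> s\<^sub>0" "s \<le> 1" "s \<le> l" using s\<^sub>0(1) l by (auto simp: s_def)
  have "(\<Sum>\<^sub>\<infinity>i\<in>hit Q (ball x s). (\<rho> i)\<^sup>2) \<le> (\<Sum>\<^sub>\<infinity>i\<in>hit Q (ball x 1) - A. (osc (Q i) g)\<^sup>2)"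
  proof -
    have "(\<Sum>\<^sub>\<infinity>i\<in>hit Q (ball x s). (\<rho> i)\<^sup>2) = (\<Sum>\<^sub>\<infinity>i\<in>hit Q (ball x s) - {k}. (\<rho> i)\<^sup>2)"
      by (rule infsum_zero_outside_ennreal) (auto simp: \<rho>_def)
    also have "\<dots> \<le> (\<Sum>\<^sub>\<infinity>i\<in>hit Q (ball x 1) - A. (osc (Q i) g)\<^sup>2)"
    proof (rule infsum_mono_ennreal)
      show "hit Q (ball x s) - {k} \<subseteq> hit Q (ball x 1) - A"
      proof
        fix i assume i: "i \<in> hit Q (ball x s) - {k}"
        have "ball x s \<subseteq> ball x s\<^sub>0" "ball x s \<subseteq> ball x 1" using s by auto
        then have "i \<in> hit Q (ball x 1)" "Q i \<inter> ball x s\<^sub>0 \<noteq> {}" using i by (auto simp: hit_def)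
        then show "i \<in> hit Q (ball x 1) - A" using s\<^sub>0(2) i by blast
      qed
    qed (auto simp: \<rho>_def)
    finally show ?thesis .
  qed
  then have small: "(\<Sum>\<^sub>\<infinity>i\<in>hit Q (ball x s). (\<rho> i)\<^sup>2) \<le> ennreal \<tau>" using A(2) by simp
  obtain F where F: "F \<in> borel_measurable borel"
    "\<And>h. (\<Sum>\<^sub>\<infinity>i\<in>{i. h \<in> sup_dist x ` (Q i \<inter> ball x s)}. \<rho> i) \<le> F h"
    "(\<integral>\<^sup>+h. F h \<partial>lborel)\<^sup>2 \<le> ennreal (C * s\<^sup>2) * (\<Sum>\<^sub>\<infinity>i\<in>hit Q (ball x s). (\<rho> i)\<^sup>2)"
    using C(2)[where \<rho> = \<rho> and x = x and s = s and \<pi> = "sup_dist x", OF s(1) sup_dist_Lipschitz] by blast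
  have "(\<integral>\<^sup>+h. F h \<partial>lborel)\<^sup>2 \<le> ennreal (C * s\<^sup>2) * ennreal \<tau>"
    using small by (intro order_trans[OF F(3)] mult_left_mono) auto
  also have "\<dots> = ennreal (C * s\<^sup>2 * \<tau>)" using C(1) \<tau> by (simp add: ennreal_mult)
  also have "\<dots> < ennreal ((e * (s / 2))\<^sup>2)"
  proof (rule ennreal_lessI)
    have "C * s\<^sup>2 * \<tau> = e\<^sup>2 * s\<^sup>2 / 8" using C(1) by (simp add: \<tau>_def)
    moreover have "(e * (s / 2))\<^sup>2 = e\<^sup>2 * s\<^sup>2 / 4" by (simp add: power_mult_distrib power_divide)
    moreover have "0 < e\<^sup>2 * s\<^sup>2" using e s by simp
    ultimately show "C * s\<^sup>2 * \<tau> < (e * (s / 2))\<^sup>2" by linarith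
  qed (use e s in simp)
  \<comment> \<open>A square of radius below \<open>s / 2\<close> lies in \<open>ball x s\<close>,
    since distances are at most twice \<open>sup_dist\<close>.\<close>
  finally obtain r where r: "0 < r" "r < s / 2" "r \<notin> E" "F r \<le> ennreal e"
    using exists_small_value[OF F(1) E, of "s / 2" e] e s(1) by auto
  have "(\<Sum>\<^sub>\<infinity>i\<in>hit Q {z. sup_dist x z = r} - {k}. osc (Q i) g) \<le> (\<Sum>\<^sub>\<infinity>i\<in>{i. r \<in> sup_dist x ` (Q i \<inter> ball x s)}. \<rho> i)"
  proof (rule infsum_mono_ennreal)
    show "hit Q {z. sup_dist x z = r} - {k} \<subseteq> {i. r \<in> sup_dist x ` (Q i \<inter> ball x s)}"
    proof
      fix i assume "i \<in> hit Q {z. sup_dist x z = r} - {k}"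
      then obtain z where z: "z \<in> Q i" "sup_dist x z = r" by (auto simp: hit_def)
      then have "z \<in> ball x s" using dist_le_sup_dist[of x z] r(2) by simp
      then show "i \<in> {i. r \<in> sup_dist x ` (Q i \<inter> ball x s)}" using z by blast
    qed
  qed (auto simp: \<rho>_def)
  also have "\<dots> \<le> ennreal e" using F(2) r(4) by (rule order_trans)
  finally show ?thesis using r s by (intro exI[of _ r]) auto
qed

text \<open>From disk \<open>i\<close> the curve is followed towards \<open>x\<close>, at cost
  \<open>e\<close>, until it crosses a small square inside some disk \<open>j\<close>; along the
  square \<open>Q k\<close> is reached at cost \<open>12 * (disk_osc g k + e)\<close>.\<close>

lemma access_curve_estimate:
  assumes g: "g \<in> sobolev_loc v UNIV Q" and x: "x \<in> frontier (Q k)" and acc: "access_curve UNIV Q g x \<gamma>"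
    and e: "0 < e"
  shows "eventually (\<lambda>i. \<bar>disk_value g i - disk_value g k\<bar> \<le> 12 * disk_osc g k + 13 * e) (disks_to Q x \<gamma>)"
proof -
  obtain \<gamma>\<^sub>0 where \<gamma>\<^sub>0: "\<gamma>\<^sub>0 \<in> good_curves UNIV Q g"
    and cond: "if x \<in> trace \<gamma>\<^sub>0 \<inter> carpet_inner UNIV Q then \<gamma> = \<gamma>\<^sub>0
       else subcurve \<gamma> \<gamma>\<^sub>0 \<and> open_curve \<gamma> \<and> x \<in> closure (trace \<gamma>) - trace \<gamma> \<and>
            (\<forall>i. x \<in> frontier (Q i) \<longrightarrow> trace \<gamma> \<inter> Q i = {})"
    using acc unfolding access_curve_def by blast
  \<comment> \<open>A boundary point forces the second branch of \<open>access_curve\<close>, so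
    that \<open>\<gamma>\<close> avoids \<open>Q k\<close>.\<close>
  have "x \<notin> carpet_inner UNIV Q" using x by (auto simp: carpet_inner_def)
  then have \<gamma>: "subcurve \<gamma> \<gamma>\<^sub>0" "open_curve \<gamma>" "x \<notin> trace \<gamma>" "trace \<gamma> \<inter> Q k = {}" using cond x by auto
  obtain I f where If: "\<gamma> = (I, f)" by (cases \<gamma>)
  have c0: "is_curve \<gamma>\<^sub>0" and H0: "hausdorff_1 (trace \<gamma>\<^sub>0 \<inter> S) = 0"
    and diff: "\<And>\<gamma>' i j. subcurve \<gamma>' \<gamma>\<^sub>0 \<Longrightarrow> i \<in> hit Q (trace \<gamma>') \<Longrightarrow> j \<in> hit Q (trace \<gamma>') \<Longrightarrow>
      \<bar>max_disk (Q i) g - max_disk (Q j) g\<bar> \<le> enn2ereal (\<Sum>\<^sub>\<infinity>k\<in>hit Q (trace \<gamma>'). osc (Q k) g)"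
    and fin: "\<And>\<gamma>'. subcurve \<gamma>' \<gamma>\<^sub>0 \<Longrightarrow> compactly_contained (trace \<gamma>') UNIV \<Longrightarrow>
      (\<Sum>\<^sub>\<infinity>k\<in>hit Q (trace \<gamma>'). osc (Q k) g) < \<infinity>"
    using \<gamma>\<^sub>0 unfolding good_curves_def curves_in_def by blast+
  have I: "I \<noteq> {}" "is_interval I" "I \<subseteq> fst \<gamma>\<^sub>0" "f = snd \<gamma>\<^sub>0" "open I"
    using \<gamma>(1,2) If by (auto simp: subcurve_def open_curve_def)
  have c: "is_curve (I, f)"
  proof -
    obtain h where h: "continuous_on (closure (fst \<gamma>\<^sub>0)) h" "\<forall>t\<in>fst \<gamma>\<^sub>0. h t = snd \<gamma>\<^sub>0 t" "bounded (fst \<gamma>\<^sub>0)"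
      using c0 unfolding is_curve_def by blast
    have "continuous_on (closure I) h" using h(1) closure_mono[OF I(3)] continuous_on_subset by blast
    moreover have "bounded I" using h(3) I(3) bounded_subset by blast
    moreover have "\<forall>t\<in>I. h t = f t" using h(2) I(3,4) by blast
    ultimately show ?thesis using I(1,2) unfolding is_curve_def by auto
  qed
  have tr: "trace \<gamma> = f ` I" by (simp add: trace_def If)
  have "compactly_contained (trace \<gamma>) UNIV"
    using bounded_trace[OF c] by (simp add: compactly_contained_def compact_closure If)
  then have "(\<Sum>\<^sub>\<infinity>i\<in>hit Q (f ` I). osc (Q i) g) < \<infinity>" using fin[OF \<gamma>(1)] by (simp add: tr)
  then obtain A where A: "finite A" "A \<subseteq> hit Q (f ` I)" "(\<Sum>\<^sub>\<infinity>i\<in>hit Q (f ` I) - A. osc (Q i) g) < ennreal e"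
    using infsum_tail_ennreal[of "\<lambda>i. osc (Q i) g" "hit Q (f ` I)" "ennreal e"] e by auto
  \<comment> \<open>\<open>Q k\<close> comes arbitrarily close to \<open>x\<close>; as
    \<open>\<gamma>\<close> misses it, it is not in \<open>A\<close>, and all disks of
    \<open>A\<close> can be kept away from \<open>x\<close>.\<close>
  have "k \<notin> A" using A(2) \<gamma>(4) by (auto simp: hit_def tr)
  then obtain d where d: "0 < d" "\<And>i. i \<in> A \<Longrightarrow> Q i \<inter> ball x d = {}"
    using avoid_finitely_many_disks[OF A(1) x] by auto
  have xI: "x \<notin> f ` I" using \<gamma>(3) by (simp add: tr)
  obtain \<delta> where \<delta>: "0 < \<delta>" "\<And>t. t \<in> I \<Longrightarrow> dist (f t) x < \<delta> \<Longrightarrow>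
    \<exists>J. t \<in> J \<and> is_interval J \<and> J \<subseteq> I \<and> f ` J \<subseteq> ball x d \<and> x \<in> closure (f ` J)"
    using tail_near_accumulation_point[OF c I(5) xI d(1)] by blast
  show ?thesis
    unfolding eventually_disks_to
  proof (intro exI conjI ballI impI)
    show "0 < \<delta>" by (rule \<delta>(1))
    fix i assume i: "i \<in> hit Q (trace \<gamma>)" "Q i \<subseteq> ball x \<delta>"
    then obtain t where t: "t \<in> I" "f t \<in> Q i" by (auto simp: tr hit_def)
    then have "dist (f t) x < \<delta>" using i(2) by (auto simp: dist_commute)
    then obtain J where J: "t \<in> J" "is_interval J" "J \<subseteq> I" "f ` J \<subseteq> ball x d" "x \<in> closure (f ` J)"
      using \<delta>(2)[OF t(1)] by blast
    have subJ: "subcurve (J, f) \<gamma>\<^sub>0" using J I by (auto simp: subcurve_def)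
    have trJ: "trace (J, f) = f ` J" by (simp add: trace_def)
    have sumJ: "(\<Sum>\<^sub>\<infinity>i\<in>hit Q (f ` J). osc (Q i) g) \<le> ennreal e"
    proof -
      have "hit Q (f ` J) \<subseteq> hit Q (f ` I) - A"
      proof
        fix m assume "m \<in> hit Q (f ` J)"
        then obtain s where s: "s \<in> J" "f s \<in> Q m" by (auto simp: hit_def)
        have "f s \<in> Q m \<inter> ball x d" using s J(4) by blast
        then have "m \<notin> A" using d(2) by blast
        moreover have "f s \<in> Q m \<inter> f ` I" using s J(3) by blast
        ultimately show "m \<in> hit Q (f ` I) - A" by (auto simp: hit_def)
      qed
      then have "(\<Sum>\<^sub>\<infinity>i\<in>hit Q (f ` J). osc (Q i) g) \<le> (\<Sum>\<^sub>\<infinity>i\<in>hit Q (f ` I) - A. osc (Q i) g)"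
        by (rule infsum_mono_ennreal) simp
      then show ?thesis using A(3) by simp
    qed
    have contJ: "continuous_on J f"
      using curve_continuous_on[OF c] J(3) continuous_on_subset by auto
    have "connected ((\<lambda>s. sup_dist x (f s)) ` J)"
    proof (intro connected_continuous_image)
      show "continuous_on J (\<lambda>s. sup_dist x (f s))"
        by (rule continuous_on_compose2[OF continuous_on_sup_dist contJ]) auto
      show "connected J" using J(2) by (simp add: is_interval_connected)
    qed
    have ft: "0 < sup_dist x (f t)"
      using xI t(1) sup_dist_nonneg[of x "f t"] sup_dist_eq_0_iff[of x "f t"] by (metis imageI less_eq_real_def)
    have cross: "\<exists>s\<in>J. sup_dist x (f s) = r" if r: "0 < r" "r < sup_dist x (f t)" for r
    proof -
      obtain z where z: "z \<in> f ` J" "dist z x < r" using J(5) r(1) unfolding closure_approachable by blast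
      then obtain s where s: "s \<in> J" "z = f s" by blast
      then have "sup_dist x (f s) < r" using z(2) sup_dist_le[of x z] by (simp add: dist_commute)
      then have "{sup_dist x (f s)..sup_dist x (f t)} \<subseteq> (\<lambda>s. sup_dist x (f s)) ` J"
        by (intro connected_contains_Icc[OF \<open>connected ((\<lambda>s. sup_dist x (f s)) ` J)\<close>]) (use s J(1) in auto)
      then have "r \<in> (\<lambda>s. sup_dist x (f s)) ` J" using r \<open>sup_dist x (f s) < r\<close> by auto
      then show ?thesis by auto
    qed
    \<comment> \<open>\<open>p\<close> provides a radius below which every square around
      \<open>x\<close> meets \<open>Q k\<close>: this disk is connected and accumulates at
      \<open>x\<close>.\<close>
    obtain p where p: "p \<in> Q k" "p \<noteq> x"
    proof -
      obtain p where "p \<in> Q k" using Q_nonempty by blast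
      moreover have "x \<notin> Q k" using x in_S_notin_Q frontier_subset_S by blast
      ultimately show ?thesis using that by blast
    qed
    then have kp: "0 < sup_dist x p"
      using sup_dist_nonneg[of x p] sup_dist_eq_0_iff[of x p] by (metis less_eq_real_def)
    have crossk: "k \<in> hit Q {z. sup_dist x z = r}" if r: "0 < r" "r < sup_dist x p" for r
    proof -
      have conn: "connected (sup_dist x ` Q k)" by (intro connected_continuous_image continuous_on_sup_dist) auto
      have "x \<in> closure (Q k)" using x frontier_subset_closure by blast
      then obtain z where z: "z \<in> Q k" "dist z x < r" using r(1) unfolding closure_approachable by blast
      then have "sup_dist x z < r" using sup_dist_le[of x z] by (simp add: dist_commute)
      moreover have "{sup_dist x z..sup_dist x p} \<subseteq> sup_dist x ` Q k"
        by (intro connected_contains_Icc[OF conn]) (use z p in auto)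
      ultimately have "r \<in> sup_dist x ` Q k" using r by auto
      then show ?thesis by (auto simp: hit_def)
    qed
    define N where "N d = {h. \<not> good_line g d h}" for d
    have N: "negligible (N d)" for d unfolding N_def by (rule negligible_not_good_line[OF g])
    \<comment> \<open>Radii to avoid: those at which \<open>\<gamma>\<^sub>0\<close> meets the
      carpet, so that the crossing point lies in a disk, and those with a side on a line that is not
      good.\<close>
    define E where "E = sup_dist x ` (trace \<gamma>\<^sub>0 \<inter> S) \<union> {r. Im x + 1 * r \<in> N True} \<union> {r. Im x + (-1) * r \<in> N True}
      \<union> {r. Re x + 1 * r \<in> N False} \<union> {r. Re x + (-1) * r \<in> N False}"
    have "negligible E"
      unfolding E_def using negligible_image_if_hausdorff_1_eq_0[OF H0 sup_dist_Lipschitz]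
      by (intro negligible_Un negligible_affine_preimage N) auto
    then obtain r where r: "0 < r" "r < min (sup_dist x (f t)) (sup_dist x p)" "r \<notin> E"
      "(\<Sum>\<^sub>\<infinity>i\<in>hit Q {z. sup_dist x z = r} - {k}. osc (Q i) g) \<le> ennreal e"
      using small_osc_square[OF g x e, of "min (sup_dist x (f t)) (sup_dist x p)" E] ft kp by auto
    define \<Theta> where "\<Theta> = disk_osc g k + e"
    have o: "0 \<le> disk_osc g k" by (rule disk_value_osc(3)[OF g])
    then have \<Theta>: "0 \<le> \<Theta>" using e by (simp add: \<Theta>_def)
    have sum: "(\<Sum>\<^sub>\<infinity>i\<in>hit Q {z. sup_dist x z = r}. osc (Q i) g) \<le> ennreal \<Theta>"
    proof -
      have "(\<Sum>\<^sub>\<infinity>i\<in>hit Q {z. sup_dist x z = r}. osc (Q i) g)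
          \<le> (\<Sum>\<^sub>\<infinity>i\<in>{k} \<union> (hit Q {z. sup_dist x z = r} - {k}). osc (Q i) g)"
        by (rule infsum_mono_ennreal) auto
      also have "\<dots> \<le> (\<Sum>\<^sub>\<infinity>i\<in>{k}. osc (Q i) g) + (\<Sum>\<^sub>\<infinity>i\<in>hit Q {z. sup_dist x z = r} - {k}. osc (Q i) g)"
        by (rule infsum_Un_le_ennreal)
      also have "\<dots> \<le> ennreal (disk_osc g k) + ennreal e"
        using r(4) disk_value_osc(2)[OF g, of k] by (intro add_mono) auto
      also have "\<dots> = ennreal \<Theta>" using o e by (simp add: \<Theta>_def)
      finally show ?thesis .
    qed
    have lines: "good_line g True (Im x + s * r) \<and> good_line g False (Re x + s * r)" if "s = 1 \<or> s = -1" for s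
      using r(3) that by (auto simp: E_def N_def)
    obtain s where s: "s \<in> J" "sup_dist x (f s) = r" using cross r by auto
    have "f s \<notin> S"
    proof
      assume "f s \<in> S"
      then have "f s \<in> trace \<gamma>\<^sub>0 \<inter> S" using s(1) J(3) I(3,4) by (auto simp: trace_def)
      then have "r \<in> sup_dist x ` (trace \<gamma>\<^sub>0 \<inter> S)" using s(2) by blast
      then show False using r(3) by (simp add: E_def)
    qed
    then obtain j where j: "f s \<in> Q j" using not_in_S by blast
    obtain q where q: "q \<in> Q k" "sup_dist x q = r" using crossk[of r] r by (auto simp: hit_def)
    have "\<bar>extended_value g (f s) - extended_value g q\<bar> \<le> 12 * \<Theta>"
      by (rule extended_value_square_diff[OF g lines sum \<Theta> r(1) s(2) q(2)])
    then have jk: "\<bar>disk_value g j - disk_value g k\<bar> \<le> 12 * \<Theta>"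
      by (simp add: extended_value_disk[OF j] extended_value_disk[OF q(1)])
    have "\<bar>disk_value g i - disk_value g j\<bar> \<le> e"
    proof -
      have "i \<in> hit Q (trace (J, f))" "j \<in> hit Q (trace (J, f))"
        using t(2) J(1) j s(1) by (auto simp: hit_def trJ)
      from diff[OF subJ this] have "\<bar>ereal (disk_value g i) - ereal (disk_value g j)\<bar>
          \<le> enn2ereal (\<Sum>\<^sub>\<infinity>k\<in>hit Q (f ` J). osc (Q k) g)"
        by (simp only: trJ disk_value_osc(1)[OF g])
      then have "ennreal \<bar>disk_value g i - disk_value g j\<bar> \<le> (\<Sum>\<^sub>\<infinity>k\<in>hit Q (f ` J). osc (Q k) g)"
        by (simp only: abs_ereal_diff_le_iff)
      then have "ennreal \<bar>disk_value g i - disk_value g j\<bar> \<le> ennreal e" using sumJ by (rule order_trans)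
      then show ?thesis using e by (simp add: ennreal_le_iff)
    qed
    then show "\<bar>disk_value g i - disk_value g k\<bar> \<le> 12 * disk_osc g k + 13 * e"
      using jk by (simp add: \<Theta>_def)
  qed
qed

end

text \<open>A real value excludes the trivial filter, over which \<open>Liminf\<close> is infinite;
  hence \<open>Liminf\<close> is at most \<open>Limsup\<close> and the upper bound follows as
  well.\<close>

lemma Liminf_real_bounds:
  assumes "Liminf F f = ereal y" "eventually (\<lambda>i. ereal a \<le> f i \<and> f i \<le> ereal b) F"
  shows "a \<le> y" "y \<le> b"
proof -
  have "F \<noteq> bot" using assms(1) by (auto simp: top_ereal_def)
  have "ereal a \<le> Liminf F f" by (rule Liminf_bounded) (use assms(2) in \<open>auto elim: eventually_mono\<close>)
  then show "a \<le> y" using assms(1) by simp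
  have "Liminf F f \<le> Limsup F f" using \<open>F \<noteq> bot\<close> by (rule Liminf_le_Limsup)
  also have "\<dots> \<le> ereal b" by (rule Limsup_bounded) (use assms(2) in \<open>auto elim: eventually_mono\<close>)
  finally show "y \<le> b" using assms(1) by simp
qed

section \<open>Recovering all values of the normalized function\<close>

context plane_carpet
begin

lemma access_value_eq:
  assumes "x \<in> accessible UNIV Q g"
  obtains \<gamma> where "access_curve UNIV Q g x \<gamma>" "access_value UNIV Q g x = Liminf (disks_to Q x \<gamma>) (\<lambda>i. max_disk (Q i) g)"
proof -
  have "access_curve UNIV Q g x (SOME \<gamma>. access_curve UNIV Q g x \<gamma>)"
    using assms unfolding accessible_def by (auto intro: someI_ex)
  then show ?thesis using that by (simp add: access_value_def)
qed

text \<open>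
  As \<open>u\<close> is real-valued, none of the limits defining it is taken along a trivial filter, where it
  would be infinite. In particular every peripheral circle contains accessible points.
\<close>

lemma normalized_eq_constant:
  fixes u :: "complex \<Rightarrow> real"
  assumes g: "g \<in> sobolev_loc v UNIV Q"
    and u: "\<And>x. x \<in> S \<Longrightarrow> ereal (u x) = normalized_version UNIV Q g x"
    and c: "\<And>i x. x \<in> frontier (Q i) \<Longrightarrow> u x = c"
    and y: "y \<in> S"
  shows "u y = c"
proof -
  let ?A = "accessible UNIV Q g"
  have AS: "?A \<subseteq> S" by (auto simp: accessible_def access_curve_def)
  have uA: "ereal (u x) = access_value UNIV Q g x" if "x \<in> ?A" for x
    using u[of x] AS that by (auto simp: normalized_version_def)
  have max: "max_disk (Q i) g = ereal (disk_value g i)" for i by (rule disk_value_osc(1)[OF g])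
  \<comment> \<open>The link between \<open>u\<close> and \<open>g\<close>: an accessible point of
    the boundary of \<open>Q k\<close> has the value \<open>c\<close>, and the limit defining that
    value stays close to the disk value of \<open>g\<close> at \<open>k\<close>.\<close>
  have near: "\<bar>c - disk_value g k\<bar> \<le> 12 * disk_osc g k" for k
  proof -
    have "\<exists>x. x \<in> ?A \<inter> frontier (Q k)"
    proof (rule ccontr)
      assume "\<not> ?thesis"
      then have empty: "?A \<inter> frontier (Q k) = {}" by blast
      obtain x where x: "x \<in> frontier (Q k)" using frontier_Q_nonempty by blast
      then have "(THE i. x \<in> frontier (Q i)) = k" using frontier_Q_disjoint by (intro the_equality) auto
      then have "normalized_version UNIV Q g x = Liminf (at x within {}) (access_value UNIV Q g)"
        using empty x by (auto simp: normalized_version_def)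
      then have "ereal (u x) = \<infinity>"
        using u[of x] frontier_subset_S x by (auto simp: top_ereal_def)
      then show False by simp
    qed
    then obtain x where x: "x \<in> ?A" "x \<in> frontier (Q k)" by blast
    obtain \<gamma> where \<gamma>: "access_curve UNIV Q g x \<gamma>"
      "access_value UNIV Q g x = Liminf (disks_to Q x \<gamma>) (\<lambda>i. max_disk (Q i) g)"
      by (rule access_value_eq[OF x(1)])
    have lim: "Liminf (disks_to Q x \<gamma>) (\<lambda>i. ereal (disk_value g i)) = ereal c"
      using \<gamma>(2) uA[OF x(1)] c[OF x(2)] by (simp add: max)
    have "\<bar>c - disk_value g k\<bar> \<le> 12 * disk_osc g k + 13 * e" if e: "0 < e" for e
    proof -
      have ev: "eventually (\<lambda>i. ereal (disk_value g k - (12 * disk_osc g k + 13 * e)) \<le> ereal (disk_value g i) \<and>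
          ereal (disk_value g i) \<le> ereal (disk_value g k + (12 * disk_osc g k + 13 * e))) (disks_to Q x \<gamma>)"
        by (rule eventually_mono[OF access_curve_estimate[OF g x(2) \<gamma>(1) e]]) auto
      show ?thesis using Liminf_real_bounds[OF lim ev] by linarith
    qed
    then have "\<bar>c - disk_value g k\<bar> \<le> 12 * disk_osc g k + e" if "0 < e" for e
      using that spec[of "\<lambda>e. 0 < e \<longrightarrow> \<bar>c - disk_value g k\<bar> \<le> 12 * disk_osc g k + 13 * e" "e / 13"] by auto
    then show ?thesis by (rule field_le_epsilon)
  qed
  have acc: "u x = c" if x: "x \<in> ?A" for x
  proof -
    obtain \<gamma> where \<gamma>: "access_curve UNIV Q g x \<gamma>"
      "access_value UNIV Q g x = Liminf (disks_to Q x \<gamma>) (\<lambda>i. max_disk (Q i) g)"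
      by (rule access_value_eq[OF x])
    have lim: "Liminf (disks_to Q x \<gamma>) (\<lambda>i. ereal (disk_value g i)) = ereal (u x)"
      using \<gamma>(2) uA[OF x] by (simp add: max)
    have xS: "x \<in> S" using x AS by blast
    have "\<bar>u x - c\<bar> \<le> e" if e: "0 < e" for e
    proof -
      have fin: "(\<Sum>\<^sub>\<infinity>i\<in>hit Q (ball x 1). (osc (Q i) g)\<^sup>2) < \<infinity>" by (rule sobolev_loc_osc_finite[OF g]) simp
      \<comment> \<open>The 12 is the constant in \<open>near\<close>: disks outside the finite set
        \<open>B\<close> chosen below will satisfy \<open>12 * disk_osc g i \<le> e\<close>.\<close>
      have pos: "0 < ennreal ((e / 12)\<^sup>2)" using e by simp
      obtain B where "finite B" "B \<subseteq> hit Q (ball x 1)"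
          "(\<Sum>\<^sub>\<infinity>i\<in>hit Q (ball x 1) - B. (osc (Q i) g)\<^sup>2) < ennreal ((e / 12)\<^sup>2)"
        by (rule infsum_tail_ennreal[OF fin pos])
      then have B: "finite B" "(\<Sum>\<^sub>\<infinity>i\<in>hit Q (ball x 1) - B. (osc (Q i) g)\<^sup>2) < ennreal ((e / 12)\<^sup>2)"
        by simp_all
      define z where "z i = (SOME z. z \<in> Q i)" for i
      have z: "z i \<in> Q i" for i unfolding z_def using Q_nonempty by (meson ex_in_conv someI_ex)
      have zx: "0 < dist x (z i)" for i using z[of i] in_S_notin_Q[OF xS, of i] by (metis zero_less_dist_iff)
      \<comment> \<open>A disk of \<open>B\<close> contains a point at distance at least
        \<open>\<epsilon>\<close> from \<open>x\<close>, so it never lies in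
        \<open>ball x \<epsilon>\<close>. The 1 ensures that the disks that do are among those
        meeting \<open>ball x 1\<close>.\<close>
      define \<epsilon> where "\<epsilon> = Min (insert 1 ((\<lambda>i. dist x (z i)) ` B))"
      have \<epsilon>: "0 < \<epsilon>" "\<epsilon> \<le> 1" "\<And>i. i \<in> B \<Longrightarrow> \<epsilon> \<le> dist x (z i)"
        using B(1) zx by (auto simp: \<epsilon>_def)
      have "eventually (\<lambda>i. ereal (c - e) \<le> ereal (disk_value g i) \<and> ereal (disk_value g i) \<le> ereal (c + e))
          (disks_to Q x \<gamma>)"
        unfolding eventually_disks_to
      proof (intro exI[of _ \<epsilon>] conjI \<epsilon>(1) ballI impI)
        fix i assume i: "Q i \<subseteq> ball x \<epsilon>"
        then have "z i \<in> ball x \<epsilon>" using z by blast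
        then have "i \<notin> B" "i \<in> hit Q (ball x 1)" using \<epsilon>(2) \<epsilon>(3)[of i] z[of i] by (auto simp: hit_def)
        then have "(osc (Q i) g)\<^sup>2 \<le> (\<Sum>\<^sub>\<infinity>i\<in>hit Q (ball x 1) - B. (osc (Q i) g)\<^sup>2)"
          by (intro infsum_ge_member_ennreal) auto
        then have "(ennreal (disk_osc g i))\<^sup>2 \<le> ennreal ((e / 12)\<^sup>2)"
          using B(2) disk_value_osc(2)[OF g, of i] by simp
        then have "ennreal (disk_osc g i) \<le> ennreal (e / 12)" by (rule ennreal_le_of_square_le) (use e in simp)
        then have "12 * disk_osc g i \<le> e" using e by (simp add: ennreal_le_iff)
        then have "c - e \<le> disk_value g i" "disk_value g i \<le> c + e"
          using near[of i] by linarith+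
        then show "ereal (c - e) \<le> ereal (disk_value g i)" "ereal (disk_value g i) \<le> ereal (c + e)"
          by simp_all
      qed
      from Liminf_real_bounds[OF lim this] show ?thesis by linarith
    qed
    then have "\<bar>u x - c\<bar> \<le> 0" using field_le_epsilon[of "\<bar>u x - c\<bar>" 0] by simp
    then show ?thesis by simp
  qed
  \<comment> \<open>At such points \<open>u\<close> is a lower limit, along a nontrivial filter, of
    values already known to be \<open>c\<close>.\<close>
  have nonacc: "u y = c" if lim: "ereal (u y) = Liminf (at y within X) (access_value UNIV Q g)" and "X \<subseteq> ?A" for X
  proof -
    have "at y within X \<noteq> bot" using lim by (auto simp: top_ereal_def)
    have "Liminf (at y within X) (access_value UNIV Q g) = Liminf (at y within X) (\<lambda>_. ereal c)"
    proof (rule Liminf_eq)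
      show "\<forall>\<^sub>F x in at y within X. access_value UNIV Q g x = ereal c"
        unfolding eventually_at_filter using acc uA \<open>X \<subseteq> ?A\<close> by (intro always_eventually) (metis subsetD)
    qed
    then show ?thesis using lim \<open>at y within X \<noteq> bot\<close> by (simp add: Liminf_const)
  qed
  show ?thesis
  proof (cases "y \<in> ?A")
    case False
    show ?thesis
    proof (cases "\<exists>i. y \<in> frontier (Q i)")
      case True
      then show ?thesis using c by blast
    next
      case no_frontier: False
      then show ?thesis using nonacc[of ?A] u[OF y] False by (simp add: normalized_version_def)
    qed
  qed (rule acc)
qed

end

theorem corollary2p79:
  fixes Q :: "nat \<Rightarrow> complex set" and u :: "complex \<Rightarrow> real" and v :: carpet_version
  assumes "relative_sierpinski_carpet UNIV Q"
    and "carpet_harmonic v UNIV Q (\<lambda>x. ereal (u x))"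
    and "normalized v UNIV Q (\<lambda>x. ereal (u x))"
    and "(\<exists>B. \<forall>x\<in>carpet UNIV Q. u x \<le> B) \<or> (\<exists>B. \<forall>x\<in>carpet UNIV Q. B \<le> u x)"
  shows "\<exists>c. \<forall>x\<in>carpet UNIV Q. u x = c"
proof -
  interpret plane_carpet Q by unfold_locales (rule assms(1))
  let ?u = "\<lambda>x. ereal (u x)"
  have su: "?u \<in> sobolev_loc v UNIV Q" using assms(2) by (simp add: carpet_harmonic_def)
  have osc0: "osc (Q i) ?u = 0" for i by (rule harmonic_osc_eq_0[OF assms(2,4)])
  define c where "c = disk_value ?u 0"
  have "u x = c" if "x \<in> frontier (Q i)" for i x
  proof -
    have "disk_osc ?u i = 0" using disk_value_osc(2,3)[OF su, of i] osc0[of i] by simp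
    then have "disk_value ?u i = u x" using disk_value_osc(4)[OF su that] by simp
    then show ?thesis using disk_value_eq_if_osc_eq_0[OF su osc0, of i 0] by (simp add: c_def)
  qed
  moreover obtain g where "g \<in> sobolev_loc v UNIV Q" "\<forall>x\<in>S. ?u x = normalized_version UNIV Q g x"
    using assms(3) unfolding normalized_def by blast
  ultimately have "\<forall>x\<in>S. u x = c" using normalized_eq_constant by blast
  then show ?thesis by blast
qed

end
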